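(* Let $k\ge 3$ and $G\in\mathcal{G}_k$. Then $G$ has a decomposition $\mathcal{D}$ into paths, each of length in $\{2k-1,2k,2k+1\}$, such that the number of paths in $\mathcal{D}$ of length $2k-1$ equals the number of paths in $\mathcal{D}$ of length $2k+1$.
   Context: All graphs are finite and simple. The girth of a graph is the length of a shortest cycle; the length of a path or cycle is its number of edges. For an integer $k\ge 3$, $\mathcal{G}_k$ denotes the class of all $2k$-regular graphs of girth at least $2k-2$ that admit a pair of disjoint perfect matchings. A decomposition of a graph is a set of subgraphs whose edge sets partition its edge set. *)

theory Defs
  imports Main
begin

definition simple_graph :: "'a set \<Rightarrow> 'a set set \<Rightarrow> bool" where
  "simple_graph V E \<longleftrightarrow> finite V \<and>
     (\<forall>e\<in>E. \<exists>u v. e = {u, v} \<and> u \<noteq> v \<and> u \<in> V \<and> v \<in> V)"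

definition degree :: "'a set set \<Rightarrow> 'a \<Rightarrow> nat" where
  "degree E v = card {e\<in>E. v \<in> e}"

definition regular :: "'a set \<Rightarrow> 'a set set \<Rightarrow> nat \<Rightarrow> bool" where
  "regular V E d \<longleftrightarrow> (\<forall>v\<in>V. degree E v = d)"

definition is_walk :: "'a set set \<Rightarrow> 'a list \<Rightarrow> bool" where
  "is_walk E xs \<longleftrightarrow> (\<forall>i. Suc i < length xs \<longrightarrow> {xs ! i, xs ! Suc i} \<in> E)"

definition is_cycle :: "'a set set \<Rightarrow> 'a list \<Rightarrow> bool" where
  "is_cycle E xs \<longleftrightarrow> distinct xs \<and> length xs \<ge> 3 \<and> is_walk E xs \<and> {last xs, hd xs} \<in> E"

text \<open>Girth at least g: every cycle has length at least g (acyclic graphs have infinite girth).\<close>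
definition girth_at_least :: "'a set set \<Rightarrow> nat \<Rightarrow> bool" where
  "girth_at_least E g \<longleftrightarrow> (\<forall>xs. is_cycle E xs \<longrightarrow> length xs \<ge> g)"

definition perfect_matching :: "'a set \<Rightarrow> 'a set set \<Rightarrow> 'a set set \<Rightarrow> bool" where
  "perfect_matching V E M \<longleftrightarrow> M \<subseteq> E \<and> (\<forall>v\<in>V. \<exists>!e. e \<in> M \<and> v \<in> e)"

definition class_G :: "nat \<Rightarrow> 'a set \<Rightarrow> 'a set set \<Rightarrow> bool" where
  "class_G k V E \<longleftrightarrow> simple_graph V E \<and> regular V E (2 * k) \<and> girth_at_least E (2 * k - 2) \<and>
     (\<exists>M1 M2. perfect_matching V E M1 \<and> perfect_matching V E M2 \<and> M1 \<inter> M2 = {})"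

definition path_edges :: "'a list \<Rightarrow> 'a set set" where
  "path_edges xs = {{xs ! i, xs ! Suc i} | i. Suc i < length xs}"

text \<open>P is (the edge set of) a path subgraph of G with at least one edge; its length is card P.\<close>
definition is_path_in :: "'a set set \<Rightarrow> 'a set set \<Rightarrow> bool" where
  "is_path_in E P \<longleftrightarrow> (\<exists>xs. distinct xs \<and> length xs \<ge> 2 \<and> is_walk E xs \<and> P = path_edges xs)"

definition decomposition :: "'a set set \<Rightarrow> 'a set set set \<Rightarrow> bool" where
  "decomposition E D \<longleftrightarrow> \<Union>D = E \<and> (\<forall>P\<in>D. \<forall>Q\<in>D. P \<noteq> Q \<longrightarrow> P \<inter> Q = {})"

end

theory Submission
  imports Defs "HOL-Library.Multiset"
begin

text \<open>Deleting both matchings leaves a \<open>(2 * k - 2)\<close>-regular graph, which is a union of \<open>k - 1\<close> permutations.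
  Following the first \<open>k - 3\<close> of them from both ends of every edge of the first matching and adding one edge of
  each of the last two at both ends gives \<open>card V div 2\<close> trails on \<open>2 * k\<close> vertices covering everything but the
  second matching. By the girth condition only their extreme vertices can coincide; exchanging and reversing
  the last two permutations (a choice minimising the number of coincidences) and rerouting turns all of them
  into paths. The edges of the second matching are then distributed: each end of such an edge is the end of
  exactly one path, and each edge is absorbed by the two paths at its ends, after a local rerouting if
  necessary. So every path gains at most two vertices, and since there are \<open>2 * k\<close> edges per path on average,
  the short and the long paths are equally many.\<close>

section \<open>Edge multisets of vertex lists\<close>

text \<open>The constant \<open>k - 3\<close> is dictated by the girth: two trails on
  \<open>k - 2\<close> vertices, joined by a matching edge and prolonged by two vertices at each
  end, have \<open>2 * k\<close> vertices, and equal vertices of a trail are at least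
  \<open>2 * k - 2\<close> steps apart, so only three pairs of positions can coincide. Rerouting a
  trail that closes up takes the last edge of some trail end, and an end cannot both take and give;
  an odd cycle of such dependencies would be an obstacle, and the extremal choice of the last two
  permutations serves to exclude all cycles longer than two. For the second matching the obstacle is
  an edge joining the two ends of one path: it closes that path to a cycle and cannot be shared by
  two paths, so these cycles are opened with the help of other paths before the remaining edges are
  absorbed. Both there and in the absorption, two chords from the start of a path force
  \<open>4 * k - 7 \<le> 2 * k\<close>, so \<open>k = 3\<close> is the one value with exceptional
  configurations. Edges are kept in multisets because inclusion in \<open>mset_set E\<close>
  expresses that no edge is repeated, within a path or between paths.\<close>

fun el :: "'a list \<Rightarrow> 'a set multiset" where
  "el (x # y # zs) = add_mset {x, y} (el (y # zs))"
| "el _ = {#}"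

lemma el_append: "el (xs @ y # ys) = el (xs @ [y]) + el (y # ys)"
  by (induction xs rule: induct_list012) auto

lemma el_snoc: "el (xs @ [x, y]) = add_mset {x, y} (el (xs @ [x]))"
  using el_append[of xs x "[y]"] by simp

lemma el_snoc_last: "xs \<noteq> [] \<Longrightarrow> el (xs @ [y]) = add_mset {last xs, y} (el xs)"
  by (cases xs rule: rev_cases) (simp_all add: el_snoc)

lemma el_rev: "el (rev xs) = el xs"
proof (induction xs rule: el.induct)
  case (1 x y zs)
  have "el (rev (x # y # zs)) = el (rev zs @ [y, x])" by simp
  also have "\<dots> = add_mset {y, x} (el (rev zs @ [y]))" by (rule el_snoc)
  finally show ?case using 1 by (simp add: insert_commute)
qed auto

lemma size_el: "size (el xs) = length xs - 1"
  by (induction xs rule: el.induct) auto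

lemma set_el: "set_mset (el xs) = path_edges xs"
proof (induction xs rule: el.induct)
  case (1 x y zs)
  have "path_edges (x # y # zs) = insert {x, y} (path_edges (y # zs))"
    unfolding path_edges_def
  proof (intro set_eqI iffI, goal_cases)
    case (1 e)
    then obtain i where i: "e = {(x # y # zs) ! i, (x # y # zs) ! Suc i}" "Suc i < length (x # y # zs)"
      by blast
    then show ?case
    proof (cases i)
      case 0
      then show ?thesis using i by simp
    next
      case (Suc j)
      then have "e = {(y # zs) ! j, (y # zs) ! Suc j} \<and> Suc j < length (y # zs)" using i by simp
      then show ?thesis by blast
    qed
  next
    case (2 e)
    then consider "e = {x, y}" | j where "e = {(y # zs) ! j, (y # zs) ! Suc j}" "Suc j < length (y # zs)"
      by blast
    then show ?case
    proof cases
      case 1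
      then have "e = {(x # y # zs) ! 0, (x # y # zs) ! Suc 0} \<and> Suc 0 < length (x # y # zs)" by simp
      then show ?thesis by blast
    next
      case 2
      then have "e = {(x # y # zs) ! Suc j, (x # y # zs) ! Suc (Suc j)} \<and> Suc (Suc j) < length (x # y # zs)"
        by simp
      then show ?thesis by blast
    qed
  qed
  then show ?case using 1 by simp
qed (auto simp: path_edges_def)

lemma el_sub_append1: "el xs \<subseteq># el (xs @ ys)"
proof (cases ys)
  case (Cons y zs)
  have "el xs \<subseteq># el (xs @ [y])"
    by (induction xs rule: el.induct) (auto simp: el.simps)
  then show ?thesis using el_append[of xs y zs] Cons by (simp add: subset_mset.add_increasing2)
qed simp

lemma el_sub_append2: "el ys \<subseteq># el (xs @ ys)"
proof -
  have "el (rev ys) \<subseteq># el (rev ys @ rev xs)" by (rule el_sub_append1)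
  then have "el (rev ys) \<subseteq># el (rev (xs @ ys))" by simp
  then show ?thesis by (simp only: el_rev)
qed

lemma el_sub_take: "el (take n xs) \<subseteq># el xs"
  using el_sub_append1[of "take n xs" "drop n xs"] by simp

lemma el_sub_drop: "el (drop n xs) \<subseteq># el xs"
  using el_sub_append2[of "drop n xs" "take n xs"] by simp

lemma el_slice: "el (take m (drop n xs)) \<subseteq># el xs"
  by (rule subset_mset.order_trans[OF el_sub_take el_sub_drop])

section \<open>Trails in graphs of large girth\<close>

locale girth_graph =
  fixes E :: "'a set set" and k :: nat
  assumes finE: "finite E"
    and edgeE: "e \<in> E \<Longrightarrow> \<exists>u v. e = {u, v} \<and> u \<noteq> v"
    and girth: "girth_at_least E (2 * k - 2)"
    and k3: "3 \<le> k"
begin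

text \<open>Multiset inclusion says both that every step is an edge of \<open>E\<close> and that no
  edge is used twice.\<close>

abbreviation trail :: "'a list \<Rightarrow> bool" where
  "trail xs \<equiv> el xs \<subseteq># mset_set E"

lemma sub_E_mem: "M \<subseteq># mset_set E \<Longrightarrow> e \<in># M \<Longrightarrow> e \<in> E"
  using finE by (metis elem_mset_set mset_subset_eqD)

lemma sub_E_count: "M \<subseteq># mset_set E \<Longrightarrow> count M e \<le> 1"
  using finE by (metis count_mset_set(1,3) mset_subset_eq_count le_trans nat_le_linear zero_le)

lemma edge_neq: "{x, y} \<in> E \<Longrightarrow> x \<noteq> y"
  using edgeE[of "{x, y}"] by (auto simp: doubleton_eq_iff)

lemma trail_walk:
  assumes "trail xs" "Suc i < length xs"
  shows "{xs ! i, xs ! Suc i} \<in> E"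
proof -
  have "{xs ! i, xs ! Suc i} \<in># el xs" unfolding set_el path_edges_def using assms(2) by blast
  then show ?thesis using assms(1) sub_E_mem by blast
qed

lemma trail_nth_neq: "trail xs \<Longrightarrow> Suc i < length xs \<Longrightarrow> xs ! i \<noteq> xs ! Suc i"
  using trail_walk edge_neq by blast

lemma trail_sub: "trail xs \<Longrightarrow> el ys \<subseteq># el xs \<Longrightarrow> trail ys"
  using subset_mset.order_trans by blast

lemma trail_nth_neq2:
  assumes "trail xs" "Suc (Suc i) < length xs"
  shows "xs ! i \<noteq> xs ! Suc (Suc i)"
proof
  assume eq: "xs ! i = xs ! Suc (Suc i)"
  have d: "take 3 (drop i xs) = [xs ! i, xs ! Suc i, xs ! Suc (Suc i)]"
    using assms(2) by (simp add: take_Suc_conv_app_nth numeral_3_eq_3 Cons_nth_drop_Suc[symmetric])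
  have "el (take 3 (drop i xs)) \<subseteq># mset_set E" using assms(1) el_slice subset_mset.order_trans by blast
  then have "count (el [xs ! i, xs ! Suc i, xs ! i]) {xs ! i, xs ! Suc i} \<le> 1"
    unfolding d eq[symmetric] by (rule sub_E_count)
  then show False by (simp add: insert_commute)
qed

lemma cycle_length: "distinct xs \<Longrightarrow> 3 \<le> length xs \<Longrightarrow> trail xs \<Longrightarrow> {last xs, hd xs} \<in> E \<Longrightarrow> 2 * k - 2 \<le> length xs"
  using girth trail_walk unfolding girth_at_least_def is_cycle_def is_walk_def by blast

text \<open>A closest pair of equal vertices bounds a cycle, to which the girth applies; the
  induction descends to such a pair. Distances 1 and 2 cannot occur, because edges have two ends and
  no edge is repeated.\<close>

lemma closed_trail:
  assumes "trail xs" "i < j" "j < length xs" "xs ! i = xs ! j"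
  shows "2 * k - 2 \<le> j - i"
  using assms(2-4)
proof (induction "j - i" arbitrary: i j rule: less_induct)
  case less
  show ?case
  proof (cases "\<exists>i' j'. i \<le> i' \<and> i' < j' \<and> j' \<le> j \<and> j' - i' < j - i \<and> xs ! i' = xs ! j'")
    case True
    then obtain i' j' where ij: "i \<le> i'" "i' < j'" "j' \<le> j" "j' - i' < j - i" "xs ! i' = xs ! j'" by blast
    then have "2 * k - 2 \<le> j' - i'" using less by auto
    then show ?thesis using ij by simp
  next
    case False
    define ys where "ys = take (j - i) (drop i xs)"
    have len: "length ys = j - i" unfolding ys_def using less.prems by simp
    have nth: "ys ! t = xs ! (i + t)" if "t < j - i" for t unfolding ys_def using that less.prems by simp
    have dist: "distinct ys"
    proof -
      have "ys ! s \<noteq> ys ! t" if "s < t" "t < j - i" for s t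
      proof
        assume "ys ! s = ys ! t"
        then have "xs ! (i + s) = xs ! (i + t)" using nth that by simp
        moreover have "i \<le> i + s" "i + s < i + t" "i + t \<le> j" "i + t - (i + s) < j - i" using that by auto
        ultimately show False using False by blast
      qed
      then show ?thesis unfolding distinct_conv_nth len by (metis linorder_neqE_nat)
    qed
    have tr: "trail ys" unfolding ys_def using assms(1) el_slice trail_sub by blast
    have ge3: "3 \<le> j - i"
    proof (rule ccontr)
      assume "\<not> 3 \<le> j - i"
      then have "j = Suc i \<or> j = Suc (Suc i)" using less.prems by auto
      then show False using trail_nth_neq[OF assms(1), of i] trail_nth_neq2[OF assms(1), of i] less.prems by auto
    qed
    have "last ys = xs ! (j - 1)" using nth[of "j - i - 1"] len ge3 by (subst last_conv_nth) auto
    moreover have "hd ys = xs ! j" using nth[of 0] len ge3 less.prems by (subst hd_conv_nth) auto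
    moreover have "{xs ! (j - 1), xs ! Suc (j - 1)} \<in> E" using trail_walk[OF assms(1), of "j - 1"] less.prems by simp
    ultimately have "{last ys, hd ys} \<in> E" using less.prems by simp
    then show ?thesis using cycle_length[OF dist _ tr] ge3 len by simp
  qed
qed

lemma trail_distinctI:
  assumes "trail xs"
    and "\<And>i j. i < j \<Longrightarrow> j < length xs \<Longrightarrow> 2 * k - 2 \<le> j - i \<Longrightarrow> xs ! i \<noteq> xs ! j"
  shows "distinct xs"
proof -
  have "xs ! i \<noteq> xs ! j" if "i < j" "j < length xs" for i j
    using closed_trail[OF assms(1) that] assms(2)[OF that] by blast
  then show ?thesis unfolding distinct_conv_nth by (metis linorder_neqE_nat)
qed

lemma short_trail_distinct: "trail xs \<Longrightarrow> length xs \<le> 2 * k - 2 \<Longrightarrow> distinct xs"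
  by (rule trail_distinctI) auto

text \<open>The girth is at least four because \<open>k\<close> is at least three.\<close>

lemma no_triangle:
  assumes "{x, y} \<in> E" "{y, z} \<in> E" "{x, z} \<in> E"
  shows False
proof -
  have ne: "x \<noteq> y" "y \<noteq> z" "x \<noteq> z" using assms edge_neq by auto
  have "el [x, y, z] = mset_set {{x, y}, {y, z}}" using ne by (auto simp: doubleton_eq_iff)
  also have "\<dots> \<subseteq># mset_set E" using assms finE by (intro subset_imp_msubset_mset_set) auto
  finally have "trail [x, y, z]" .
  from cycle_length[OF _ _ this] show False using ne assms k3 by (simp add: insert_commute)
qed

end

context girth_graph
begin

section \<open>Recombining paths\<close>

lemma mset_sub_E:
  assumes "mset es \<subseteq># mset_set E"
  shows "distinct es" "set es \<subseteq> E"
proof -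
  have "count (mset es) e \<le> 1" for e using sub_E_count[OF assms] .
  then show "distinct es" by (metis distinct_count_atmost_1 count_mset_0_iff le_neq_implies_less less_one zero_less_iff_neq_zero)
  show "set es \<subseteq> E" using sub_E_mem[OF assms] by auto
qed

text \<open>Putting the other end of the chord in front closes a trail with \<open>i + 1\<close>
  edges.\<close>

lemma chord_index:
  assumes "add_mset {a, (a # xs) ! i} (el (a # xs)) \<subseteq># mset_set E" "i < length (a # xs)"
  shows "2 * k - 3 \<le> i"
proof -
  have "trail ((a # xs) ! i # a # xs)" using assms(1) by (simp add: insert_commute)
  from closed_trail[OF this, of 0 "Suc i"] show ?thesis using assms(2) by simp
qed

text \<open>The two chords and the stretch of the path between them form a closed trail of
  \<open>j - i + 2\<close> edges. Together the bounds give \<open>4 * k - 7 \<le> j\<close>, which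
  on a path with at most \<open>2 * k + 1\<close> vertices is possible only for
  \<open>k = 3\<close>.\<close>

lemma chords_index:
  assumes sub: "add_mset {a, (a # xs) ! i} (add_mset {a, (a # xs) ! j} (el (a # xs))) \<subseteq># mset_set E"
    and ij: "i < j" "j < length (a # xs)"
  shows "2 * k - 3 \<le> i" "2 * k - 4 \<le> j - i"
proof -
  have "el (a # xs) \<subseteq># el (a # xs) + {#{a, (a # xs) ! j}#}" by (rule mset_subset_eq_add_left)
  then have "add_mset {a, (a # xs) ! i} (el (a # xs)) \<subseteq># add_mset {a, (a # xs) ! i} (add_mset {a, (a # xs) ! j} (el (a # xs)))"
    by simp
  from subset_mset.order_trans[OF this sub]
  have "add_mset {a, (a # xs) ! i} (el (a # xs)) \<subseteq># mset_set E" .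
  then show "2 * k - 3 \<le> i" using chord_index ij by simp
  define ys where "ys = take (Suc (j - i)) (drop i (a # xs))"
  have len: "length ys = Suc (j - i)" unfolding ys_def using ij by simp
  have hd: "hd ys = (a # xs) ! i" unfolding ys_def using ij by (simp add: hd_drop_conv_nth)
  have last: "last ys = (a # xs) ! j"
    using len ij by (subst last_conv_nth) (auto simp: ys_def)
  obtain zs where zs: "ys = hd ys # zs" using len by (cases ys) auto
  obtain ws where ws: "ys = ws @ [last ys]" using len by (metis append_butlast_last_id length_0_conv nat.simps(3))
  have "el (a # ys @ [a]) = add_mset {a, hd ys} (el (ys @ [a]))" using zs by (metis append_Cons el.simps(1))
  also have "el (ys @ [a]) = add_mset {last ys, a} (el ys)" using el_snoc[of ws "last ys" a] ws
    by (metis append.assoc append_Cons append_Nil)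
  finally have "el (a # ys @ [a]) = add_mset {a, hd ys} (add_mset {a, last ys} (el ys))"
    by (simp add: insert_commute)
  also have "\<dots> \<subseteq># add_mset {a, (a # xs) ! i} (add_mset {a, (a # xs) ! j} (el (a # xs)))"
    using el_slice[of "Suc (j - i)" i "a # xs"] unfolding hd last ys_def[symmetric] by simp
  finally have tr: "trail (a # ys @ [a])" using sub subset_mset.order_trans by blast
  have "2 * k - 2 \<le> length ys + 1 - 0"
    by (rule closed_trail[OF tr]) (auto simp: nth_append)
  then show "2 * k - 4 \<le> j - i" using len by simp
qed

text \<open>The last vertices are kept because further matching edges may have to be attached there.\<close>
definition merges :: "'a list \<Rightarrow> 'a list \<Rightarrow> 'a set multiset \<Rightarrow> bool" where
  "merges P Q M \<longleftrightarrow> (\<exists>R S. el R + el S = M \<and> distinct R \<and> distinct S \<and> 2 * k \<le> length R \<and> 2 * k \<le> length S \<and>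
     length R \<le> length P + 1 \<and> length S \<le> length Q + 1 \<and> last R = last P \<and> last S = last Q)"

lemma merges_sym: "merges P Q M \<Longrightarrow> merges Q P M"
  unfolding merges_def by (metis add.commute)

lemma merges_extend:
  assumes "b \<notin> set (a # xs)" "distinct (a # xs)" "distinct (b # ys)" "2 * k \<le> length (a # xs)" "2 * k \<le> length (b # ys)"
  shows "merges (a # xs) (b # ys) (add_mset {a, b} (el (a # xs) + el (b # ys)))"
  unfolding merges_def
  by (rule exI[of _ "b # a # xs"], rule exI[of _ "b # ys"]) (use assms in \<open>auto simp: insert_commute\<close>)

text \<open>A Posa rotation: adding the edge \<open>ab\<close> to the path from \<open>b\<close> and
  deleting the edge \<open>da\<close> before \<open>a\<close> leaves a path that starts at
  \<open>d\<close> and has the same last vertex. The deleted edge is written on the other side to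
  avoid subtraction.\<close>

lemma el_rotate:
  assumes "b # ys = us @ d # a # vs"
  shows "add_mset {a, d} (el (rev (us @ [d]) @ a # vs)) = add_mset {a, b} (el (b # ys))"
proof -
  obtain ws where ws: "us @ [d] = b # ws" using assms by (cases us) auto
  have "el (rev (us @ [d]) @ a # vs) = el (rev (us @ [d]) @ [a]) + el (a # vs)" by (rule el_append)
  also have "el (rev (us @ [d]) @ [a]) = add_mset {b, a} (el (us @ [d]))"
    using el_snoc[of "rev ws" b a] el_rev[of "b # ws"] by (simp add: ws del: rev_append)
  finally have 1: "el (rev (us @ [d]) @ a # vs) = add_mset {b, a} (el (us @ [d])) + el (a # vs)" .
  have "el (us @ d # a # vs) = el (us @ [d]) + el (d # a # vs)" by (rule el_append)
  then have "el (b # ys) = el (us @ [d]) + add_mset {d, a} (el (a # vs))" unfolding assms by simp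
  then show ?thesis using 1 by (simp add: insert_commute)
qed

text \<open>The lollipop formed by the second path and the new edge is cut at the other edge of its cycle
  at the first vertex of the first path, which then extends the first path.\<close>
lemma merges_rotate:
  assumes Q: "b # ys = us @ d # a # vs" and d: "d \<notin> set (a # xs)"
    and "distinct (a # xs)" "distinct (b # ys)" "2 * k \<le> length (a # xs)" "2 * k \<le> length (b # ys)"
  shows "merges (a # xs) (b # ys) (add_mset {a, b} (el (a # xs) + el (b # ys)))"
proof -
  let ?S = "rev (us @ [d]) @ a # vs"
  have dd: "distinct (us @ d # a # vs)" using assms(4) Q by simp
  have len: "length ?S = length (b # ys)" unfolding Q by simp
  have "last ?S = last (b # ys)" unfolding Q by simp
  moreover have "distinct ?S" using dd by auto
  moreover have "el (d # a # xs) + el ?S = add_mset {a, b} (el (a # xs) + el (b # ys))"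
    using el_rotate[OF Q] by (simp add: insert_commute)
  ultimately show ?thesis unfolding merges_def using len assms
    by (intro exI[of _ "d # a # xs"] exI[of _ ?S]) auto
qed

text \<open>One rotation on each side. After rotating the second path its start is \<open>d\<close>
  and the pending edge is \<open>ad\<close>; as \<open>d\<close> lies on the first path, that one
  can be rotated too, which frees the edge \<open>xd\<close> for the front of the second.\<close>

lemma merges_rotate2:
  assumes Q: "b # ys = us @ d # a # vs" and P: "a # xs = us' @ x # d # vs'" and x: "x \<notin> set (b # ys)"
    and dist: "distinct (a # xs)" "distinct (b # ys)" and len: "2 * k \<le> length (a # xs)" "2 * k \<le> length (b # ys)"
  shows "merges (a # xs) (b # ys) (add_mset {a, b} (el (a # xs) + el (b # ys)))"
proof -
  let ?S = "rev (us @ [d]) @ a # vs"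
  have S: "?S = d # rev us @ a # vs" by simp
  have "distinct (us @ d # a # vs)" using dist(2) Q by simp
  then have dS: "distinct ?S" by auto
  have lenS: "length ?S = length (b # ys)" and lastS: "last ?S = last (b # ys)" unfolding Q by simp_all
  have "set ?S = set (us @ d # a # vs)" by auto
  then have "x \<notin> set ?S" using x Q by metis
  then have "merges ?S (a # xs) (add_mset {d, a} (el ?S + el (a # xs)))"
    using merges_rotate[of a xs us' x d vs' "rev us @ a # vs"] P dist(1) dS len lenS unfolding S by simp
  moreover have "add_mset {d, a} (el ?S + el (a # xs)) = add_mset {a, b} (el (a # xs) + el (b # ys))"
    using el_rotate[OF Q] by (simp add: insert_commute ac_simps)
  ultimately have "merges ?S (a # xs) (add_mset {a, b} (el (a # xs) + el (b # ys)))" by (simp only:)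
  then have "merges (a # xs) ?S (add_mset {a, b} (el (a # xs) + el (b # ys)))" by (rule merges_sym)
  then show ?thesis unfolding merges_def lenS lastS .
qed

text \<open>The two stretches between the common vertices, joined end to end, form a closed trail.
  The sums of truncated differences are absolute values.\<close>

lemma two_paths_index:
  assumes sub: "el P + el Q \<subseteq># mset_set E"
    and m: "m < length P" "m' < length P" and n: "n < length Q" "n' < length Q"
    and eq: "P ! m = Q ! n" "P ! m' = Q ! n'" and ne: "m \<noteq> m'"
  shows "2 * k - 2 \<le> (m - m') + (m' - m) + ((n - n') + (n' - n))"
proof -
  define slice :: "'a list \<Rightarrow> nat \<Rightarrow> nat \<Rightarrow> 'a list"
    where "slice xs i j = take (Suc (j - i)) (drop i xs)" for xs i j
  have sl: "el (slice xs i j) \<subseteq># el xs" "length (slice xs i j) = Suc (j - i)"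
      "slice xs i j \<noteq> []" "hd (slice xs i j) = xs ! i" "last (slice xs i j) = xs ! j"
    if "i \<le> j" "j < length xs" for xs i j
  proof -
    show "el (slice xs i j) \<subseteq># el xs" unfolding slice_def by (rule el_slice)
    show l: "length (slice xs i j) = Suc (j - i)" unfolding slice_def using that by simp
    then show "slice xs i j \<noteq> []" by auto
    then show "hd (slice xs i j) = xs ! i" unfolding slice_def using that by (simp add: hd_drop_conv_nth)
    show "last (slice xs i j) = xs ! j" using l that by (subst last_conv_nth) (auto simp: slice_def)
  qed
  have key: "2 * k - 2 \<le> (length p - 1) + (length q - 1)"
    if p: "p \<noteq> []" "q \<noteq> []" "last p = hd q" "last q = hd p" "el p + el q \<subseteq># mset_set E" "2 \<le> length p" for p q :: "'a list"
  proof -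
    obtain p' y where p': "p = p' @ [y]" using p(1) by (cases p rule: rev_cases) auto
    obtain q' where q': "q = y # q'" using p(2,3) p' by (cases q) auto
    have "el (p @ q') = el p + el q" using el_append[of p' y q'] p' q' by simp
    then have tr: "trail (p @ q')" using p(5) by simp
    have "(p @ q') ! 0 = (p @ q') ! (length p + length q' - 1)"
    proof (cases q')
      case Nil
      then have "last q = y" using q' by simp
      then have "hd p = last p" using p p' by simp
      then show ?thesis using Nil p by (simp add: hd_conv_nth last_conv_nth)
    next
      case (Cons z zs)
      then have "last q = q' ! (length q' - 1)" using q' by (simp add: last_conv_nth)
      then show ?thesis using p Cons by (auto simp: nth_append hd_conv_nth)
    qed
    from closed_trail[OF tr _ _ this] show ?thesis using p q' by auto
  qed
  have sum: "el p + el q \<subseteq># mset_set E" if "el p \<subseteq># el P" "el q \<subseteq># el Q" for p q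
    using sub subset_mset.add_mono[OF that] subset_mset.order_trans by blast
  \<comment> \<open>The stretch of \<open>P\<close> leads from \<open>m\<close> to
    \<open>m'\<close>, that of \<open>Q\<close> back from \<open>n'\<close> to
    \<open>n\<close>.\<close>
  define p where "p = (if m < m' then slice P m m' else rev (slice P m' m))"
  define q where "q = (if n < n' then rev (slice Q n n') else slice Q n' n)"
  have "p \<noteq> []" "q \<noteq> []" "hd p = P ! m" "last p = P ! m'" "hd q = Q ! n'" "last q = Q ! n"
    "length p = Suc ((m - m') + (m' - m))" "length q = Suc ((n - n') + (n' - n))" "el p \<subseteq># el P" "el q \<subseteq># el Q"
    unfolding p_def q_def using m n ne by (auto simp: sl hd_rev last_rev el_rev)
  then show ?thesis using key[of p q] sum[of p q] eq ne by auto
qed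

section \<open>Adding an edge between two paths, and the configurations surviving for
  \<open>k = 3\<close>\<close>

lemma split_nth2:
  assumes "0 < i" "i < length xs"
  shows "xs = take (i - 1) xs @ xs ! (i - 1) # xs ! i # drop (Suc i) xs"
  using id_take_nth_drop[of "i - 1" xs] Cons_nth_drop_Suc[of i xs] assms by simp

text \<open>These are the coincidences that remain when all extensions and rotations are blocked.
  The thirteen edges are repartitioned explicitly into a path with six and a path with seven edges;
  the distinctness that does not come from \<open>P\<close> and \<open>Q\<close> holds because no
  edge is repeated and there are no triangles.\<close>

lemma merge_exceptions:
  assumes k: "k = 3" and sub: "add_mset {P ! 0, Q ! 0} (el P + el Q) \<subseteq># mset_set E"
    and dist: "distinct P" "distinct Q" and len: "length P = 7" "length Q = 7"
    and idx: "Q ! 0 = P ! r" "Q ! s = P ! 0" "Q ! (s - 1) = P ! j" "Q ! i = P ! (r - 1)" "Q ! t = P ! (j - 1)"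
    and cases: "(r, j, s, i, t) \<in> {(3, 6, 3, 6, 5), (3, 6, 6, 3, 2), (6, 3, 6, 3, 2)}"
  shows "merges P Q (add_mset {P ! 0, Q ! 0} (el P + el Q))"
proof -
  obtain p0 p1 p2 p3 p4 p5 p6 where P: "P = [p0, p1, p2, p3, p4, p5, p6]"
    using len(1) by (auto simp: length_Suc_conv eval_nat_numeral)
  obtain q0 q1 q2 q3 q4 q5 q6 where Q: "Q = [q0, q1, q2, q3, q4, q5, q6]"
    using len(2) by (auto simp: length_Suc_conv eval_nat_numeral)
  have es: "mset [{p0, q0}, {p0, p1}, {p1, p2}, {p2, p3}, {p3, p4}, {p4, p5}, {p5, p6},
        {q0, q1}, {q1, q2}, {q2, q3}, {q3, q4}, {q4, q5}, {q5, q6}] = add_mset {P ! 0, Q ! 0} (el P + el Q)"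
    unfolding P Q by simp
  have D: "distinct [{p0, q0}, {p0, p1}, {p1, p2}, {p2, p3}, {p3, p4}, {p4, p5}, {p5, p6},
        {q0, q1}, {q1, q2}, {q2, q3}, {q3, q4}, {q4, q5}, {q5, q6}]"
    "set [{p0, q0}, {p0, p1}, {p1, p2}, {p2, p3}, {p3, p4}, {p4, p5}, {p5, p6},
        {q0, q1}, {q1, q2}, {q2, q3}, {q3, q4}, {q4, q5}, {q5, q6}] \<subseteq> E"
    by (rule mset_sub_E; use sub in \<open>simp only: es\<close>)+
  from cases consider "r = 3" "j = 6" "s = 3" "i = 6" "t = 5" | "r = 3" "j = 6" "s = 6" "i = 3" "t = 2"
    | "r = 6" "j = 3" "s = 6" "i = 3" "t = 2" by auto
  then show ?thesis
  proof cases
    case 1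
    then have q: "q0 = p3" "q3 = p0" "q2 = p6" "q6 = p2" "q5 = p5" using idx P Q by auto
    have "{p0, p1} \<noteq> {q3, q4}" using D(1) by simp_all
    then have n1: "p1 \<noteq> q4" using q by auto
    have "{p1, p2} \<in> E" "{p2, p3} \<in> E" "{q0, q1} \<in> E" using D(2) by simp_all
    then have n2: "p1 \<noteq> q1" using no_triangle[of p1 p2 p3] q by (auto simp: insert_commute)
    show ?thesis unfolding merges_def
      by (rule exI[of _ "[p1, p2, p5, p4, p3, p0, p6]"], rule exI[of _ "[p1, p0, q4, p5, p6, q1, p3, p2]"], intro conjI)
        (use k P Q q n1 n2 dist in \<open>auto simp: insert_commute\<close>)
  next
    case 2
    then have q: "q0 = p3" "q6 = p0" "q5 = p6" "q3 = p2" "q2 = p5" using idx P Q by auto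
    have "{p1, p2} \<noteq> {q3, q4}" using D(1) by simp_all
    then have n1: "p1 \<noteq> q4" using q by auto
    have "{p2, p3} \<in> E" "{p3, p4} \<in> E" "{q3, q4} \<in> E" using D(2) by simp_all
    then have n2: "p4 \<noteq> q4" using no_triangle[of p2 p3 p4] q by (auto simp: insert_commute)
    show ?thesis unfolding merges_def
      by (rule exI[of _ "[q4, p2, p5, q1, p3, p0, p6]"], rule exI[of _ "[q4, p6, p5, p4, p3, p2, p1, p0]"], intro conjI)
        (use k P Q q n1 n2 dist in \<open>auto simp: insert_commute\<close>)
  next
    case 3
    then have q: "q0 = p6" "q6 = p0" "q5 = p3" "q3 = p5" "q2 = p2" using idx P Q by auto
    have "{p1, p2} \<noteq> {q1, q2}" using D(1) by simp_all
    then have n1: "p1 \<noteq> q1" using q by auto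
    have "{p0, p1} \<in> E" "{p2, p3} \<in> E" "{p3, p4} \<in> E" "{q1, q2} \<in> E" "{q4, q5} \<in> E" "{q5, q6} \<in> E"
      using D(2) by simp_all
    then have n2: "p4 \<noteq> q1" "p1 \<noteq> q4"
      using no_triangle[of p2 p3 p4] no_triangle[of p0 p1 p3] q by (auto simp: insert_commute)
    show ?thesis unfolding merges_def
      by (rule exI[of _ "[q1, p2, p5, p4, p3, p0, p6]"], rule exI[of _ "[q1, p6, p5, q4, p3, p2, p1, p0]"], intro conjI)
        (use k P Q q n1 n2 dist in \<open>auto simp: insert_commute\<close>)
  qed
qed

end

text \<open>The bound of \<open>two_paths_index\<close> for \<open>k = 3\<close>, as pure
  arithmetic: it relates two coincidences \<open>P ! m = Q ! n\<close> and
  \<open>P ! m' = Q ! n'\<close> of edge-disjoint paths.\<close>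

definition separated :: "nat \<Rightarrow> nat \<Rightarrow> nat \<Rightarrow> nat \<Rightarrow> bool" where
  "separated m n m' n' \<longleftrightarrow> (m = m' \<longleftrightarrow> n = n') \<and> (m = m' \<or> 4 \<le> (m - m') + (m' - m) + ((n - n') + (n' - n)))"

text \<open>A finite search. The listed pairs are the indices from 3 to 6 that differ by at least
  two, as \<open>chords_index\<close> demands for \<open>k = 3\<close>. Conditions free of
  \<open>t\<close> and \<open>w\<close> stand before the quantifiers over these, so that failing
  cases stop early.\<close>

lemma index_cases_compute:
  "\<forall>(r, j) \<in> set [(3, 5), (3, 6), (4, 6), (5, 3), (6, 3), (6, 4)].
   \<forall>(s, i) \<in> set [(3, 5), (3, 6), (4, 6), (5, 3), (6, 3), (6, 4)].
     separated 0 s r 0 \<longrightarrow> separated 0 s (r - 1) i \<longrightarrow> separated 0 s j (s - 1) \<longrightarrow>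
     separated r 0 (r - 1) i \<longrightarrow> separated r 0 j (s - 1) \<longrightarrow> separated (r - 1) i j (s - 1) \<longrightarrow>
     (\<forall>t \<in> set [0, 1, 2, 3, 4, 5, 6]. separated 0 s (j - 1) t \<longrightarrow> separated r 0 (j - 1) t \<longrightarrow>
        separated (r - 1) i (j - 1) t \<longrightarrow> separated j (s - 1) (j - 1) t \<longrightarrow>
     (\<forall>w \<in> set [0, 1, 2, 3, 4, 5, 6]. separated 0 s w (i - 1) \<longrightarrow> separated r 0 w (i - 1) \<longrightarrow>
        separated (r - 1) i w (i - 1) \<longrightarrow> separated j (s - 1) w (i - 1) \<longrightarrow> separated (j - 1) t w (i - 1) \<longrightarrow>
        (r, j, s, i, t, w) \<in> set [(3, 6, 3, 6, 5, 5), (3, 6, 6, 3, 2, 5), (6, 3, 3, 6, 5, 2), (6, 3, 6, 3, 2, 2)]))"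
  unfolding separated_def by code_simp

text \<open>Index 6 occurs on both sides in every surviving case, which is why both paths have seven
  vertices.\<close>

lemma index_cases:
  fixes r j s i t w l l' :: nat
  assumes "3 \<le> r" "3 \<le> j" "3 \<le> s" "3 \<le> i" "2 \<le> (r - j) + (j - r)" "2 \<le> (s - i) + (i - s)"
    and "r < l" "j < l" "w < l" "s < l'" "i < l'" "t < l'" "l \<le> 7" "l' \<le> 7"
    and "separated 0 s r 0" "separated 0 s (r - 1) i" "separated 0 s j (s - 1)" "separated 0 s (j - 1) t" "separated 0 s w (i - 1)"
      "separated r 0 (r - 1) i" "separated r 0 j (s - 1)" "separated r 0 (j - 1) t" "separated r 0 w (i - 1)"
      "separated (r - 1) i j (s - 1)" "separated (r - 1) i (j - 1) t" "separated (r - 1) i w (i - 1)"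
      "separated j (s - 1) (j - 1) t" "separated j (s - 1) w (i - 1)" "separated (j - 1) t w (i - 1)"
  shows "l = 7 \<and> l' = 7 \<and> (r, j, s, i, t, w) \<in> {(3, 6, 3, 6, 5, 5), (3, 6, 6, 3, 2, 5), (6, 3, 3, 6, 5, 2), (6, 3, 6, 3, 2, 2)}"
proof -
  have six: "x = 3 \<or> x = 4 \<or> x = 5 \<or> x = 6" if "3 \<le> x" "x < n" "n \<le> 7" for x n :: nat
    using that by linarith
  have rj: "(r, j) \<in> set [(3, 5), (3, 6), (4, 6), (5, 3), (6, 3), (6, 4)]"
    using six[OF assms(1,7,13)] six[OF assms(2,8,13)] assms(5) by (elim disjE) simp_all
  have si: "(s, i) \<in> set [(3, 5), (3, 6), (4, 6), (5, 3), (6, 3), (6, 4)]"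
    using six[OF assms(3,10,14)] six[OF assms(4,11,14)] assms(6) by (elim disjE) simp_all
  have seven: "x \<in> set [0, 1, 2, 3, 4, 5, 6]" if "x < n" "n \<le> 7" for x n :: nat
  proof -
    have "x = 0 \<or> x = 1 \<or> x = 2 \<or> x = 3 \<or> x = 4 \<or> x = 5 \<or> x = 6" using that by linarith
    then show ?thesis by simp
  qed
  note tw = seven[OF assms(12,14)] seven[OF assms(9,13)]
  note index_cases_compute[THEN bspec, OF rj, unfolded prod.case, THEN bspec, OF si, unfolded prod.case]
  from this[rule_format, OF assms(15,16,17,20,21,24) tw(1) assms(18,22,25,27) tw(2) assms(19,23,26,28,29)]
  have "(r, j, s, i, t, w) \<in> set [(3, 6, 3, 6, 5, 5), (3, 6, 6, 3, 2, 5), (6, 3, 3, 6, 5, 2), (6, 3, 6, 3, 2, 2)]" .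
  then show ?thesis using assms(7-14) by auto
qed

context girth_graph
begin

text \<open>If neither an extension nor a single or double rotation works, six coincidences are
  forced: the start of each path lies on the other path, so does the vertex before it there, and so
  does the vertex before the place where that one recurs. They give two chords at each start, hence
  \<open>k = 3\<close>, and the finite search applies.\<close>

lemma merges_all:
  assumes sub: "add_mset {a, b} (el (a # xs) + el (b # ys)) \<subseteq># mset_set E"
    and dist: "distinct (a # xs)" "distinct (b # ys)"
    and len: "2 * k \<le> length (a # xs)" "2 * k \<le> length (b # ys)" "length (a # xs) \<le> 2 * k + 1" "length (b # ys) \<le> 2 * k + 1"
  shows "merges (a # xs) (b # ys) (add_mset {a, b} (el (a # xs) + el (b # ys)))"
proof (rule ccontr)
  assume no: "\<not> merges (a # xs) (b # ys) (add_mset {a, b} (el (a # xs) + el (b # ys)))"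
  define P Q where "P = a # xs" and "Q = b # ys"
  have no': "\<not> merges (b # ys) (a # xs) (add_mset {b, a} (el (b # ys) + el (a # xs)))"
    using no merges_sym by (metis add.commute insert_commute)
  have dP: "distinct P" and dQ: "distinct Q" using dist unfolding P_def Q_def by auto
  have sub': "add_mset {a, b} (el P + el Q) \<subseteq># mset_set E" using sub unfolding P_def Q_def .
  have ab: "a \<noteq> b" using sub_E_mem[OF sub, of "{a, b}"] edge_neq by auto
  have "b \<in> set P" using merges_extend[OF _ dist len(1,2)] no unfolding P_def by blast
  then obtain r where r: "r < length P" "P ! r = b" by (auto simp: in_set_conv_nth)
  have "a \<in> set Q" using merges_extend[OF _ dist(2,1) len(2,1)] no' unfolding Q_def by blast
  then obtain s where s: "s < length Q" "Q ! s = a" by (auto simp: in_set_conv_nth)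
  have r0: "0 < r" using r ab by (cases r) (auto simp: P_def)
  have s0: "0 < s" using s ab by (cases s) (auto simp: Q_def)
  have Ps: "P = take (r - 1) P @ P ! (r - 1) # b # drop (Suc r) P" using split_nth2[OF r0 r(1)] r(2) by simp
  have Qs: "Q = take (s - 1) Q @ Q ! (s - 1) # a # drop (Suc s) Q" using split_nth2[OF s0 s(1)] s(2) by simp
  have "Q ! (s - 1) \<in> set P"
    using merges_rotate[OF _ _ dist len(1,2), of _ "Q ! (s - 1)"] no Qs unfolding P_def Q_def by blast
  then obtain j where j: "j < length P" "P ! j = Q ! (s - 1)" by (auto simp: in_set_conv_nth)
  have "P ! (r - 1) \<in> set Q"
    using merges_rotate[OF _ _ dist(2,1) len(2,1), of _ "P ! (r - 1)"] no' Ps unfolding P_def Q_def by blast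
  then obtain i where i: "i < length Q" "Q ! i = P ! (r - 1)" by (auto simp: in_set_conv_nth)
  have P0: "P ! 0 = a" and Q0: "Q ! 0 = b" unfolding P_def Q_def by auto
  have j0: "0 < j"
  proof (rule ccontr)
    assume "\<not> 0 < j"
    then have "Q ! (s - 1) = Q ! s" using j s P0 by simp
    then show False using nth_eq_iff_index_eq[OF dQ, of "s - 1" s] less_imp_diff_less[OF s(1), of 1] s s0 by auto
  qed
  have i0: "0 < i"
  proof (rule ccontr)
    assume "\<not> 0 < i"
    then have "P ! (r - 1) = P ! r" using i r Q0 by simp
    then show False using nth_eq_iff_index_eq[OF dP, of "r - 1" r] less_imp_diff_less[OF r(1), of 1] r r0 by auto
  qed
  have adj: "{P ! j, a} \<in># el Q" "{P ! (r - 1), b} \<in># el P"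
  proof -
    have "{Q ! (s - 1), Q ! Suc (s - 1)} \<in> path_edges Q" unfolding path_edges_def using s s0 by (intro CollectI exI[of _ "s - 1"]) simp
    then show "{P ! j, a} \<in># el Q" using s s0 j by (simp add: set_el)
    have "{P ! (r - 1), P ! Suc (r - 1)} \<in> path_edges P" unfolding path_edges_def using r r0 by (intro CollectI exI[of _ "r - 1"]) simp
    then show "{P ! (r - 1), b} \<in># el P" using r r0 by (simp add: set_el)
  qed
  \<comment> \<open>The pending edge and the edge of \<open>Q\<close> leading to \<open>a\<close>
    are two chords of \<open>P\<close> at its start.\<close>
  have cP: "add_mset {a, P ! r} (add_mset {a, P ! j} (el P)) \<subseteq># mset_set E"
  proof -
    have "{#{a, P ! j}#} \<subseteq># el Q" using adj(1) by (simp add: insert_commute)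
    then have "el P + {#{a, P ! j}#} \<subseteq># el P + el Q" by simp
    then have "add_mset {a, P ! r} (add_mset {a, P ! j} (el P)) \<subseteq># add_mset {a, b} (el P + el Q)" using r by simp
    then show ?thesis using sub' by (rule subset_mset.order_trans)
  qed
  have cQ: "add_mset {b, Q ! s} (add_mset {b, Q ! i} (el Q)) \<subseteq># mset_set E"
  proof -
    have "{#{b, Q ! i}#} \<subseteq># el P" using adj(2) i by (simp add: insert_commute)
    then have "{#{b, Q ! i}#} + el Q \<subseteq># el P + el Q" by simp
    then have "add_mset {b, Q ! s} (add_mset {b, Q ! i} (el Q)) \<subseteq># add_mset {a, b} (el P + el Q)" using s by (simp add: insert_commute)
    then show ?thesis using sub' by (rule subset_mset.order_trans)
  qed
  have rj: "2 * k - 3 \<le> r" "2 * k - 3 \<le> j" "2 * k - 4 \<le> (r - j) + (j - r)"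
  proof -
    have "r \<noteq> j" using sub_E_count[OF cP, of "{a, P ! r}"] by auto
    then have "2 * k - 3 \<le> r \<and> 2 * k - 3 \<le> j \<and> 2 * k - 4 \<le> (r - j) + (j - r)"
    proof (cases "r < j")
      case True
      then show ?thesis using chords_index[of a xs r j] cP j unfolding P_def by auto
    next
      case False
      then have "j < r" using \<open>r \<noteq> j\<close> by simp
      then show ?thesis using chords_index[of a xs j r] cP r unfolding P_def by (auto simp: add_mset_commute)
    qed
    then show "2 * k - 3 \<le> r" "2 * k - 3 \<le> j" "2 * k - 4 \<le> (r - j) + (j - r)" by auto
  qed
  have si: "2 * k - 3 \<le> s" "2 * k - 3 \<le> i" "2 * k - 4 \<le> (s - i) + (i - s)"
  proof -
    have "s \<noteq> i" using sub_E_count[OF cQ, of "{b, Q ! s}"] by auto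
    then have "2 * k - 3 \<le> s \<and> 2 * k - 3 \<le> i \<and> 2 * k - 4 \<le> (s - i) + (i - s)"
    proof (cases "s < i")
      case True
      then show ?thesis using chords_index[of b ys s i] cQ i unfolding Q_def by auto
    next
      case False
      then have "i < s" using \<open>s \<noteq> i\<close> by simp
      then show ?thesis using chords_index[of b ys i s] cQ s unfolding Q_def by (auto simp: add_mset_commute)
    qed
    then show "2 * k - 3 \<le> s" "2 * k - 3 \<le> i" "2 * k - 4 \<le> (s - i) + (i - s)" by auto
  qed
  have lPQ: "length P \<le> 2 * k + 1" "length Q \<le> 2 * k + 1" using len unfolding P_def Q_def by auto
  have k: "k = 3" using rj r j k3 lPQ by linarith
  have Pj: "P = take (j - 1) P @ P ! (j - 1) # Q ! (s - 1) # drop (Suc j) P" using split_nth2[OF j0 j(1)] j(2) by simp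
  have Qi: "Q = take (i - 1) Q @ Q ! (i - 1) # P ! (r - 1) # drop (Suc i) Q" using split_nth2[OF i0 i(1)] i(2) by simp
  have "P ! (j - 1) \<in> set Q"
    using merges_rotate2[of b ys "take (s - 1) Q" "Q ! (s - 1)" a "drop (Suc s) Q" xs "take (j - 1) P" "P ! (j - 1)" "drop (Suc j) P"]
      no Qs Pj dist len unfolding P_def[symmetric] Q_def[symmetric] by blast
  then obtain t where t: "t < length Q" "Q ! t = P ! (j - 1)" by (auto simp: in_set_conv_nth)
  have "Q ! (i - 1) \<in> set P"
    using merges_rotate2[of a xs "take (r - 1) P" "P ! (r - 1)" b "drop (Suc r) P" ys "take (i - 1) Q" "Q ! (i - 1)" "drop (Suc i) Q"]
      no' Ps Qi dist len unfolding P_def[symmetric] Q_def[symmetric] by blast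
  then obtain w where w: "w < length P" "P ! w = Q ! (i - 1)" by (auto simp: in_set_conv_nth)
  have subPQ: "el P + el Q \<subseteq># mset_set E"
    by (rule subset_mset.order_trans[OF _ sub']) (metis add_mset_add_single mset_subset_eq_add_left)
  have sep: "separated m n m' n'" if "m < length P" "n < length Q" "m' < length P" "n' < length Q" "P ! m = Q ! n" "P ! m' = Q ! n'" for m n m' n'
  proof -
    have "m = m' \<longleftrightarrow> n = n'"
      using nth_eq_iff_index_eq[OF dP that(1,3)] nth_eq_iff_index_eq[OF dQ that(2,4)] that(5,6) by simp
    moreover have "4 \<le> (m - m') + (m' - m) + ((n - n') + (n' - n))" if "m \<noteq> m'"
      using two_paths_index[OF subPQ \<open>m < length P\<close> \<open>m' < length P\<close> \<open>n < length Q\<close> \<open>n' < length Q\<close> \<open>P ! m = Q ! n\<close> \<open>P ! m' = Q ! n'\<close> that] k by simp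
    ultimately show ?thesis unfolding separated_def by blast
  qed
  have lt: "0 < length P" "0 < length Q" "r - 1 < length P" "s - 1 < length Q" "j - 1 < length P" "i - 1 < length Q"
    using r s j i by auto
  have eqs: "P ! 0 = Q ! s" "P ! r = Q ! 0" "P ! (r - 1) = Q ! i" "P ! j = Q ! (s - 1)" "P ! (j - 1) = Q ! t" "P ! w = Q ! (i - 1)"
    using r s j i t w P0 Q0 by auto
  have *: "length P = 7 \<and> length Q = 7 \<and> (r, j, s, i, t, w) \<in> {(3, 6, 3, 6, 5, 5), (3, 6, 6, 3, 2, 5), (6, 3, 3, 6, 5, 2), (6, 3, 6, 3, 2, 2)}"
  proof (rule index_cases)
    show "3 \<le> r" "3 \<le> j" "3 \<le> s" "3 \<le> i" "2 \<le> (r - j) + (j - r)" "2 \<le> (s - i) + (i - s)"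
      using rj si unfolding k by simp_all
    show "length P \<le> 7" "length Q \<le> 7" using lPQ unfolding k by simp_all
  qed (rule sep, (fact | rule r j s i t w lt eqs eqs[symmetric])+ | rule r j s i t w)+
  show False
  proof (cases "(r, j, s, i, t) = (6, 3, 3, 6, 5)")
    case False
    then have "merges P Q (add_mset {P ! 0, Q ! 0} (el P + el Q))"
      using * sub' P0 Q0 eqs by (intro merge_exceptions[OF k _ dP dQ, of r s j i t]) auto
    then show False using no P0 Q0 unfolding P_def Q_def by simp
  next
    case True
    \<comment> \<open>Exchanging the two paths maps \<open>(r, j, s, i, t, w)\<close> to
      \<open>(s, i, r, j, w, t)\<close>, which turns this case into
      \<open>(3, 6, 6, 3, 2)\<close>.\<close>
    have "merges Q P (add_mset {Q ! 0, P ! 0} (el Q + el P))"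
      using * True sub' P0 Q0 eqs by (intro merge_exceptions[OF k _ dQ dP, of s r i j w]) (auto simp: ac_simps insert_commute)
    then show False using no' P0 Q0 unfolding P_def Q_def by simp
  qed
qed

end

section \<open>Edge multisets of closed lists\<close>

definition cyc :: "'a list \<Rightarrow> 'a set multiset" where
  "cyc xs = el (xs @ [hd xs])"

lemma cyc_Cons: "cyc (x # xs) = el (x # xs @ [x])"
  by (simp add: cyc_def)

lemma cyc_eq: "xs \<noteq> [] \<Longrightarrow> cyc xs = add_mset {last xs, hd xs} (el xs)"
  using el_snoc[of "butlast xs" "last xs" "hd xs"] append_butlast_last_id[of xs]
  by (metis append.assoc append_Cons append_Nil cyc_def)

lemma cyc_rotate: "cyc (us @ vs) = cyc (vs @ us)"
proof (cases "us = [] \<or> vs = []")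
  case False
  then obtain u us' v vs' where uv: "us = u # us'" "vs = v # vs'" by (metis neq_Nil_conv)
  have "cyc (us @ vs) = el ((u # us') @ v # vs' @ [u])" using uv by (simp add: cyc_def)
  also have "\<dots> = el (u # us' @ [v]) + el (v # vs' @ [u])" using el_append[of "u # us'" v "vs' @ [u]"] by simp
  also have "\<dots> = el ((v # vs') @ u # us' @ [v])" using el_append[of "v # vs'" u "us' @ [v]"] by simp
  finally show ?thesis using uv by (simp add: cyc_def)
qed auto

lemma cyc_rev_tail: "cyc (x # rev xs) = cyc (x # xs)"
  using el_rev[of "x # xs @ [x]"] by (simp add: cyc_Cons)

lemma rotate_to:
  assumes "x \<in> set xs" "distinct xs"
  obtains ys where "cyc (x # ys) = cyc xs" "set (x # ys) = set xs" "distinct (x # ys)" "length (x # ys) = length xs"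
proof -
  obtain us vs where "xs = us @ x # vs" using assms(1) split_list by metis
  then show ?thesis using that[of "vs @ us"] cyc_rotate[of us "x # vs"] assms(2) by auto
qed

context girth_graph
begin

section \<open>Opening cycles\<close>

text \<open>Meant for a cycle \<open>M\<close> through the start \<open>c\<close> of the path
  \<open>Q\<close>. \<open>R\<close> starts at \<open>c\<close>, so that a matching edge waiting at
  \<open>c\<close> can be moved to it, and \<open>R'\<close> keeps the last vertex of
  \<open>Q\<close>, where another edge may be waiting.\<close>

definition unloops :: "'a \<Rightarrow> 'a set multiset \<Rightarrow> 'a list \<Rightarrow> bool" where
  "unloops c M Q \<longleftrightarrow> (\<exists>R R'. el R + el R' = M + el Q \<and> distinct R \<and> distinct R' \<and> hd R = c \<and> last R' = last Q \<and>
     2 * k \<le> length R \<and> length R \<le> 2 * k + 1 \<and> 2 * k \<le> length R' \<and> length R' \<le> length Q + 1)"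

text \<open>The cycle edge from \<open>c\<close> to \<open>hd cs\<close> moves to the front of the
  path; what remains of the cycle is a path from \<open>c\<close>.\<close>

lemma unloops_extend:
  assumes "distinct (c # cs)" "length (c # cs) = 2 * k" "distinct (c # qs)" "2 * k \<le> length (c # qs)"
    and "hd cs \<notin> set (c # qs)"
  shows "unloops c (cyc (c # cs)) (c # qs)"
proof -
  obtain p ps where p: "cs = p # ps" using assms(2) k3 by (cases cs) auto
  have "el (c # rev cs) = el (cs @ [c])" using el_rev[of "cs @ [c]"] by simp
  then have "el (c # rev cs) + el (p # c # qs) = cyc (c # cs) + el (c # qs)"
    unfolding p cyc_Cons by (simp add: insert_commute)
  then show ?thesis unfolding unloops_def
    by (intro exI[of _ "c # rev cs"] exI[of _ "p # c # qs"]) (use assms p in auto)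
qed

text \<open>If both neighbours of the common vertex on the cycle lie on the path, then \<open>k = 3\<close>, and the
  last cycle vertex \<open>v\<close> is preceded on the path by a vertex outside the cycle.\<close>
lemma unloops_rotate:
  assumes sub: "cyc (c # cs) + el (c # qs) \<subseteq># mset_set E"
    and cs: "distinct (c # cs)" "length (c # cs) = 2 * k"
    and qs: "distinct (c # qs)" "2 * k \<le> length (c # qs)" "length (c # qs) \<le> 2 * k + 1"
    and ij: "hd cs = (c # qs) ! i" "last cs = (c # qs) ! j" "i < j" "j < length (c # qs)"
  shows "unloops c (cyc (c # cs)) (c # qs)"
proof -
  define P Q where "P = c # cs" and "Q = c # qs"
  have csne: "cs \<noteq> []" using cs k3 by auto
  have c0: "cyc (c # cs) = add_mset {last cs, c} (el (c # cs))" using cyc_eq[of "c # cs"] csne by simp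
  have c1: "el (c # cs) = add_mset {c, hd cs} (el cs)" using csne by (cases cs) auto
  have subPQ: "el P + el Q \<subseteq># mset_set E"
  proof (rule subset_mset.order_trans[OF _ sub])
    show "el P + el Q \<subseteq># cyc (c # cs) + el (c # qs)" unfolding c0 P_def Q_def by simp
  qed
  have "add_mset {c, (c # qs) ! i} (add_mset {c, (c # qs) ! j} (el (c # qs))) \<subseteq># mset_set E"
  proof (rule subset_mset.order_trans[OF _ sub])
    have "add_mset {c, (c # qs) ! i} (add_mset {c, (c # qs) ! j} (el (c # qs))) + el cs = cyc (c # cs) + el (c # qs)"
      unfolding c0 c1 ij by (simp add: insert_commute)
    then show "add_mset {c, (c # qs) ! i} (add_mset {c, (c # qs) ! j} (el (c # qs))) \<subseteq># cyc (c # cs) + el (c # qs)"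
      by (metis mset_subset_eq_add_left)
  qed
  note ci = chords_index[OF this ij(3,4)]
  have k: "k = 3" using ci qs(3) ij k3 by linarith
  have lP: "length P = 6" and lQ: "length Q \<le> 7" and dP: "distinct P" and dQ: "distinct Q"
    using cs qs k unfolding P_def Q_def by auto
  have i3: "3 \<le> i" "i + 2 \<le> j" "j < length Q" using ci k ij unfolding Q_def by auto
  have P1: "P ! 1 = Q ! i" using ij(1) csne unfolding P_def Q_def by (simp add: hd_conv_nth)
  have P5: "P ! 5 = Q ! j" using ij(2) csne lP unfolding P_def Q_def by (simp add: last_conv_nth)
  have z: "Q ! (j - 1) \<notin> set P"
  proof
    assume "Q ! (j - 1) \<in> set P"
    then obtain t where t: "t < 6" "P ! t = Q ! (j - 1)" using lP by (auto simp: in_set_conv_nth)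
    have t1: "t \<noteq> 1"
    proof
      assume "t = 1"
      then have "Q ! i = Q ! (j - 1)" using t P1 by simp
      then show False using nth_eq_iff_index_eq[OF dQ, of i "j - 1"] i3 by auto
    qed
    have t5: "t \<noteq> 5"
    proof
      assume "t = 5"
      then have "Q ! j = Q ! (j - 1)" using t P5 by simp
      then show False using nth_eq_iff_index_eq[OF dQ, of j "j - 1"] less_imp_diff_less[of j "length Q" 1] i3 by auto
    qed
    have t0: "t \<noteq> 0"
    proof
      assume "t = 0"
      then have "Q ! 0 = Q ! (j - 1)" using t unfolding P_def Q_def by simp
      moreover have "0 < length Q" "j - 1 < length Q" using i3 by linarith+
      ultimately have "0 = j - 1" using nth_eq_iff_index_eq[OF dQ] by blast
      then show False using i3 by linarith
    qed
    \<comment> \<open>The stretch of \<open>Q\<close> from \<open>i\<close> to \<open>j - 1\<close>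
      has at most two edges, so \<open>t\<close> is at least two steps away from 1 and hence at
      least 3; the stretch from \<open>j - 1\<close> to \<open>j\<close> has one edge, so
      \<open>t\<close> is at least three steps away from 5 and hence at most 2.\<close>
    have "4 \<le> (t - 1) + (1 - t) + ((j - 1 - i) + (i - (j - 1)))"
      using two_paths_index[OF subPQ _ _ _ _ t(2) P1] t t1 k i3 lP by auto
    moreover have "4 \<le> (t - 5) + (5 - t) + ((j - 1 - j) + (j - (j - 1)))"
      using two_paths_index[OF subPQ _ _ _ _ t(2) P5] t t5 k i3 lP by auto
    moreover have "j - 1 - i \<le> 2" "i - (j - 1) = 0" "j - 1 - j = 0" "j - (j - 1) = 1" using i3 lQ by linarith+
    moreover have "t = 2 \<or> t = 3 \<or> t = 4" using t0 t1 t5 t(1) by linarith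
    ultimately show False by auto
  qed
  define us vs where "us = take (j - 1) Q" and "vs = drop (Suc j) Q"
  let ?v = "last cs" and ?z = "Q ! (j - 1)"
  have Qs: "c # qs = us @ ?z # ?v # vs"
    unfolding us_def vs_def ij(2) using split_nth2[of j Q] i3 unfolding Q_def by simp
  let ?R' = "rev (us @ [?z]) @ ?v # vs"
  have dR': "distinct ?R'" using qs(1) unfolding Qs by auto
  have lenR': "length ?R' = length (c # qs)" unfolding Qs by simp
  have lastR': "last ?R' = last (c # qs)" unfolding Qs by simp
  have "el ((c # cs) @ [?z]) = add_mset {?v, ?z} (el (c # cs))"
    using el_snoc_last[of "c # cs" ?z] csne by simp
  then have "el ((c # cs) @ [?z]) + el ?R' = cyc (c # cs) + el (c # qs)"
    using el_rotate[OF Qs] unfolding c0 by (simp add: insert_commute)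
  moreover have "distinct ((c # cs) @ [?z])" using cs(1) z unfolding P_def by auto
  ultimately show ?thesis unfolding unloops_def using dR' lenR' lastR' cs(2) qs(2)
    by (intro exI[of _ "(c # cs) @ [?z]"] exI[of _ ?R']) auto
qed

text \<open>Reversing the cycle exchanges the two neighbours of \<open>c\<close>: one that is
  missing from the path can serve as \<open>hd cs\<close>, and if both lie on the path, the earlier
  one can.\<close>

lemma unloops_Cons:
  assumes sub: "cyc (c # cs) + el (c # qs) \<subseteq># mset_set E"
    and cs: "distinct (c # cs)" "length (c # cs) = 2 * k"
    and qs: "distinct (c # qs)" "2 * k \<le> length (c # qs)" "length (c # qs) \<le> 2 * k + 1"
  shows "unloops c (cyc (c # cs)) (c # qs)"
proof -
  have csne: "cs \<noteq> []" using cs k3 by auto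
  have r: "distinct (c # rev cs)" "length (c # rev cs) = 2 * k" "cyc (c # rev cs) + el (c # qs) \<subseteq># mset_set E"
    using cs sub by (auto simp: cyc_rev_tail)
  note ext = unloops_extend[OF cs qs(1,2)] unloops_extend[OF r(1,2) qs(1,2), unfolded cyc_rev_tail hd_rev]
  show ?thesis
  proof (cases "hd cs \<in> set (c # qs) \<and> last cs \<in> set (c # qs)")
    case False
    then show ?thesis using ext by blast
  next
    case True
    then obtain i j where ij: "i < length (c # qs)" "hd cs = (c # qs) ! i" "j < length (c # qs)" "last cs = (c # qs) ! j"
      by (metis in_set_conv_nth)
    have "2 \<le> length cs" using cs k3 by simp
    then have "hd cs \<noteq> last cs" using cs(1) by (cases cs) auto
    then have "i \<noteq> j" using ij by auto
    then show ?thesis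
      using unloops_rotate[OF sub cs qs, of i j] unloops_rotate[OF r(3,1,2) qs, of j i, unfolded cyc_rev_tail hd_rev last_rev] ij
      by (metis linorder_neqE_nat)
  qed
qed

lemma unloops_all:
  assumes sub: "cyc C + el Q \<subseteq># mset_set E" and C: "distinct C" "length C = 2 * k"
    and Q: "distinct Q" "2 * k \<le> length Q" "length Q \<le> 2 * k + 1" and c: "hd Q \<in> set C"
  shows "unloops (hd Q) (cyc C) Q"
proof -
  obtain ys where ys: "cyc (hd Q # ys) = cyc C" "distinct (hd Q # ys)" "length (hd Q # ys) = length C"
    using rotate_to[OF c C(1)] by metis
  obtain q qs where "Q = q # qs" using Q k3 by (cases Q) auto
  then show ?thesis using unloops_Cons[of q ys qs] ys sub C Q by simp
qed

text \<open>A chord of a cycle of length \<open>2 * k\<close> exists only for \<open>k = 3\<close>, and then it joins opposite vertices.\<close>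
lemma cycle_neighbour:
  assumes sub: "cyc (x # as) + cyc (x # bs) \<subseteq># mset_set E"
    and as: "distinct (x # as)" "length (x # as) = 2 * k" and bs: "distinct (x # bs)" "length (x # bs) = 2 * k"
  shows "hd bs \<notin> set (x # as) \<or> last bs \<notin> set (x # as)"
proof (rule ccontr)
  assume "\<not> ?thesis"
  then obtain i j where ij: "i < length (x # as)" "hd bs = (x # as) ! i" "j < length (x # as)" "last bs = (x # as) ! j"
    by (metis in_set_conv_nth)
  have ne: "as \<noteq> []" "bs \<noteq> []" using as bs k3 by auto
  have "2 \<le> length bs" using bs k3 by simp
  then have "hd bs \<noteq> last bs" using bs(1) by (cases bs) auto
  then have neq: "i \<noteq> j" using ij by auto
  have ca: "cyc (x # as) = add_mset {x, last as} (el (x # as))" using cyc_eq[of "x # as"] ne by (simp add: insert_commute)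
  have cb: "cyc (x # bs) = add_mset {x, last bs} (add_mset {x, hd bs} (el bs))"
    using cyc_eq[of "x # bs"] ne by (cases bs) (simp_all add: insert_commute)
  have "add_mset {x, hd bs} (add_mset {x, last bs} (el (x # as))) + add_mset {x, last as} (el bs) = cyc (x # as) + cyc (x # bs)"
    unfolding ca cb by simp
  then have "add_mset {x, hd bs} (add_mset {x, last bs} (el (x # as))) \<subseteq># cyc (x # as) + cyc (x # bs)"
    by (metis mset_subset_eq_add_left)
  then have s: "add_mset {x, hd bs} (add_mset {x, last bs} (el (x # as))) \<subseteq># mset_set E"
    using sub by (rule subset_mset.order_trans)
  then have s': "add_mset {x, last bs} (add_mset {x, hd bs} (el (x # as))) \<subseteq># mset_set E" by (simp add: add_mset_commute)
  obtain m where m: "m = max i j" "4 * k - 7 \<le> m"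
  proof (cases "i < j")
    case True
    then show ?thesis using that[of j] chords_index[of x as i j] s ij by simp
  next
    case False
    then show ?thesis using that[of i] chords_index[of x as j i] s' ij neq by simp
  qed
  have "m \<le> 2 * k - 1" using m ij as by auto
  \<comment> \<open>Here \<open>4 * k - 7 \<le> m\<close> and \<open>m \<le> 2 * k - 1\<close> force
    \<open>k = 3\<close>, and the chord with the larger index joins \<open>x\<close> to
    \<open>last as\<close>, already an edge of the first cycle.\<close>
  then have "m = 2 * k - 1" using m k3 by linarith
  then have "m = length (x # as) - 1" using as by simp
  then have "(x # as) ! m = last as" using ne by (simp add: last_conv_nth nth_Cons')
  then have "{x, last as} \<in># cyc (x # bs)" using m(1) ij neq unfolding cb max_def by (auto split: if_splits)
  then have "2 \<le> count (cyc (x # as) + cyc (x # bs)) {x, last as}"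
    unfolding ca using count_greater_zero_iff[of "cyc (x # bs)" "{x, last as}"] by (simp del: count_greater_zero_iff)
  then show False using sub_E_count[OF sub, of "{x, last as}"] by simp
qed

text \<open>Meant for the edges of two cycles: \<open>R\<close> starts at a prescribed vertex and
  has room for one more vertex, while \<open>R'\<close> may have the maximal size.\<close>

definition unties :: "'a \<Rightarrow> 'a set multiset \<Rightarrow> bool" where
  "unties p M \<longleftrightarrow> (\<exists>R R'. el R + el R' = M \<and> distinct R \<and> distinct R' \<and> hd R = p \<and>
     2 * k \<le> length R \<and> length R \<le> 2 * k + 1 \<and> 2 * k \<le> length R' \<and> length R' \<le> 2 * k + 2)"

text \<open>Both results start at \<open>p'\<close>. If \<open>p\<close> lies on \<open>C\<close>,
  the first cycle is cut at \<open>p p'\<close> and prolonged by an edge of \<open>C\<close> at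
  \<open>p\<close>, and \<open>p'\<close> is put before \<open>C\<close> opened at \<open>p\<close>.
  Otherwise \<open>p\<close> is removed from the first cycle, whose rest is prolonged at the other
  neighbour \<open>x\<close> of \<open>p\<close>, and \<open>p', p\<close> are put before
  \<open>C\<close> opened at \<open>x\<close>. The neighbour on \<open>C\<close> at which
  \<open>C\<close> is opened comes from \<open>cycle_neighbour\<close>.\<close>

lemma unties_all:
  assumes sub: "cyc (p # p' # ps) + cyc C \<subseteq># mset_set E"
    and ps: "distinct (p # p' # ps)" "length (p # p' # ps) = 2 * k" and C: "distinct C" "length C = 2 * k"
    and p': "p' \<notin> set C" and p: "p \<in> set C \<or> last (p # p' # ps) \<in> set C"
  shows "unties p' (cyc (p # p' # ps) + cyc C)"
proof -
  have psne: "ps \<noteq> []" using ps k3 by auto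
  have orient: "\<exists>bs. cyc (x # bs) = cyc C \<and> set (x # bs) = set C \<and> distinct (x # bs) \<and> length (x # bs) = length C \<and>
     last bs \<notin> set (x # as)" if x: "x \<in> set C" and as: "cyc (x # as) = cyc (p # p' # ps)" "distinct (x # as)" "length (x # as) = 2 * k" for x as
  proof -
    obtain bs where bs: "cyc (x # bs) = cyc C" "set (x # bs) = set C" "distinct (x # bs)" "length (x # bs) = length C"
      using rotate_to[OF x C(1)] by metis
    from cycle_neighbour[OF _ as(2,3), of bs] have "hd bs \<notin> set (x # as) \<or> last bs \<notin> set (x # as)"
      using bs C sub as(1) by simp
    then show ?thesis using bs cyc_rev_tail[of x bs]
      by (elim disjE; intro exI[of _ "rev bs"] exI[of _ bs]) (auto simp: last_rev)
  qed
  show ?thesis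
  proof (cases "p \<in> set C")
    case True
    from orient[OF this, of "p' # ps"] obtain bs where bs: "cyc (p # bs) = cyc C" "set (p # bs) = set C" "distinct (p # bs)"
      "length (p # bs) = length C" "last bs \<notin> set (p # p' # ps)" using ps by auto
    have ne: "bs \<noteq> []" using bs C k3 by auto
    have "el ((p' # ps) @ [p, last bs]) = add_mset {p, last bs} (el ((p' # ps) @ [p]))" by (rule el_snoc)
    then have e: "el ((p' # ps) @ [p, last bs]) + el (p' # p # bs) = cyc (p # p' # ps) + cyc C" unfolding bs(1)[symmetric]
      using cyc_eq[of "p # bs"] ne by (simp add: cyc_Cons insert_commute)
    have "p' \<notin> set (p # bs)" using p' bs by simp
    then show ?thesis unfolding unties_def
      by (intro exI[of _ "(p' # ps) @ [p, last bs]"] exI[of _ "p' # p # bs"] conjI e) (use ps bs(3,4,5) C in auto)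
  next
    case False
    define x where "x = last ps"
    have x: "x \<in> set C" using p False psne by (simp add: x_def)
    have dec: "ps = butlast ps @ [x]" using psne by (simp add: x_def)
    have cyx: "cyc (x # p # p' # butlast ps) = cyc (p # p' # ps)"
      using cyc_rotate[of "[x]" "p # p' # butlast ps"] dec by simp
    have dx: "distinct (x # p # p' # butlast ps)" "length (x # p # p' # butlast ps) = 2 * k"
      "set (x # p # p' # butlast ps) = set (p # p' # ps)"
    proof -
      obtain qs where "ps = qs @ [x]" using dec by blast
      then show "distinct (x # p # p' # butlast ps)" "length (x # p # p' # butlast ps) = 2 * k"
        "set (x # p # p' # butlast ps) = set (p # p' # ps)" using ps by auto
    qed
    from orient[OF x cyx dx(1,2)] obtain bs where bs: "cyc (x # bs) = cyc C" "set (x # bs) = set C" "distinct (x # bs)"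
      "length (x # bs) = length C" "last bs \<notin> set (p # p' # ps)" unfolding dx(3) by auto
    have ne: "bs \<noteq> []" using bs C k3 by auto
    have "el ((p' # ps) @ [last bs]) = add_mset {x, last bs} (el (p' # ps))"
      using el_snoc_last[of "p' # ps"] psne by (simp add: x_def)
    moreover have "cyc (p # p' # ps) = add_mset {x, p} (add_mset {p, p'} (el (p' # ps)))"
      using cyc_eq[of "p # p' # ps"] psne by (simp add: x_def)
    ultimately have e: "el ((p' # ps) @ [last bs]) + el (p' # p # x # bs) = cyc (p # p' # ps) + cyc C"
      unfolding bs(1)[symmetric] using cyc_eq[of "x # bs"] ne by (simp add: insert_commute)
    have "p' \<notin> set (x # bs)" "p \<notin> set (x # bs)" using p' False unfolding bs(2) by simp_all
    then show ?thesis unfolding unties_def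
      by (intro exI[of _ "(p' # ps) @ [last bs]"] exI[of _ "p' # p # x # bs"] conjI e) (use ps bs(3,4,5) C in auto)
  qed
qed

end

context girth_graph
begin

section \<open>Distributing the second matching\<close>

text \<open>\<open>P\<close> lists the current paths, \<open>U\<close> the matching edges not yet assigned. Every end \<open>v\<close> of an edge in
  \<open>U\<close> is reserved an end of the path \<open>P (sl v)\<close>, to which the edge may later be attached.\<close>
definition state :: "'i set \<Rightarrow> 'a set set \<Rightarrow> ('i \<Rightarrow> 'a list) \<Rightarrow> ('a \<Rightarrow> 'i) \<Rightarrow> bool" where
  "state I U P sl \<longleftrightarrow> finite I \<and> U \<subseteq> E \<and> (\<Sum>i\<in>I. el (P i)) + mset_set U = mset_set E \<and>
     (\<forall>e\<in>U. \<forall>e'\<in>U. e \<noteq> e' \<longrightarrow> e \<inter> e' = {}) \<and>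
     (\<forall>i\<in>I. distinct (P i) \<and> 2 * k \<le> length (P i) \<and> length (P i) + card {v \<in> \<Union>U. sl v = i} \<le> 2 * k + 2) \<and>
     (\<forall>v\<in>\<Union>U. sl v \<in> I \<and> v \<in> {hd (P (sl v)), last (P (sl v))})"

text \<open>Here both ends of one path are reserved for the same matching edge, which joins them and
  so cannot be shared between two paths.\<close>

definition loops :: "'i set \<Rightarrow> 'a set set \<Rightarrow> ('a \<Rightarrow> 'i) \<Rightarrow> 'i set" where
  "loops I U sl = {i \<in> I. \<exists>e\<in>U. \<forall>v\<in>e. sl v = i}"

lemma state_finite: "state I U P sl \<Longrightarrow> finite I" "state I U P sl \<Longrightarrow> finite U" "state I U P sl \<Longrightarrow> U \<subseteq> E"
  using finE unfolding state_def by (auto dest: finite_subset)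

lemma state_path:
  assumes "state I U P sl" "i \<in> I"
  shows "distinct (P i)" "2 * k \<le> length (P i)" "length (P i) + card {v \<in> \<Union>U. sl v = i} \<le> 2 * k + 2"
  using assms unfolding state_def by blast+

lemma state_slot:
  assumes "state I U P sl" "v \<in> \<Union>U"
  shows "sl v \<in> I" "v \<in> {hd (P (sl v)), last (P (sl v))}"
  using assms unfolding state_def by blast+

lemma state_disjoint: "state I U P sl \<Longrightarrow> e \<in> U \<Longrightarrow> v \<in> e \<Longrightarrow> v \<notin> \<Union>(U - {e})"
  unfolding state_def by blast

text \<open>Additive form, because the replaced terms cannot be subtracted in a commutative
  monoid.\<close>

lemma sum_update2:
  fixes f :: "'b \<Rightarrow> 'c::comm_monoid_add"
  assumes "finite I" "i \<in> I" "j \<in> I" "i \<noteq> j"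
  shows "(\<Sum>l\<in>I. f ((P(i := x, j := y)) l)) + (f (P i) + f (P j)) = (\<Sum>l\<in>I. f (P l)) + (f x + f y)"
proof -
  have I: "I = insert i (insert j (I - {i, j}))" using assms by blast
  have "(\<Sum>l\<in>I - {i, j}. f ((P(i := x, j := y)) l)) = (\<Sum>l\<in>I - {i, j}. f (P l))"
    by (intro sum.cong) auto
  then show ?thesis using assms(1,4) by (subst (1 2) I) (simp add: ac_simps)
qed

lemma finite_Union_edges: "U \<subseteq> E \<Longrightarrow> finite (\<Union>U)"
proof (rule finite_Union)
  assume U: "U \<subseteq> E"
  show "finite U" using U finE by (rule finite_subset)
  show "finite e" if "e \<in> U" for e
  proof -
    have "e \<in> E" using U that by blast
    from edgeE[OF this] show ?thesis by auto
  qed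
qed

lemma finite_slots: "U \<subseteq> E \<Longrightarrow> finite {v \<in> \<Union>U. sl v = i}"
  using finite_Union_edges by (rule rev_finite_subset) auto

text \<open>Every change of a state replaces two paths, consumes the edges \<open>W\<close>, and
  moves reservations only between these two paths.\<close>

lemma state_update:
  assumes st: "state I U P sl" and ij: "i \<in> I" "j \<in> I" "i \<noteq> j" and W: "W \<subseteq> U"
    and sum: "el R + el R' = el (P i) + el (P j) + mset_set W"
    and R: "distinct R" "2 * k \<le> length R" "length R + card {v \<in> \<Union>(U - W). sl' v = i} \<le> 2 * k + 2"
    and R': "distinct R'" "2 * k \<le> length R'" "length R' + card {v \<in> \<Union>(U - W). sl' v = j} \<le> 2 * k + 2"
    and sl: "\<And>v. v \<in> \<Union>(U - W) \<Longrightarrow> sl' v = sl v \<or> sl v \<in> {i, j} \<and> sl' v \<in> {i, j}"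
    and slR: "\<And>v. v \<in> \<Union>(U - W) \<Longrightarrow> sl' v = i \<Longrightarrow> v \<in> {hd R, last R}"
    and slR': "\<And>v. v \<in> \<Union>(U - W) \<Longrightarrow> sl' v = j \<Longrightarrow> v \<in> {hd R', last R'}"
  shows "state I (U - W) (P(i := R, j := R')) sl'"
proof -
  have fin: "finite I" "finite U" "finite W" using st W finE unfolding state_def by (auto dest: finite_subset)
  have mU: "mset_set U = mset_set (U - W) + mset_set W" using W fin
    by (metis Diff_disjoint Un_Diff_cancel2 finite_Diff inf_commute mset_set_Union sup.absorb1)
  have "(\<Sum>l\<in>I. el ((P(i := R, j := R')) l)) + (el (P i) + el (P j)) + mset_set U
      = (\<Sum>l\<in>I. el (P l)) + mset_set U + (el (P i) + el (P j) + mset_set W)"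
    unfolding sum_update2[OF fin(1) ij] sum by (simp add: ac_simps)
  also have "\<dots> = mset_set E + (el (P i) + el (P j) + mset_set W)" using st unfolding state_def by simp
  finally have s: "(\<Sum>l\<in>I. el ((P(i := R, j := R')) l)) + mset_set (U - W) = mset_set E" unfolding mU by simp
  have U: "\<Union>(U - W) \<subseteq> \<Union>U" by blast
  have finU: "finite (\<Union>U)" using st finite_Union_edges unfolding state_def by blast
  have old: "length (P l) + card {v \<in> \<Union>(U - W). sl' v = l} \<le> 2 * k + 2" if l: "l \<in> I" "l \<noteq> i" "l \<noteq> j" for l
  proof -
    have "{v \<in> \<Union>(U - W). sl' v = l} \<subseteq> {v \<in> \<Union>U. sl v = l}" using sl l by fastforce
    then have "card {v \<in> \<Union>(U - W). sl' v = l} \<le> card {v \<in> \<Union>U. sl v = l}" using finite_slots[OF state_finite(3)[OF st]] by (intro card_mono)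
    then show ?thesis using st l unfolding state_def by fastforce
  qed
  have 2: "distinct ((P(i := R, j := R')) l) \<and> 2 * k \<le> length ((P(i := R, j := R')) l) \<and>
      length ((P(i := R, j := R')) l) + card {v \<in> \<Union>(U - W). sl' v = l} \<le> 2 * k + 2" if "l \<in> I" for l
  proof -
    have o: "distinct (P l)" "2 * k \<le> length (P l)" using st that unfolding state_def by blast+
    consider "l = j" | "l = i" | "l \<noteq> i" "l \<noteq> j" by blast
    then show ?thesis using R R' old[OF that] o ij by cases simp_all
  qed
  have 3: "sl' v \<in> I \<and> v \<in> {hd ((P(i := R, j := R')) (sl' v)), last ((P(i := R, j := R')) (sl' v))}"
    if v: "v \<in> \<Union>(U - W)" for v
  proof -
    have o: "sl v \<in> I" "v \<in> {hd (P (sl v)), last (P (sl v))}" using st v U unfolding state_def by blast+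
    consider "sl' v = i" | "sl' v = j" | "sl' v = sl v" "sl' v \<noteq> i" "sl' v \<noteq> j" using sl[OF v] by blast
    then show ?thesis
    proof cases
      case 1
      then show ?thesis using slR[OF v] ij by simp
    next
      case 2
      then show ?thesis using slR'[OF v] ij by simp
    next
      case 3
      then show ?thesis using o by simp
    qed
  qed
  have "U - W \<subseteq> E" using state_finite(3)[OF st] by blast
  moreover have "\<forall>e\<in>U - W. \<forall>e'\<in>U - W. e \<noteq> e' \<longrightarrow> e \<inter> e' = {}" using st unfolding state_def by (meson DiffD1)
  ultimately show ?thesis unfolding state_def
    by (intro conjI ballI s fin(1)) (use 2 3 in \<open>blast+\<close>)
qed

lemma state_sub: "state I U P sl \<Longrightarrow> i \<in> I \<Longrightarrow> j \<in> I \<Longrightarrow> i \<noteq> j \<Longrightarrow> W \<subseteq> U \<Longrightarrow> el (P i) + el (P j) + mset_set W \<subseteq># mset_set E"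
proof -
  assume st: "state I U P sl" and ij: "i \<in> I" "j \<in> I" "i \<noteq> j" and W: "W \<subseteq> U"
  have fin: "finite I" "finite U" using st finE unfolding state_def by (auto dest: finite_subset)
  have I: "I = insert i (insert j (I - {i, j}))" using ij by blast
  have "(\<Sum>l\<in>I. el (P l)) = el (P i) + el (P j) + (\<Sum>l\<in>I - {i, j}. el (P l))"
    using ij fin by (subst I) (simp add: ac_simps)
  then have "el (P i) + el (P j) \<subseteq># (\<Sum>l\<in>I. el (P l))" by simp
  moreover have "mset_set W \<subseteq># mset_set U" using W fin by (simp add: subset_imp_msubset_mset_set)
  ultimately have "el (P i) + el (P j) + mset_set W \<subseteq># (\<Sum>l\<in>I. el (P l)) + mset_set U"
    by (rule subset_mset.add_mono)
  then show ?thesis using st unfolding state_def by simp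
qed

text \<open>The ends of \<open>e\<close> take two slots, so the bound on vertices plus slots leaves
  exactly \<open>2 * k\<close> vertices, and \<open>e\<close> closes the path to a cycle of that
  length.\<close>

lemma state_loop:
  assumes st: "state I U P sl" and e: "e \<in> U" "\<forall>v\<in>e. sl v = i"
  shows "i \<in> I" "e = {last (P i), hd (P i)}" "length (P i) = 2 * k" "cyc (P i) = el (P i) + {#e#}" "e \<subseteq> set (P i)"
    and "\<And>v. v \<in> \<Union>U \<Longrightarrow> sl v = i \<Longrightarrow> v \<in> e"
proof -
  have "U \<subseteq> E" using st unfolding state_def by blast
  then obtain x y where xy: "e = {x, y}" "x \<noteq> y" using e edgeE[of e] by blast
  have sl: "x \<in> \<Union>U" "y \<in> \<Union>U" "sl x = i" "sl y = i" using xy e by auto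
  then show i: "i \<in> I" using state_slot(1)[OF st, of x] by simp
  have "x \<in> {hd (P i), last (P i)}" "y \<in> {hd (P i), last (P i)}"
    using state_slot(2)[OF st sl(1)] state_slot(2)[OF st sl(2)] sl(3,4) by simp_all
  then show ee: "e = {last (P i), hd (P i)}" using xy by auto
  have len: "2 * k \<le> length (P i)" "length (P i) + card {v \<in> \<Union>U. sl v = i} \<le> 2 * k + 2"
    using state_path[OF st i] by auto
  have "card {x, y} \<le> card {v \<in> \<Union>U. sl v = i}"
    using sl finite_slots[OF state_finite(3)[OF st]] by (intro card_mono) auto
  then show "length (P i) = 2 * k" using len xy by simp
  have ne: "P i \<noteq> []" using len k3 by auto
  then show "cyc (P i) = el (P i) + {#e#}" "e \<subseteq> set (P i)" using cyc_eq[of "P i"] ee by auto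
  show "v \<in> e" if "v \<in> \<Union>U" "sl v = i" for v using state_slot(2)[OF st that(1)] that(2) ee by auto
qed

lemma edge_not_single: "e \<in> E \<Longrightarrow> \<not> e \<subseteq> {x}"
  using edgeE by blast

text \<open>Path \<open>j\<close> has its end \<open>c\<close> on the cycle formed by
  \<open>e\<close> and path \<open>i\<close>, so \<open>unloops_all\<close> applies. Path
  \<open>j\<close> may grow there: either its slot for \<open>c\<close> is handed to the new path
  \<open>i\<close>, which starts at \<open>c\<close>, or it has spare room. Afterwards
  \<open>i\<close> can hold a slot only for \<open>c\<close> and \<open>j\<close> only for its other
  end, so neither is a loop.\<close>

lemma open_loop:
  assumes st: "state I U P sl" and e: "e \<in> U" "\<forall>v\<in>e. sl v = i" and j: "j \<in> I" "j \<noteq> i"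
    and c: "c \<in> {hd (P j), last (P j)}" "c \<in> set (P i)"
    and room: "c \<in> \<Union>U \<and> sl c = j \<or> length (P j) + card {v \<in> \<Union>U. sl v = j} \<le> 2 * k + 1"
  shows "\<exists>P' sl'. state I (U - {e}) P' sl' \<and> (\<forall>l. l \<notin> {i, j} \<longrightarrow> P' l = P l) \<and>
     (\<forall>v. sl' v = (if v = c \<and> sl v = j then i else sl v)) \<and> hd (P' i) = c \<and> loops I (U - {e}) sl' \<subseteq> loops I U sl - {i, j}"
proof -
  note lp = state_loop[OF st e]
  have finU: "finite (\<Union>U)" and UE: "U \<subseteq> E" using st finite_Union_edges unfolding state_def by blast+
  have Pj: "distinct (P j)" "2 * k \<le> length (P j)" "length (P j) + card {v \<in> \<Union>U. sl v = j} \<le> 2 * k + 2"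
    using state_path[OF st j(1)] by auto
  have Pi: "distinct (P i)" using state_path[OF st lp(1)] by auto
  define S S' where "S = {v \<in> \<Union>U. sl v = j}" and "S' = {v \<in> \<Union>(U - {e}). sl v = j \<and> v \<noteq> c}"
  have S': "S' \<subseteq> S" unfolding S_def S'_def by auto
  have finS: "finite S" using finite_slots[OF UE] unfolding S_def .
  have room': "length (P j) + 1 + card S' \<le> 2 * k + 2"
    using room
  proof
    assume "c \<in> \<Union>U \<and> sl c = j"
    then have "c \<in> S" unfolding S_def by auto
    moreover have "c \<notin> S'" unfolding S'_def by auto
    ultimately have "card S' < card S" using S' finS by (metis psubsetI psubset_card_mono)
    then show ?thesis using Pj S_def by simp
  next
    assume "length (P j) + card {v \<in> \<Union>U. sl v = j} \<le> 2 * k + 1"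
    then show ?thesis using card_mono[OF finS S'] S_def by simp
  qed
  define Q where "Q = (if hd (P j) = c then P j else rev (P j))"
  have ne: "P j \<noteq> []" using Pj k3 by auto
  have Q: "el Q = el (P j)" "distinct Q" "length Q = length (P j)" "hd Q = c" "{hd Q, last Q} = {hd (P j), last (P j)}"
    unfolding Q_def using Pj c ne by (auto simp: el_rev hd_rev last_rev)
  have "el (P i) + el (P j) + mset_set {e} \<subseteq># mset_set E"
    using state_sub[OF st lp(1) j(1) j(2)[symmetric], of "{e}"] e(1) by simp
  then have sub: "cyc (P i) + el Q \<subseteq># mset_set E" unfolding lp(4) Q(1) by (simp add: ac_simps)
  have "unloops (hd Q) (cyc (P i)) Q"
    by (rule unloops_all[OF sub Pi lp(3) Q(2)]) (use Q Pj c room' in auto)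
  then obtain R R' where R: "el R + el R' = cyc (P i) + el Q" "distinct R" "distinct R'" "hd R = c" "last R' = last Q"
     "2 * k \<le> length R" "length R \<le> 2 * k + 1" "2 * k \<le> length R'" "length R' \<le> length Q + 1"
    unfolding unloops_def Q(4) by blast
  define sl' where "sl' v = (if v = c \<and> sl v = j then i else sl v)" for v
  have sli: "v = c" if "v \<in> \<Union>(U - {e})" "sl' v = i" for v
  proof (rule ccontr)
    assume "v \<noteq> c"
    then have "sl v = i" using that unfolding sl'_def by (auto split: if_splits)
    then have "v \<in> e" using lp(6) that(1) by blast
    then show False using state_disjoint[OF st e(1)] that(1) by blast
  qed
  have slj: "v = last Q \<and> v \<in> S'" if "v \<in> \<Union>(U - {e})" "sl' v = j" for v
  proof -
    have v: "sl v = j" "v \<noteq> c" using that j unfolding sl'_def by (auto split: if_splits)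
    moreover have "v \<in> {hd (P j), last (P j)}" using state_slot(2)[OF st, of v] that v by auto
    ultimately show ?thesis using Q that unfolding S'_def by auto
  qed
  have "{v \<in> \<Union>(U - {e}). sl' v = i} \<subseteq> {c}" using sli by blast
  from card_mono[OF _ this] have ci: "card {v \<in> \<Union>(U - {e}). sl' v = i} \<le> 1" by simp
  have "{v \<in> \<Union>(U - {e}). sl' v = j} \<subseteq> S'" using slj by blast
  from card_mono[OF _ this] have cj: "card {v \<in> \<Union>(U - {e}). sl' v = j} \<le> card S'"
    using finite_subset[OF S' finS] by simp
  have "state I (U - {e}) (P(i := R, j := R')) sl'"
  proof (rule state_update[OF st lp(1) j(1)])
    show "el R + el R' = el (P i) + el (P j) + mset_set {e}" using R(1) lp(4) Q(1) by (simp add: ac_simps)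
    show "length R + card {v \<in> \<Union>(U - {e}). sl' v = i} \<le> 2 * k + 2" using ci R by simp
    show "length R' + card {v \<in> \<Union>(U - {e}). sl' v = j} \<le> 2 * k + 2" using cj R room' Q by simp
    show "v \<in> {hd R, last R}" if "v \<in> \<Union>(U - {e})" "sl' v = i" for v using sli[OF that] R by simp
    show "v \<in> {hd R', last R'}" if "v \<in> \<Union>(U - {e})" "sl' v = j" for v using slj[OF that] R by simp
  qed (use R e j in \<open>auto simp: sl'_def\<close>)
  moreover have "loops I (U - {e}) sl' \<subseteq> loops I U sl - {i, j}"
  proof
    fix l assume "l \<in> loops I (U - {e}) sl'"
    then obtain e' where e': "l \<in> I" "e' \<in> U - {e}" "\<forall>v\<in>e'. sl' v = l" unfolding loops_def by blast
    have "e' \<in> E" using e' UE by blast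
    note ns = edge_not_single[OF this]
    have "l \<noteq> i"
    proof
      assume "l = i"
      then have "e' \<subseteq> {c}" using sli e' by blast
      then show False using ns by blast
    qed
    moreover have "l \<noteq> j"
    proof
      assume "l = j"
      then have "e' \<subseteq> {last Q}" using slj e' by blast
      then show False using ns by blast
    qed
    moreover have "\<forall>v\<in>e'. sl v = l" using e' \<open>l \<noteq> i\<close> unfolding sl'_def by metis
    ultimately show "l \<in> loops I U sl - {i, j}" using e' unfolding loops_def by blast
  qed
  ultimately show ?thesis using R j sl'_def by (intro exI[of _ "P(i := R, j := R')"] exI[of _ sl']) auto
qed

text \<open>Without loops the ends of \<open>e\<close> have slots on different paths, so
  \<open>merges_all\<close> applies. Each path grows by at most one vertex, paid for by the released
  slot, and the other ends stay in place for their own slots.\<close>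

lemma add_edge:
  assumes st: "state I U P sl" and e: "e \<in> U" and nl: "loops I U sl = {}"
  shows "\<exists>P'. state I (U - {e}) P' sl"
proof -
  have finU: "finite (\<Union>U)" and UE: "U \<subseteq> E" using st finite_Union_edges unfolding state_def by blast+
  obtain a b where ab: "e = {a, b}" "a \<noteq> b" using edgeE[of e] e UE by blast
  define i j where "i = sl a" and "j = sl b"
  have ij: "i \<in> I" "j \<in> I" and ends: "a \<in> {hd (P i), last (P i)}" "b \<in> {hd (P j), last (P j)}"
    using state_slot[OF st, of a] state_slot[OF st, of b] e ab unfolding i_def j_def by auto
  have ne: "i \<noteq> j"
  proof
    assume "i = j"
    then have "i \<in> loops I U sl" unfolding loops_def using ij e ab i_def j_def by auto
    then show False using nl by simp
  qed
  have nn: "P l \<noteq> []" if "l \<in> I" for l using state_path(2)[OF st that] k3 by auto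
  have orient: "\<exists>ys. el (x # ys) = el (P l) \<and> distinct (x # ys) \<and> length (x # ys) = length (P l) \<and> {x, last (x # ys)} = {hd (P l), last (P l)}"
    if x: "x \<in> {hd (P l), last (P l)}" and l: "l \<in> I" for x l
  proof -
    define Q where "Q = (if hd (P l) = x then P l else rev (P l))"
    have d: "distinct (P l)" using state_path[OF st l] by blast
    have Q: "el Q = el (P l)" "distinct Q" "length Q = length (P l)" "hd Q = x" "{hd Q, last Q} = {hd (P l), last (P l)}" "Q \<noteq> []"
      unfolding Q_def using x nn[OF l] d by (auto simp: el_rev hd_rev last_rev)
    then show ?thesis by (metis list.collapse)
  qed
  obtain xs where xs: "el (a # xs) = el (P i)" "distinct (a # xs)" "length (a # xs) = length (P i)" "{a, last (a # xs)} = {hd (P i), last (P i)}"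
    using orient[OF ends(1) ij(1)] by blast
  obtain ys where ys: "el (b # ys) = el (P j)" "distinct (b # ys)" "length (b # ys) = length (P j)" "{b, last (b # ys)} = {hd (P j), last (P j)}"
    using orient[OF ends(2) ij(2)] by blast
  have slot: "length (P (sl x)) + 1 + card {v \<in> \<Union>(U - {e}). sl v = sl x} \<le> 2 * k + 2" if x: "x \<in> e" for x
  proof -
    have "x \<notin> \<Union>(U - {e})" by (rule state_disjoint[OF st e x])
    then have "x \<notin> {v \<in> \<Union>(U - {e}). sl v = sl x}" "x \<in> {v \<in> \<Union>U. sl v = sl x}" using x e by auto
    moreover have "{v \<in> \<Union>(U - {e}). sl v = sl x} \<subseteq> {v \<in> \<Union>U. sl v = sl x}" by blast
    ultimately have "{v \<in> \<Union>(U - {e}). sl v = sl x} \<subset> {v \<in> \<Union>U. sl v = sl x}" by blast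
    then have "card {v \<in> \<Union>(U - {e}). sl v = sl x} < card {v \<in> \<Union>U. sl v = sl x}" by (intro psubset_card_mono finite_slots UE)
    moreover have "length (P (sl x)) + card {v \<in> \<Union>U. sl v = sl x} \<le> 2 * k + 2"
      using state_path(3)[OF st state_slot(1)[OF st, of x]] x e by blast
    ultimately show ?thesis by simp
  qed
  have len: "length (P i) + 1 + card {v \<in> \<Union>(U - {e}). sl v = i} \<le> 2 * k + 2" "length (P j) + 1 + card {v \<in> \<Union>(U - {e}). sl v = j} \<le> 2 * k + 2"
    using slot ab unfolding i_def j_def by auto
  have len2: "2 * k \<le> length (P i)" "2 * k \<le> length (P j)" using state_path[OF st] ij by auto
  have "add_mset {a, b} (el (a # xs) + el (b # ys)) \<subseteq># mset_set E"
    using state_sub[OF st ij ne, of "{e}"] e unfolding xs ys ab by simp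
  from merges_all[OF this xs(2) ys(2)] have "merges (a # xs) (b # ys) (add_mset {a, b} (el (a # xs) + el (b # ys)))"
    unfolding xs(3) ys(3) using len len2 by simp
  then obtain R S where RS: "el R + el S = add_mset {a, b} (el (a # xs) + el (b # ys))" "distinct R" "distinct S" "2 * k \<le> length R" "2 * k \<le> length S"
     "length R \<le> length (P i) + 1" "length S \<le> length (P j) + 1" "last R = last (a # xs)" "last S = last (b # ys)"
    unfolding merges_def xs(3) ys(3) by blast
  have notin: "v \<noteq> a \<and> v \<noteq> b" if "v \<in> \<Union>(U - {e})" for v using that state_disjoint[OF st e] ab by blast
  have "state I (U - {e}) (P(i := R, j := S)) sl"
  proof (rule state_update[OF st ij ne])
    show "el R + el S = el (P i) + el (P j) + mset_set {e}" using RS(1) ab xs ys by simp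
    show "length R + card {v \<in> \<Union>(U - {e}). sl v = i} \<le> 2 * k + 2" using len RS by simp
    show "length S + card {v \<in> \<Union>(U - {e}). sl v = j} \<le> 2 * k + 2" using len RS by simp
    show "v \<in> {hd R, last R}" if v: "v \<in> \<Union>(U - {e})" "sl v = i" for v
    proof -
      have "v \<in> {hd (P i), last (P i)}" using state_slot(2)[OF st, of v] v by auto
      then show ?thesis using notin[OF v(1)] unfolding xs(4)[symmetric] RS by simp
    qed
    show "v \<in> {hd S, last S}" if v: "v \<in> \<Union>(U - {e})" "sl v = j" for v
    proof -
      have "v \<in> {hd (P j), last (P j)}" using state_slot(2)[OF st, of v] v by auto
      then show ?thesis using notin[OF v(1)] unfolding ys(4)[symmetric] RS by simp
    qed
  qed (use RS e in auto)
  then show ?thesis by blast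
qed

lemma add_all_edges:
  assumes "state I U P sl" "loops I U sl = {}"
  shows "\<exists>P'. state I {} P' sl"
proof -
  have "finite U" using assms finE unfolding state_def by (auto dest: finite_subset)
  then show ?thesis using assms
  proof (induction U arbitrary: P rule: finite_psubset_induct)
    case (psubset U)
    show ?case
    proof (cases "U = {}")
      case False
      then obtain e where e: "e \<in> U" by blast
      then obtain P' where "state I (U - {e}) P' sl" using add_edge[OF psubset.prems(1) e psubset.prems(2)] by blast
      moreover have "loops I (U - {e}) sl = {}" using psubset.prems(2) unfolding loops_def by blast
      ultimately show ?thesis using psubset.IH[of "U - {e}"] e by blast
    qed (use psubset in blast)
  qed
qed

end

section \<open>Eliminating the loops\<close>

context girth_graph
begin

text \<open>The second vertex is an inner vertex, so its slot is at another path, which therefore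
  has an end on the cycle of a loop \<open>i\<close> and can open it. Its position next to the head
  also suits \<open>unties_all\<close>.\<close>

lemma state_second:
  assumes "state I U P sl" "i \<in> I"
  shows "P i ! 1 \<in> set (P i)" "P i ! 1 \<notin> {hd (P i), last (P i)}"
proof -
  note p = state_path[OF assms]
  have l: "6 \<le> length (P i)" using p k3 by linarith
  then show "P i ! 1 \<in> set (P i)" by (intro nth_mem) simp
  have "P i \<noteq> []" using l by auto
  then have "hd (P i) = P i ! 0" "last (P i) = P i ! (length (P i) - 1)" by (simp_all add: hd_conv_nth last_conv_nth)
  moreover have "P i ! 1 \<noteq> P i ! 0" "P i ! 1 \<noteq> P i ! (length (P i) - 1)"
    using l nth_eq_iff_index_eq[OF p(1), of 1] \<open>P i \<noteq> []\<close> by auto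
  ultimately show "P i ! 1 \<notin> {hd (P i), last (P i)}" by simp
qed

lemma loopsE:
  assumes "i \<in> loops I U sl"
  obtains e where "e \<in> U" "\<forall>v\<in>e. sl v = i"
  using assms unfolding loops_def by blast

text \<open>This handles what pairing leaves over in an odd chain. If \<open>z = P y ! 1\<close>
  lies on \<open>P x\<close>, the end \<open>z\<close> of path \<open>w\<close> opens
  \<open>x\<close>; the new path \<open>x\<close> starts at \<open>z\<close> and opens
  \<open>y\<close>, while \<open>w\<close> has lost the slot of \<open>z\<close>. Otherwise
  \<open>unties_all\<close> turns the cycles of \<open>x\<close> and \<open>y\<close> into two
  paths, one of which starts at \<open>z\<close>, has spare room and opens \<open>w\<close>.\<close>

lemma open_three:
  assumes st: "state I U P sl" and L: "x \<in> loops I U sl" "y \<in> loops I U sl" "w \<in> loops I U sl"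
    and d: "distinct [x, y, w]"
    and xy: "P x ! 1 \<in> \<Union>U" "sl (P x ! 1) = y" and yw: "P y ! 1 \<in> \<Union>U" "sl (P y ! 1) = w"
  shows "\<exists>U' P' sl'. state I U' P' sl' \<and> loops I U' sl' \<subseteq> loops I U sl - {x, y, w} \<and>
     (\<forall>l. l \<notin> {x, y, w} \<longrightarrow> P' l = P l) \<and> (\<forall>e\<in>U. \<not> sl ` e \<subseteq> {x, y, w} \<longrightarrow> e \<in> U')"
proof -
  obtain e1 where e1: "e1 \<in> U" "\<forall>v\<in>e1. sl v = x" using L(1) by (rule loopsE)
  obtain e2 where e2: "e2 \<in> U" "\<forall>v\<in>e2. sl v = y" using L(2) by (rule loopsE)
  obtain e3 where e3: "e3 \<in> U" "\<forall>v\<in>e3. sl v = w" using L(3) by (rule loopsE)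
  have I: "x \<in> I" "y \<in> I" "w \<in> I" using L unfolding loops_def by auto
  define z where "z = P y ! 1"
  have z: "z \<in> \<Union>U" "sl z = w" using yw unfolding z_def by auto
  have zy: "z \<in> set (P y)" using state_second[OF st I(2)] unfolding z_def by simp
  have zw: "z \<in> {hd (P w), last (P w)}" using state_slot(2)[OF st z(1)] z(2) by simp
  have e2E: "e2 \<noteq> {}" "e3 \<noteq> {}" using edge_not_single state_finite(3)[OF st] e2 e3 by blast+
  then have e12: "e1 \<noteq> e2" "e1 \<noteq> e3" "e2 \<noteq> e3" using e1(2) e2(2) e3(2) d by (auto simp: ex_in_conv[symmetric])
  show ?thesis
  proof (cases "z \<in> set (P x)")
    case True
    have "w \<noteq> x" using d by auto
    from open_loop[OF st e1 I(3) this zw True disjI1[OF conjI[OF z]]]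
    obtain P1 sl1 where 1: "state I (U - {e1}) P1 sl1" "\<forall>l. l \<notin> {x, w} \<longrightarrow> P1 l = P l"
      "\<forall>v. sl1 v = (if v = z \<and> sl v = w then x else sl v)" "hd (P1 x) = z" "loops I (U - {e1}) sl1 \<subseteq> loops I U sl - {x, w}"
      by blast
    have e2': "e2 \<in> U - {e1}" "\<forall>v\<in>e2. sl1 v = y" using e2 e12 1(3) d by auto
    have "z \<in> \<Union>(U - {e1})" using z e1(2) d by auto
    then have room: "z \<in> \<Union>(U - {e1}) \<and> sl1 z = x" using z 1(3) by simp
    have "P1 y = P y" using 1(2) d by auto
    then have zy': "z \<in> set (P1 y)" using zy by simp
    have xy': "x \<noteq> y" using d by auto
    have c: "z \<in> {hd (P1 x), last (P1 x)}" using 1(4) by simp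
    from open_loop[OF 1(1) e2' I(1) xy' c zy' disjI1[OF room]]
    obtain P2 sl2 where 2: "state I (U - {e1} - {e2}) P2 sl2" "\<forall>l. l \<notin> {y, x} \<longrightarrow> P2 l = P1 l"
      "loops I (U - {e1} - {e2}) sl2 \<subseteq> loops I (U - {e1}) sl1 - {y, x}" by blast
    show ?thesis
    proof (intro exI conjI)
      show "state I (U - {e1} - {e2}) P2 sl2" by (rule 2)
      show "loops I (U - {e1} - {e2}) sl2 \<subseteq> loops I U sl - {x, y, w}" using 1(5) 2(3) by blast
      show "\<forall>l. l \<notin> {x, y, w} \<longrightarrow> P2 l = P l" using 1(2) 2(2) by simp
      show "\<forall>e\<in>U. \<not> sl ` e \<subseteq> {x, y, w} \<longrightarrow> e \<in> U - {e1} - {e2}" using e1(2) e2(2) by auto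
    qed
  next
    case False
    note lx = state_loop[OF st e1] and ly = state_loop[OF st e2]
    let ?W = "{e1, e2}"
    have W: "?W \<subseteq> U" using e1 e2 by simp
    have yx: "y \<noteq> x" "y \<noteq> w" using d by auto
    have mW: "mset_set ?W = {#e1#} + {#e2#}" using e12 by simp
    have tot: "cyc (P y) + cyc (P x) = el (P y) + el (P x) + mset_set ?W"
      unfolding lx(4) ly(4) mW by simp
    then have sub: "cyc (P y) + cyc (P x) \<subseteq># mset_set E"
      using state_sub[OF st I(2,1) yx(1) W] by simp
    obtain p p' ps where Py: "P y = p # p' # ps" using ly(3) k3 by (cases "P y" rule: remdups_adj.cases) auto
    have p': "p' = z" using Py unfolding z_def by simp
    have "P x ! 1 \<in> set (P x)" using state_second[OF st I(1)] by simp
    moreover have "P x ! 1 \<in> {hd (P y), last (P y)}" using state_slot(2)[OF st xy(1)] xy(2) by simp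
    ultimately have v0: "p \<in> set (P x) \<or> last (p # p' # ps) \<in> set (P x)" unfolding Py by auto
    have "unties p' (cyc (p # p' # ps) + cyc (P x))"
    proof (rule unties_all)
      show "distinct (p # p' # ps)" using state_path(1)[OF st I(2)] unfolding Py .
      show "distinct (P x)" by (rule state_path(1)[OF st I(1)])
    qed (use sub Py ly(3) lx(3) False v0 p' in auto)
    then obtain R R' where R: "el R + el R' = cyc (P y) + cyc (P x)" "distinct R" "distinct R'" "hd R = z"
      "2 * k \<le> length R" "length R \<le> 2 * k + 1" "2 * k \<le> length R'" "length R' \<le> 2 * k + 2"
      unfolding unties_def Py p' by blast
    have noslot: "sl v \<noteq> x \<and> sl v \<noteq> y" if "v \<in> \<Union>(U - ?W)" for v
    proof -
      have v: "v \<in> \<Union>U" "v \<in> \<Union>(U - {e1})" "v \<in> \<Union>(U - {e2})" using that by auto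
      show ?thesis using lx(6)[OF v(1)] ly(6)[OF v(1)] state_disjoint[OF st e1(1), of v] state_disjoint[OF st e2(1), of v] v by blast
    qed
    then have empty: "{v \<in> \<Union>(U - ?W). sl v = x} = {}" "{v \<in> \<Union>(U - ?W). sl v = y} = {}" by blast+
    have st1: "state I (U - ?W) (P(y := R, x := R')) sl"
    proof (rule state_update[OF st I(2,1) yx(1) W])
      show "el R + el R' = el (P y) + el (P x) + mset_set ?W" using R(1) tot by simp
      show "length R + card {v \<in> \<Union>(U - ?W). sl v = y} \<le> 2 * k + 2" unfolding empty using R by simp
      show "length R' + card {v \<in> \<Union>(U - ?W). sl v = x} \<le> 2 * k + 2" unfolding empty using R by simp
    qed (use R noslot in auto)
    have w: "(P(y := R, x := R')) w = P w" "(P(y := R, x := R')) y = R" using d by auto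
    have e3': "e3 \<in> U - ?W" using e3 e12 by auto
    have ywI: "y \<noteq> w" using d by auto
    have c: "z \<in> {hd ((P(y := R, x := R')) y), last ((P(y := R, x := R')) y)}" unfolding w using R by simp
    have "P w \<noteq> []" using state_path(2)[OF st I(3)] k3 by auto
    then have zset: "z \<in> set ((P(y := R, x := R')) w)" unfolding w using zw by auto
    have room: "length ((P(y := R, x := R')) y) + card {v \<in> \<Union>(U - ?W). sl v = y} \<le> 2 * k + 1" unfolding w empty using R by simp
    from open_loop[OF st1 e3' e3(2) I(2) ywI c zset disjI2[OF room]]
    obtain P2 sl2 where 2: "state I (U - ?W - {e3}) P2 sl2" "\<forall>l. l \<notin> {w, y} \<longrightarrow> P2 l = (P(y := R, x := R')) l"
      "loops I (U - ?W - {e3}) sl2 \<subseteq> loops I (U - ?W) sl - {w, y}" by blast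
    have "x \<notin> loops I (U - ?W) sl"
    proof
      assume "x \<in> loops I (U - ?W) sl"
      then obtain e where e: "e \<in> U - ?W" "\<forall>v\<in>e. sl v = x" by (rule loopsE)
      then have "e = {}" using noslot by blast
      then show False using e edge_not_single state_finite(3)[OF st] by blast
    qed
    moreover have "loops I (U - ?W) sl \<subseteq> loops I U sl" unfolding loops_def by blast
    ultimately have sub: "loops I (U - ?W - {e3}) sl2 \<subseteq> loops I U sl - {x, y, w}" using 2(3) by blast
    show ?thesis
    proof (intro exI conjI)
      show "state I (U - ?W - {e3}) P2 sl2" by (rule 2)
      show "loops I (U - ?W - {e3}) sl2 \<subseteq> loops I U sl - {x, y, w}" by (rule sub)
      show "\<forall>l. l \<notin> {x, y, w} \<longrightarrow> P2 l = P l" using 2(2) by simp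
      show "\<forall>e\<in>U. \<not> sl ` e \<subseteq> {x, y, w} \<longrightarrow> e \<in> U - ?W - {e3}" using e1(2) e2(2) e3(2) by auto
    qed
  qed
qed

text \<open>Opening \<open>x\<close> with the next loop \<open>y\<close> disposes of both, so the
  chain is consumed in pairs, with a triple at the end if its length is odd. The last hypothesis
  keeps the second vertices of the other loops out of the edges that are used up.\<close>

lemma open_chain:
  assumes "state I U P sl" "distinct cs" "2 \<le> length cs" "set cs \<subseteq> loops I U sl"
    and "successively (\<lambda>x y. P x ! 1 \<in> \<Union>U \<and> sl (P x ! 1) = y) cs"
    and "\<And>l. l \<in> loops I U sl - set cs \<Longrightarrow> P l ! 1 \<in> \<Union>U \<and> sl (P l ! 1) \<notin> set cs"
  shows "\<exists>U' P' sl'. state I U' P' sl' \<and> loops I U' sl' \<subseteq> loops I U sl - set cs \<and> (\<forall>l\<in>loops I U' sl'. P' l ! 1 \<in> \<Union>U')"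
  using assms
proof (induction "length cs" arbitrary: cs U P sl rule: less_induct)
  case less
  note st = less.prems(1)
  obtain x y rest where cs: "cs = x # y # rest" using less.prems(3) by (cases cs rule: remdups_adj.cases) auto
  have I: "x \<in> I" "y \<in> I" using less.prems(4) unfolding cs loops_def by auto
  have xy: "P x ! 1 \<in> \<Union>U" "sl (P x ! 1) = y" using less.prems(5) unfolding cs by auto
  have d: "x \<noteq> y" "x \<notin> set rest" "y \<notin> set rest" "distinct rest" using less.prems(2) unfolding cs by auto
  show ?case
  proof (cases "length rest = 1")
    case True
    then obtain w where rest: "rest = [w]" by (cases rest) auto
    have yw: "P y ! 1 \<in> \<Union>U" "sl (P y ! 1) = w" using less.prems(5) unfolding cs rest by auto
    have L: "x \<in> loops I U sl" "y \<in> loops I U sl" "w \<in> loops I U sl" "distinct [x, y, w]"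
      using less.prems(2,4) unfolding cs rest by auto
    have set: "set cs = {x, y, w}" unfolding cs rest by simp
    from open_three[OF st L xy yw] obtain U' P' sl' where 1: "state I U' P' sl'" "loops I U' sl' \<subseteq> loops I U sl - {x, y, w}"
      "\<forall>l. l \<notin> {x, y, w} \<longrightarrow> P' l = P l" "\<forall>e\<in>U. \<not> sl ` e \<subseteq> {x, y, w} \<longrightarrow> e \<in> U'" by blast
    have "P' l ! 1 \<in> \<Union>U'" if l: "l \<in> loops I U' sl'" for l
    proof -
      have "l \<in> loops I U sl - set cs" using l 1(2) set by blast
      then have "P l ! 1 \<in> \<Union>U" "sl (P l ! 1) \<notin> {x, y, w}" "P' l = P l" using less.prems(6) 1(3) set by auto
      then show ?thesis using 1(4) by fastforce
    qed
    then show ?thesis using 1 set by (intro exI[of _ U'] exI[of _ P'] exI[of _ sl']) simp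
  next
    case False
    have "x \<in> loops I U sl" using less.prems(4) unfolding cs by simp
    then obtain e where e: "e \<in> U" "\<forall>v\<in>e. sl v = x" by (rule loopsE)
    have c: "P x ! 1 \<in> {hd (P y), last (P y)}" using state_slot(2)[OF st xy(1)] xy(2) by simp
    from open_loop[OF st e I(2) d(1)[symmetric] c state_second(1)[OF st I(1)] disjI1[OF conjI[OF xy]]]
    obtain P1 sl1 where 1: "state I (U - {e}) P1 sl1" "\<forall>l. l \<notin> {x, y} \<longrightarrow> P1 l = P l"
      "\<forall>v. sl1 v = (if v = P x ! 1 \<and> sl v = y then x else sl v)" "loops I (U - {e}) sl1 \<subseteq> loops I U sl - {x, y}"
      by blast
    have keep: "v \<in> \<Union>(U - {e})" if "v \<in> \<Union>U" "sl v \<noteq> x" for v using that e(2) by auto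
    have others: "P1 l ! 1 \<in> \<Union>(U - {e}) \<and> sl1 (P1 l ! 1) \<notin> set rest" if l: "l \<in> loops I (U - {e}) sl1 - set rest" for l
    proof -
      have l': "l \<in> loops I U sl - set cs" using l 1(4) cs by auto
      then have "P l ! 1 \<in> \<Union>U" "sl (P l ! 1) \<notin> set cs" using less.prems(6) by auto
      moreover have "P1 l = P l" using l 1(2,4) by blast
      ultimately show ?thesis using keep[of "P l ! 1"] 1(3) cs d by simp
    qed
    show ?thesis
    proof (cases "rest = []")
      case True
      then show ?thesis using 1(1,4) others cs by (intro exI[of _ "U - {e}"] exI[of _ P1] exI[of _ sl1]) simp
    next
      case nonempty: False
      have len: "length rest < length cs" "2 \<le> length rest" using False nonempty cs by (cases rest; cases "tl rest"; auto)+
      have sub: "set rest \<subseteq> loops I (U - {e}) sl1"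
      proof
        fix l assume l: "l \<in> set rest"
        then have lxy: "l \<noteq> x" "l \<noteq> y" using d by auto
        have "l \<in> loops I U sl" using l less.prems(4) cs by auto
        then obtain e' where e': "e' \<in> U" "\<forall>v\<in>e'. sl v = l" by (rule loopsE)
        have "e' \<noteq> {}" using edge_not_single state_finite(3)[OF st] e' by blast
        then have "e' \<noteq> e" using e'(2) e(2) lxy by auto
        moreover have "\<forall>v\<in>e'. sl1 v = l" using e'(2) 1(3) lxy by auto
        ultimately show "l \<in> loops I (U - {e}) sl1" using e'(1) \<open>l \<in> loops I U sl\<close> unfolding loops_def by blast
      qed
      have "successively (\<lambda>x y. P x ! 1 \<in> \<Union>U \<and> sl (P x ! 1) = y) rest"
        using less.prems(5) unfolding cs by (cases rest) auto
      then have succ: "successively (\<lambda>x y. P1 x ! 1 \<in> \<Union>(U - {e}) \<and> sl1 (P1 x ! 1) = y) rest"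
      proof (rule successively_mono)
        fix a b assume ab: "a \<in> set rest" "b \<in> set rest" "P a ! 1 \<in> \<Union>U \<and> sl (P a ! 1) = b"
        then have "P1 a = P a" "b \<noteq> x" "b \<noteq> y" using 1(2) d by auto
        then show "P1 a ! 1 \<in> \<Union>(U - {e}) \<and> sl1 (P1 a ! 1) = b" using keep[of "P a ! 1"] ab(3) 1(3) by auto
      qed
      from less.hyps[OF len(1) 1(1) d(4) len(2) sub succ others]
      obtain U' P' sl' where 2: "state I U' P' sl'" "loops I U' sl' \<subseteq> loops I (U - {e}) sl1 - set rest"
        "\<forall>l\<in>loops I U' sl'. P' l ! 1 \<in> \<Union>U'" by blast
      moreover have "loops I U' sl' \<subseteq> loops I U sl - set cs" using 2(2) 1(4) cs by auto
      ultimately show ?thesis by blast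
    qed
  qed
qed

text \<open>A bijection without fixed points: a longest list of successive values is a full cycle.\<close>
lemma full_cycle:
  assumes "finite L" "L \<noteq> {}" "inj_on f L" "f ` L \<subseteq> L" "\<And>x. x \<in> L \<Longrightarrow> f x \<noteq> x"
  obtains cs where "distinct cs" "2 \<le> length cs" "set cs \<subseteq> L" "successively (\<lambda>x y. f x = y) cs"
    "\<And>x. x \<in> L - set cs \<Longrightarrow> f x \<notin> set cs"
proof -
  define ok where "ok cs \<longleftrightarrow> cs \<noteq> [] \<and> distinct cs \<and> set cs \<subseteq> L \<and> successively (\<lambda>x y. f x = y) cs" for cs
  obtain a where "a \<in> L" using assms(2) by blast
  then have "ok [a]" unfolding ok_def by simp
  moreover have "\<forall>cs. ok cs \<longrightarrow> length cs < Suc (card L)"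
    using assms(1) unfolding ok_def by (metis card_mono distinct_card less_Suc_eq_le)
  ultimately obtain cs where cs: "ok cs" "\<And>ds. ok ds \<Longrightarrow> length ds \<le> length cs"
    using ex_has_greatest_nat[of ok "[a]" length "Suc (card L)"] by blast
  have o: "cs \<noteq> []" "distinct cs" "set cs \<subseteq> L" "successively (\<lambda>x y. f x = y) cs" using cs(1) unfolding ok_def by auto
  have lastL: "last cs \<in> L" using o by auto
  have "f (last cs) \<in> set cs"
  proof (rule ccontr)
    assume "f (last cs) \<notin> set cs"
    then have "ok (cs @ [f (last cs)])" using o assms(4) lastL unfolding ok_def by (auto simp: successively_append_iff)
    then show False using cs(2)[of "cs @ [f (last cs)]"] by simp
  qed
  then obtain m where m: "m < length cs" "cs ! m = f (last cs)" by (auto simp: in_set_conv_nth)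
  have next_cs: "f (cs ! n) = cs ! Suc n" if "Suc n < length cs" for n
    using o(4) that unfolding successively_conv_nth by simp
  have pred: "x = cs ! (n - 1)" if "x \<in> L" "f x = cs ! n" "0 < n" "n < length cs" for x n
  proof -
    have "f (cs ! (n - 1)) = f x" using next_cs[of "n - 1"] that by simp
    moreover have "cs ! (n - 1) \<in> L" using that o(3) nth_mem[of "n - 1" cs] by auto
    ultimately show ?thesis using assms(3) that(1) by (metis inj_onD)
  qed
  \<comment> \<open>Every other element of the list is already the image of its predecessor, so by
    injectivity the last one is mapped to the first.\<close>
  have m0: "m = 0"
  proof (rule ccontr)
    assume "m \<noteq> 0"
    then have "last cs = cs ! (m - 1)" using pred[OF lastL _ _ m(1)] m by simp
    then have "cs ! (length cs - 1) = cs ! (m - 1)" using o by (simp add: last_conv_nth)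
    then have "length cs - 1 = m - 1" using o m by (subst (asm) nth_eq_iff_index_eq) auto
    then show False using m \<open>m \<noteq> 0\<close> by simp
  qed
  show ?thesis
  proof (rule that)
    show "distinct cs" "set cs \<subseteq> L" "successively (\<lambda>x y. f x = y) cs" using o by auto
    show "2 \<le> length cs"
    proof (rule ccontr)
      assume "\<not> 2 \<le> length cs"
      then have "length cs = 1" using o(1) by (simp add: not_le less_2_cases_iff)
      then have "cs ! 0 = last cs" using o(1) by (simp add: last_conv_nth)
      then show False using m m0 assms(5)[OF lastL] by simp
    qed
    show "f x \<notin> set cs" if x: "x \<in> L - set cs" for x
    proof
      assume "f x \<in> set cs"
      then obtain n where n: "n < length cs" "f x = cs ! n" by (metis in_set_conv_nth)
      show False
      proof (cases "n = 0")
        case True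
        then have "f x = f (last cs)" using n m m0 by simp
        then have "x = last cs" using assms(3) x lastL by (metis DiffD1 inj_onD)
        then show False using x o(1) by simp
      next
        case False
        then have "x = cs ! (n - 1)" using pred[of x n] x n by simp
        then show False using x n by auto
      qed
    qed
  qed
qed

text \<open>Let \<open>\<phi>\<close> send a loop to the path holding the slot of its second vertex.
  A loop that is not a value of \<open>\<phi>\<close> on loops can be opened by its image, because
  its edge contains no second vertex of a loop. If there is none, \<open>\<phi>\<close> permutes the
  loops without fixed points, and a whole cycle of it is removed by \<open>open_chain\<close>. The
  invariant that second vertices of loops are still waiting for an edge survives both.\<close>

lemma open_all_loops:
  assumes "state I U P sl" "\<forall>l\<in>loops I U sl. P l ! 1 \<in> \<Union>U"
  shows "\<exists>U' P' sl'. state I U' P' sl' \<and> loops I U' sl' = {}"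
  using assms
proof (induction "card (loops I U sl)" arbitrary: U P sl rule: less_induct)
  case less
  note st = less.prems(1)
  define L \<phi> where "L = loops I U sl" and "\<phi> l = sl (P l ! 1)" for l
  have finL: "finite L" using state_finite(1)[OF st] unfolding L_def loops_def by simp
  have LI: "L \<subseteq> I" unfolding L_def loops_def by blast
  have \<phi>: "\<phi> l \<in> I" "P l ! 1 \<in> {hd (P (\<phi> l)), last (P (\<phi> l))}" "\<phi> l \<noteq> l" if "l \<in> L" for l
  proof -
    have z: "P l ! 1 \<in> \<Union>U" using less.prems(2) that unfolding L_def by blast
    show "\<phi> l \<in> I" "P l ! 1 \<in> {hd (P (\<phi> l)), last (P (\<phi> l))}" unfolding \<phi>_def by (rule state_slot[OF st z])+
    then show "\<phi> l \<noteq> l" using state_second(2)[OF st] by metis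
  qed
  have smaller: ?case if "state I U' P' sl'" "loops I U' sl' \<subseteq> L - S" "\<forall>l\<in>loops I U' sl'. P' l ! 1 \<in> \<Union>U'" "S \<subseteq> L" "S \<noteq> {}"
    for U' P' sl' S
  proof -
    have "loops I U' sl' \<subset> L" using that by blast
    then have "card (loops I U' sl') < card L" using finL by (rule psubset_card_mono[rotated])
    then show ?thesis using less.hyps[of U' sl' P'] that(1,3) unfolding L_def by blast
  qed
  show ?case
  proof (cases "\<exists>i\<in>L. \<forall>l\<in>L. \<phi> l \<noteq> i")
    case True
    then obtain i where i: "i \<in> L" "\<And>l. l \<in> L \<Longrightarrow> \<phi> l \<noteq> i" by blast
    then have iI: "i \<in> I" using LI by blast
    obtain e where e: "e \<in> U" "\<forall>v\<in>e. sl v = i" using i(1) unfolding L_def by (rule loopsE)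
    have z: "P i ! 1 \<in> \<Union>U" using less.prems(2) i(1) unfolding L_def by blast
    have room: "P i ! 1 \<in> \<Union>U \<and> sl (P i ! 1) = \<phi> i" using z unfolding \<phi>_def by simp
    from open_loop[OF st e \<phi>(1,3,2)[OF i(1)] state_second(1)[OF st iI] disjI1[OF room]]
    obtain P1 sl1 where 1: "state I (U - {e}) P1 sl1" "\<forall>l. l \<notin> {i, \<phi> i} \<longrightarrow> P1 l = P l"
      "loops I (U - {e}) sl1 \<subseteq> loops I U sl - {i, \<phi> i}"
      by blast
    have "\<forall>l\<in>loops I (U - {e}) sl1. P1 l ! 1 \<in> \<Union>(U - {e})"
    proof
      fix l assume "l \<in> loops I (U - {e}) sl1"
      then have l: "l \<in> L" "l \<notin> {i, \<phi> i}" using 1(3) unfolding L_def by auto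
      then have "P l ! 1 \<in> \<Union>U" "P1 l = P l" using less.prems(2) 1(2) unfolding L_def by auto
      moreover have "P l ! 1 \<notin> e" using i(2)[OF l(1)] e(2) unfolding \<phi>_def by blast
      ultimately show "P1 l ! 1 \<in> \<Union>(U - {e})" by auto
    qed
    moreover have "loops I (U - {e}) sl1 \<subseteq> L - {i}" using 1(3) unfolding L_def by blast
    ultimately show ?thesis using smaller[OF 1(1), of "{i}"] i(1) by blast
  next
    case False
    then have surj: "L \<subseteq> \<phi> ` L" by (metis image_eqI subsetI)
    then have inj: "inj_on \<phi> L" by (rule finite_surj_inj[OF finL])
    then have "\<phi> ` L = L" using surj finL by (metis card_image card_subset_eq finite_imageI)
    show ?thesis
    proof (cases "L = {}")
      case True
      then show ?thesis using st unfolding L_def by blast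
    next
      case nonempty: False
      obtain cs where cs: "distinct cs" "2 \<le> length cs" "set cs \<subseteq> L" "successively (\<lambda>x y. \<phi> x = y) cs"
        "\<And>x. x \<in> L - set cs \<Longrightarrow> \<phi> x \<notin> set cs"
        using full_cycle[OF finL nonempty inj] \<open>\<phi> ` L = L\<close> \<phi>(3) by (metis order_refl)
      have succ: "successively (\<lambda>x y. P x ! 1 \<in> \<Union>U \<and> sl (P x ! 1) = y) cs"
      proof (rule successively_mono[OF cs(4)])
        fix a b assume "a \<in> set cs" "b \<in> set cs" "\<phi> a = b"
        then show "P a ! 1 \<in> \<Union>U \<and> sl (P a ! 1) = b" using less.prems(2) cs(3) unfolding L_def \<phi>_def by blast
      qed
      have oth: "P l ! 1 \<in> \<Union>U \<and> sl (P l ! 1) \<notin> set cs" if "l \<in> loops I U sl - set cs" for l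
        using that less.prems(2) cs(5)[of l] unfolding L_def \<phi>_def by blast
      from open_chain[OF st cs(1,2) _ succ oth] obtain U' P' sl' where
        1: "state I U' P' sl'" "loops I U' sl' \<subseteq> L - set cs" "\<forall>l\<in>loops I U' sl'. P' l ! 1 \<in> \<Union>U'"
        using cs(3) unfolding L_def by blast
      have "set cs \<noteq> {}" using cs(2) by auto
      then show ?thesis using smaller[OF 1 cs(3)] by blast
    qed
  qed
qed

end

section \<open>Euler orientations and two-factorisations\<close>

text \<open>The Halmos-Vaughan induction: a proper nonempty subset without surplus is matched on its
  own and its neighbours are withdrawn from the rest; if every such subset has a surplus, one
  element can be matched arbitrarily.\<close>

theorem hall:
  assumes "finite V" "\<And>v. v \<in> V \<Longrightarrow> finite (A v)" "\<And>S. S \<subseteq> V \<Longrightarrow> card S \<le> card (\<Union>(A ` S))"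
  shows "\<exists>f. inj_on f V \<and> (\<forall>v\<in>V. f v \<in> A v)"
  using assms
proof (induction "card V" arbitrary: V A rule: less_induct)
  case less
  have finN: "finite (\<Union>(A ` S))" if "S \<subseteq> V" for S
    using that less.prems(1,2) by (intro finite_UN_I) (auto intro: finite_subset)
  show ?case
  proof (cases "V = {}")
    case False
    show ?thesis
    proof (cases "\<exists>S. S \<subset> V \<and> S \<noteq> {} \<and> card (\<Union>(A ` S)) \<le> card S")
      case True
      then obtain S where S: "S \<subset> V" "S \<noteq> {}" "card (\<Union>(A ` S)) \<le> card S" by blast
      define N where "N = \<Union>(A ` S)"
      have finS: "finite S" using S(1) less.prems(1) finite_subset by blast
      have finNS: "finite N" using finN[of S] S unfolding N_def by blast
      have c: "card S < card V" "card (V - S) < card V"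
        using S less.prems(1) by (auto intro: psubset_card_mono)
      have "\<exists>f. inj_on f S \<and> (\<forall>v\<in>S. f v \<in> A v)"
        by (rule less.hyps[OF c(1) finS]) (use S less.prems in auto)
      then obtain f where f: "inj_on f S" "\<forall>v\<in>S. f v \<in> A v" by blast
      have "\<exists>g. inj_on g (V - S) \<and> (\<forall>v\<in>V - S. g v \<in> A v - N)"
      proof (rule less.hyps[OF c(2)])
        show "card T \<le> card (\<Union>v\<in>T. A v - N)" if T: "T \<subseteq> V - S" for T
        proof -
          have fT: "finite T" using T less.prems(1) by (meson finite_Diff finite_subset)
          have "card T + card S = card (T \<union> S)" using T fT finS by (subst card_Un_disjoint) auto
          also have "\<dots> \<le> card (\<Union>(A ` (T \<union> S)))" using T S by (intro less.prems(3)) auto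
          also have "\<Union>(A ` (T \<union> S)) = (\<Union>v\<in>T. A v - N) \<union> N" unfolding N_def by auto
          also have "card \<dots> = card (\<Union>v\<in>T. A v - N) + card N"
          proof (rule card_Un_disjoint)
            show "finite (\<Union>v\<in>T. A v - N)" using finN[of T] T by (rule_tac finite_subset[of _ "\<Union>(A ` T)"]) auto
          qed (use finNS in auto)
          finally show ?thesis using S(3) unfolding N_def by simp
        qed
      qed (use less.prems in auto)
      then obtain g where g: "inj_on g (V - S)" "\<forall>v\<in>V - S. g v \<in> A v - N" by blast
      define h where "h v = (if v \<in> S then f v else g v)" for v
      have "inj_on h (S \<union> (V - S))"
      proof (subst inj_on_Un, intro conjI)
        show "inj_on h S" using f(1) unfolding h_def inj_on_def by simp
        show "inj_on h (V - S)" using g(1) unfolding h_def inj_on_def by simp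
        have "h ` S \<subseteq> N" using f(2) unfolding h_def N_def by auto
        moreover have "h ` (V - S) \<inter> N = {}" using g(2) unfolding h_def by auto
        ultimately show "h ` (S - (V - S)) \<inter> h ` (V - S - S) = {}" by blast
      qed
      moreover have "S \<union> (V - S) = V" using S by blast
      ultimately show ?thesis using f(2) g(2) by (intro exI[of _ h]) (auto simp: h_def)
    next
      case no: False
      obtain a where a: "a \<in> V" using False by blast
      have "card {a} \<le> card (\<Union>(A ` {a}))" using a by (intro less.prems(3)) auto
      then obtain b where b: "b \<in> A a" by (cases "A a = {}") auto
      have c: "card (V - {a}) < card V" using a less.prems(1) by (intro psubset_card_mono) auto
      have "\<exists>g. inj_on g (V - {a}) \<and> (\<forall>v\<in>V - {a}. g v \<in> A v - {b})"
      proof (rule less.hyps[OF c])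
        show "card S \<le> card (\<Union>v\<in>S. A v - {b})" if S: "S \<subseteq> V - {a}" for S
        proof (cases "S = {}")
          case False
          have "S \<subset> V" using S a by blast
          then have "card S < card (\<Union>(A ` S))" using no False by (meson not_le)
          also have "card (\<Union>(A ` S)) \<le> card (insert b (\<Union>v\<in>S. A v - {b}))"
          proof (rule card_mono)
            have "finite (\<Union>(A ` S))" using finN[of S] S by blast
            then show "finite (insert b (\<Union>v\<in>S. A v - {b}))" by (rule rev_finite_subset[THEN finite.insertI]) auto
          qed auto
          also have "\<dots> \<le> Suc (card (\<Union>v\<in>S. A v - {b}))" by (metis card_insert_if finite_insert card.infinite le_SucI order_refl zero_le)
          finally show ?thesis by simp
        qed simp
      qed (use less.prems in auto)
      then obtain g where g: "inj_on g (V - {a})" "\<forall>v\<in>V - {a}. g v \<in> A v - {b}" by blast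
      have V: "V = insert a (V - {a})" using a by blast
      have "inj_on (g(a := b)) (insert a (V - {a}))"
        using g by (subst inj_on_insert) (auto simp: inj_on_def)
      then show ?thesis using g(2) b V by (intro exI[of _ "g(a := b)"]) auto
    qed
  qed simp
qed

lemma size_filter_mem: "finite S \<Longrightarrow> size {#p \<in># M. g p \<in> S#} = (\<Sum>v\<in>S. count (image_mset g M) v)"
proof (induction M)
  case (add p M)
  have "(\<Sum>v\<in>S. count (image_mset g (add_mset p M)) v) = (\<Sum>v\<in>S. count (image_mset g M) v) + (\<Sum>v\<in>S. if v = g p then 1 else 0)"
    by (subst sum.distrib[symmetric]) (auto intro!: sum.cong)
  then show ?case using add by simp
qed simp

text \<open>\<open>M\<close> is a regular bipartite multigraph between two copies of
  \<open>V\<close>. Counting its edges gives Hall's condition, and perfect matchings are split off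
  one at a time.\<close>

lemma regular_matchings:
  assumes "finite V"
    and "\<And>v. count (image_mset fst M) v = (if v \<in> V then m else 0)"
    and "\<And>v. count (image_mset snd M) v = (if v \<in> V then m else 0)"
  shows "\<exists>f. (\<forall>i<m. bij_betw (f i) V V) \<and> M = (\<Sum>i<m. image_mset (\<lambda>v. (v, f i v)) (mset_set V))"
  using assms(2,3)
proof (induction m arbitrary: M)
  case 0
  then have "count (image_mset fst M) v = 0" for v by simp
  then have "image_mset fst M = {#}" by (simp add: multiset_eq_iff)
  then show ?case by simp
next
  case (Suc m)
  define A where "A v = {w. (v, w) \<in># M}" for v
  have mem: "v \<in> V \<and> w \<in> V" if "(v, w) \<in># M" for v w
  proof -
    have "v \<in># image_mset fst M" "w \<in># image_mset snd M" using that by force+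
    then have "count (image_mset fst M) v \<noteq> 0" "count (image_mset snd M) w \<noteq> 0" by simp_all
    then show ?thesis unfolding Suc.prems by (auto split: if_splits)
  qed
  have AV: "A v \<subseteq> V" for v using mem unfolding A_def by auto
  have "card S \<le> card (\<Union>(A ` S))" if S: "S \<subseteq> V" for S
  proof -
    let ?N = "\<Union>(A ` S)"
    have fin: "finite S" "finite ?N" "?N \<subseteq> V" using S AV assms(1) by (auto intro: finite_subset)
    have "Suc m * card S = size {#p \<in># M. fst p \<in> S#}"
      using S unfolding size_filter_mem[OF fin(1)] Suc.prems by (subst sum.cong[OF refl, of _ _ "\<lambda>_. Suc m"]) auto
    also have "{#p \<in># M. fst p \<in> S#} \<subseteq># {#p \<in># M. snd p \<in> ?N#}"
    proof (rule mset_subset_eqI)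
      show "count {#p \<in># M. fst p \<in> S#} q \<le> count {#p \<in># M. snd p \<in> ?N#} q" for q
        by (cases "q \<in># M"; cases q) (auto simp: A_def not_in_iff)
    qed
    then have "size {#p \<in># M. fst p \<in> S#} \<le> size {#p \<in># M. snd p \<in> ?N#}" by (rule size_mset_mono)
    also have "\<dots> = Suc m * card ?N"
      using fin(3) unfolding size_filter_mem[OF fin(2)] Suc.prems by (subst sum.cong[OF refl, of _ _ "\<lambda>_. Suc m"]) auto
    finally show ?thesis by (simp only: Suc_mult_le_cancel1)
  qed
  then obtain f where f: "inj_on f V" "\<forall>v\<in>V. f v \<in> A v"
    using hall[OF assms(1), of A] AV assms(1) finite_subset by metis
  have "f ` V \<subseteq> V" using f(2) AV by blast
  then have bij: "bij_betw f V V" using f(1) assms(1) by (metis bij_betw_def endo_inj_surj)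
  define F where "F = image_mset (\<lambda>v. (v, f v)) (mset_set V)"
  have F: "F = mset_set ((\<lambda>v. (v, f v)) ` V)" unfolding F_def by (rule image_mset_mset_set) (auto simp: inj_on_def)
  have "F \<subseteq># M"
  proof (rule mset_subset_eqI)
    fix p show "count F p \<le> count M p"
    proof (cases "p \<in> (\<lambda>v. (v, f v)) ` V")
      case True
      then have "p \<in># M" using f(2) unfolding A_def by auto
      then show ?thesis using True assms(1) unfolding F by (simp add: Suc_le_eq)
    next
      case False
      then show ?thesis unfolding F using assms(1) by simp
    qed
  qed
  then obtain M' where M': "M = F + M'" by (metis subset_mset.add_diff_inverse)
  have fstF: "image_mset fst F = mset_set V" unfolding F_def by (simp add: multiset.map_comp comp_def)
  have sndF: "image_mset snd F = mset_set V" unfolding F_def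
    using image_mset_mset_set[OF f(1)] bij by (simp add: multiset.map_comp comp_def bij_betw_def)
  have c1: "count (image_mset fst M') v = (if v \<in> V then m else 0)" for v
    using Suc.prems(1)[of v] assms(1) unfolding M' by (auto simp: fstF split: if_splits)
  have c2: "count (image_mset snd M') v = (if v \<in> V then m else 0)" for v
    using Suc.prems(2)[of v] assms(1) unfolding M' by (auto simp: sndF split: if_splits)
  obtain g where g: "\<forall>i<m. bij_betw (g i) V V" "M' = (\<Sum>i<m. image_mset (\<lambda>v. (v, g i v)) (mset_set V))"
    using Suc.IH[OF c1 c2] by blast
  have "(\<Sum>i<Suc m. image_mset (\<lambda>v. (v, (g(m := f)) i v)) (mset_set V)) = M' + F"
    unfolding g(2) F_def by simp
  then show ?case using g(1) bij M' by (intro exI[of _ "g(m := f)"]) (auto simp: less_Suc_eq add.commute)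
qed

text \<open>Loops and parallel edges are allowed; two edges \<open>xy\<close> and \<open>yz\<close> are replaced by \<open>xz\<close>.\<close>
lemma euler_orientation:
  fixes M :: "('a \<times> 'a) multiset"
  assumes "\<And>v. even (count (image_mset fst M + image_mset snd M) v)"
  shows "\<exists>M'. image_mset (\<lambda>(u, v). {u, v}) M' = image_mset (\<lambda>(u, v). {u, v}) M \<and> image_mset fst M' = image_mset snd M'"
  using assms
proof (induction "size M" arbitrary: M rule: less_induct)
  case less
  let ?u = "\<lambda>(u, v). {u, v} :: 'a set"
  show ?case
  proof (cases "M = {#}")
    case False
    then obtain x y M1 where M: "M = add_mset (x, y) M1" by (metis multiset_cases surj_pair)
    show ?thesis
    proof (cases "x = y")
      case True
      have "even (count (image_mset fst M1 + image_mset snd M1) v)" for v using less.prems[of v] unfolding M True by (auto split: if_splits)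
      then obtain M' where "image_mset ?u M' = image_mset ?u M1" "image_mset fst M' = image_mset snd M'"
        using less.hyps[of M1] M by auto
      then show ?thesis unfolding M True by (intro exI[of _ "add_mset (y, y) M'"]) simp
    next
      case xy: False
      have "odd (count (image_mset fst M1 + image_mset snd M1) y)" using less.prems[of y] xy unfolding M by (auto split: if_splits)
      then have "count (image_mset fst M1 + image_mset snd M1) y \<noteq> 0" by (metis even_zero)
      then have "y \<in># image_mset fst M1 + image_mset snd M1" by (simp only: count_eq_zero_iff not_not)
      then obtain q where "q \<in># M1" "y = fst q \<or> y = snd q" by auto
      then obtain z where q: "q \<in># M1" "q = (y, z) \<or> q = (z, y)" by (metis prod.collapse)
      then obtain M2 where M2: "M1 = add_mset q M2" by (metis multi_member_split)
      have q2: "?u q = {y, z}" using q(2) by auto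
      have deg: "count (image_mset fst M + image_mset snd M) v =
          count (image_mset fst (add_mset (x, z) M2) + image_mset snd (add_mset (x, z) M2)) v + (if v = y then 2 else 0)" for v
        using q(2) unfolding M M2 by auto
      have "even (count (image_mset fst (add_mset (x, z) M2) + image_mset snd (add_mset (x, z) M2)) v)" for v
        using less.prems[of v] unfolding deg by (simp split: if_splits)
      then obtain M' where M': "image_mset ?u M' = image_mset ?u (add_mset (x, z) M2)" "image_mset fst M' = image_mset snd M'"
        using less.hyps[of "add_mset (x, z) M2"] M M2 by auto
      have "{x, z} \<in># image_mset ?u M'" unfolding M'(1) by simp
      then obtain p where p: "p \<in># M'" "?u p = {x, z}" by auto
      then obtain M3 where M3: "M' = add_mset p M3" by (metis multi_member_split)
      have u3: "image_mset ?u M3 = image_mset ?u M2" using M'(1) p(2) unfolding M3 by simp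
      have "p = (x, z) \<or> p = (z, x)" using p(2) by (cases p) (auto simp: doubleton_eq_iff)
      then show ?thesis
      proof
        assume "p = (x, z)"
        then show ?thesis using M'(2) u3 q2 unfolding M M2 M3
          by (intro exI[of _ "add_mset (x, y) (add_mset (y, z) M3)"]) (simp add: add_mset_commute)
      next
        assume "p = (z, x)"
        then show ?thesis using M'(2) u3 q2 unfolding M M2 M3
          by (intro exI[of _ "add_mset (y, x) (add_mset (z, y) M3)"]) (simp add: add_mset_commute insert_commute)
      qed
    qed
  qed simp
qed

text \<open>Petersen's theorem: an Euler orientation has in- and out-degree \<open>m\<close>
  everywhere, so its arcs form a regular bipartite multigraph.\<close>

lemma two_factorisation:
  assumes V: "finite V" and F: "\<And>e. e \<in> F \<Longrightarrow> \<exists>u v. e = {u, v} \<and> u \<noteq> v \<and> u \<in> V \<and> v \<in> V"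
    and deg: "\<And>v. v \<in> V \<Longrightarrow> card {e \<in> F. v \<in> e} = 2 * m"
  shows "\<exists>f. (\<forall>i<m. bij_betw (f i) V V) \<and> (\<Sum>i<m. \<Sum>v\<in>V. {#{v, f i v}#}) = mset_set F"
proof -
  let ?u = "\<lambda>(u, v). {u, v} :: 'a set"
  have "F \<subseteq> Pow V" using F by auto
  then have finF: "finite F" using V finite_subset by blast
  obtain p where p: "\<And>e. e \<in> F \<Longrightarrow> ?u (p e) = e \<and> fst (p e) \<noteq> snd (p e)"
  proof -
    have "\<forall>e\<in>F. \<exists>q. ?u q = e \<and> fst q \<noteq> snd q" using F by fastforce
    then show ?thesis using that by metis
  qed
  define M where "M = image_mset p (mset_set F)"
  have uM: "image_mset ?u M = mset_set F" unfolding M_def multiset.map_comp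
    using p finF by (subst image_mset_cong[of _ _ id]) auto
  have pe: "of_bool (fst (p e) = v) + of_bool (snd (p e) = v) = (of_bool (v \<in> e) :: nat)" if "e \<in> F" for e v
  proof -
    obtain a b where ab: "p e = (a, b)" by (cases "p e")
    then have "e = {a, b}" "a \<noteq> b" using p[OF that] by auto
    then show ?thesis unfolding ab by auto
  qed
  have cnt: "count (image_mset g (mset_set F)) v = (\<Sum>e\<in>F. of_bool (g e = v))" for g :: "'a set \<Rightarrow> 'a" and v
  proof -
    have "count (image_mset g (mset_set F)) v = (\<Sum>e\<in>F. if g e = v then 1 else 0)"
      using finF by (simp add: count_image_mset vimage_def Int_def sum.If_cases conj_commute)
    then show ?thesis by (simp add: of_bool_def)
  qed
  have degM: "count (image_mset fst M + image_mset snd M) v = card {e \<in> F. v \<in> e}" for v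
  proof -
    have "count (image_mset fst M + image_mset snd M) v = (\<Sum>e\<in>F. of_bool (fst (p e) = v)) + (\<Sum>e\<in>F. of_bool (snd (p e) = v))"
      unfolding M_def multiset.map_comp comp_def count_union cnt ..
    also have "\<dots> = (\<Sum>e\<in>F. of_bool (v \<in> e))" unfolding sum.distrib[symmetric] using pe by (intro sum.cong) auto
    also have "\<dots> = card {e \<in> F. v \<in> e}" using finF by (simp add: of_bool_def sum.If_cases Int_def)
    finally show ?thesis .
  qed
  have zero: "card {e \<in> F. v \<in> e} = 0" if "v \<notin> V" for v
  proof -
    have "{e \<in> F. v \<in> e} = {}" using F that by blast
    then show ?thesis by (simp only: card.empty)
  qed
  have ev: "even (count (image_mset fst M + image_mset snd M) v)" for v
    unfolding degM using deg zero by (cases "v \<in> V") auto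
  from euler_orientation[OF ev] obtain M' where M': "image_mset ?u M' = mset_set F" "image_mset fst M' = image_mset snd M'"
    unfolding uM by blast
  have tw: "count (image_mset fst N + image_mset snd N) v = (\<Sum>q\<in>#N. of_bool (fst q = v) + of_bool (snd q = v))" for N :: "('a \<times> 'a) multiset" and v
    by (induction N) auto
  have simp': "of_bool (fst q = v) + of_bool (snd q = v) = (of_bool (v \<in> ?u q) + of_bool (?u q = {v}) :: nat)" for q :: "'a \<times> 'a" and v
    by (cases q) auto
  \<comment> \<open>Degrees depend only on the unordered edges, the second indicator counting a loop
    twice; so they survive the reorientation, of which only the edges are known.\<close>
  have dN: "count (image_mset fst N + image_mset snd N) v = (\<Sum>e\<in>#image_mset ?u N. of_bool (v \<in> e) + of_bool (e = {v}))" for N :: "('a \<times> 'a) multiset" and v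
    unfolding tw simp' by (simp add: multiset.map_comp comp_def)
  have "count (image_mset fst M' + image_mset snd M') v = card {e \<in> F. v \<in> e}" for v
    unfolding degM[symmetric] dN M'(1) uM ..
  then have c2: "2 * count (image_mset fst M') v = card {e \<in> F. v \<in> e}" for v using M'(2) by (metis count_union mult_2)
  have c: "count (image_mset fst M') v = (if v \<in> V then m else 0)" for v
  proof (cases "v \<in> V")
    case True
    then have "2 * count (image_mset fst M') v = 2 * m" unfolding c2 by (rule deg)
    then show ?thesis using True by simp
  next
    case False
    then have "2 * count (image_mset fst M') v = 0" unfolding c2 by (rule zero)
    then show ?thesis using False by simp
  qed
  have c': "count (image_mset snd M') v = (if v \<in> V then m else 0)" for v using c M'(2) by metis
  from regular_matchings[OF V c c'] obtain f where f: "\<forall>i<m. bij_betw (f i) V V"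
    "M' = (\<Sum>i<m. image_mset (\<lambda>v. (v, f i v)) (mset_set V))" by blast
  have im_sum: "image_mset ?u (\<Sum>i<n. h i) = (\<Sum>i<n. image_mset ?u (h i))" for n :: nat and h
    by (induction n) auto
  have "mset_set F = (\<Sum>i<m. image_mset (\<lambda>v. {v, f i v}) (mset_set V))"
    using M'(1) unfolding f(2) im_sum by (simp add: multiset.map_comp comp_def)
  also have "\<dots> = (\<Sum>i<m. \<Sum>v\<in>V. {#{v, f i v}#})"
  proof (rule sum.cong[OF refl])
    fix i
    show "image_mset (\<lambda>v. {v, f i v}) (mset_set V) = (\<Sum>v\<in>V. {#{v, f i v}#})"
      using V by (induction V rule: finite_induct) auto
  qed
  finally have "mset_set F = (\<Sum>i<m. \<Sum>v\<in>V. {#{v, f i v}#})" .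
  then show ?thesis by (intro exI[of _ f] conjI f(1)) (rule sym)
qed

section \<open>Rotations\<close>

lemma bij_betw_if:
  assumes "bij_betw a W W'" "bij_betw b (V - W) (V - W')" "W \<subseteq> V" "W' \<subseteq> V"
  shows "bij_betw (\<lambda>v. if v \<in> W then a v else b v) V V"
proof -
  have 1: "bij_betw (\<lambda>v. if v \<in> W then a v else b v) W W'"
    by (rule bij_betw_cong[THEN iffD1, OF _ assms(1)]) simp
  have 2: "bij_betw (\<lambda>v. if v \<in> W then a v else b v) (V - W) (V - W')"
    by (rule bij_betw_cong[THEN iffD1, OF _ assms(2)]) simp
  have "bij_betw (\<lambda>v. if v \<in> W then a v else b v) (W \<union> (V - W)) (W' \<union> (V - W'))"
    by (rule bij_betw_combine[OF 1 2]) blast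
  then show ?thesis using assms(3,4) by (simp add: Un_absorb1)
qed

lemma bij_betw_Diff_image:
  assumes "bij_betw g V V" "W \<subseteq> V"
  shows "bij_betw g (V - W) (V - g ` W)"
proof -
  have "g ` (V - W) = V - g ` W" using assms inj_on_image_set_diff[of g V V W] by (auto simp: bij_betw_def)
  then show ?thesis using assms by (auto simp: bij_betw_def intro: inj_on_subset)
qed

text \<open>On a chain of \<open>p\<close> inside \<open>B\<close> every second element is taken,
  beginning with the start. An odd cycle would admit no such choice; the hypothesis allows only
  cycles of length two.\<close>

lemma alternating_subset:
  assumes "finite B" "inj_on p B"
    and "\<And>S s. S \<subseteq> B \<Longrightarrow> p ` S = S \<Longrightarrow> s \<in> S \<Longrightarrow> p (p s) = s \<and> p s \<noteq> s"
  shows "\<exists>R\<subseteq>B. p ` R \<inter> R = {} \<and> B - R \<subseteq> p ` R"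
  using assms
proof (induction "card B" arbitrary: B rule: less_induct)
  case less
  show ?case
  proof (cases "B = {}")
    case False
    \<comment> \<open>Such an \<open>s\<close> starts a chain or lies on a cycle of length two; it
      is taken, and \<open>p s\<close> is dropped.\<close>
    have "\<exists>s\<in>B. p s \<noteq> s \<and> (\<forall>t\<in>B. p t = s \<longrightarrow> t = p s)"
    proof (cases "B \<subseteq> p ` B")
      case True
      then have "p ` B = B" using less.prems(1,2) by (metis card_image card_subset_eq finite_imageI)
      then have *: "p (p s) = s \<and> p s \<noteq> s" if "s \<in> B" for s using less.prems(3)[of B s] that by blast
      obtain s where s: "s \<in> B" using False by blast
      then show ?thesis using * \<open>p ` B = B\<close> less.prems(2) by (metis image_eqI inj_onD)
    next
      case False
      then obtain s where "s \<in> B" "s \<notin> p ` B" by blast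
      then show ?thesis by (intro bexI[of _ s]) (auto simp: image_iff)
    qed
    then obtain s where s: "s \<in> B" "p s \<noteq> s" "\<And>t. t \<in> B \<Longrightarrow> p t = s \<Longrightarrow> t = p s" by blast
    let ?B = "B - {s, p s}"
    have "card ?B < card B" using s(1) less.prems(1) by (intro psubset_card_mono) auto
    then have "\<exists>R\<subseteq>?B. p ` R \<inter> R = {} \<and> ?B - R \<subseteq> p ` R"
    proof (rule less.hyps)
      show "p (p t) = t \<and> p t \<noteq> t" if "S \<subseteq> ?B" "p ` S = S" "t \<in> S" for S t
        by (rule less.prems(3)[of S]) (use that in auto)
    qed (use less.prems in \<open>auto intro: inj_on_subset\<close>)
    then obtain R where R: "R \<subseteq> ?B" "p ` R \<inter> R = {}" "?B - R \<subseteq> p ` R" by blast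
    have "s \<notin> p ` R" using s(3) R(1) by blast
    then have "p ` insert s R \<inter> insert s R = {}" using R s(2) by auto
    moreover have "B - insert s R \<subseteq> p ` insert s R" using R(3) by auto
    ultimately show ?thesis using R(1) s(1) by (intro exI[of _ "insert s R"]) auto
  qed auto
qed

text \<open>\<open>m\<close> is the partner in the first matching, \<open>c\<close> the far end of
  the trail followed from a vertex, and \<open>X\<close> the edges left for two more steps on each
  side. The tentative path at \<open>s\<close> is \<open>g' (g (c s)), g (c s), c s, ..., s, m s,
  ..., c (m s), g (c (m s)), g' (g (c (m s)))\<close>.\<close>

locale matched_graph = girth_graph E k for E :: "'a set set" and k :: nat +
  fixes V :: "'a set" and m c :: "'a \<Rightarrow> 'a" and X :: "'a set multiset"
  assumes finV: "finite V"
    and mV: "v \<in> V \<Longrightarrow> m v \<in> V" and mm: "v \<in> V \<Longrightarrow> m (m v) = v" and m_neq: "v \<in> V \<Longrightarrow> m v \<noteq> v"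
    and c: "bij_betw c V V" and X: "X \<subseteq># mset_set E"
begin

definition perms :: "('a \<Rightarrow> 'a) \<Rightarrow> ('a \<Rightarrow> 'a) \<Rightarrow> bool" where
  "perms g g' \<longleftrightarrow> bij_betw g V V \<and> bij_betw g' V V \<and> (\<Sum>v\<in>V. {#{v, g v}#}) + (\<Sum>v\<in>V. {#{v, g' v}#}) = X"

text \<open>The vertices \<open>s\<close> for which the path through the matching edge at \<open>s\<close> closes up at its last vertex.\<close>
definition bad :: "('a \<Rightarrow> 'a) \<Rightarrow> ('a \<Rightarrow> 'a) \<Rightarrow> 'a set" where
  "bad g g' = {s \<in> V. g' (g (c s)) = g (c (m s))}"

text \<open>The side whose trail reaches \<open>c (m s)\<close> after its \<open>g\<close> step. If
  the path at a bad \<open>s\<close> is rerouted to leave \<open>c (m s)\<close> along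
  \<open>g'\<close>, it takes the last edge of that side, which receives the \<open>g\<close> edge
  at \<open>c (m s)\<close> instead.\<close>

definition nxt :: "('a \<Rightarrow> 'a) \<Rightarrow> 'a \<Rightarrow> 'a" where
  "nxt g s = inv_into V (\<lambda>v. g (c v)) (c (m s))"

text \<open>For a pair with \<open>perms g g'\<close>, \<open>nxt g\<close> permutes
  \<open>V\<close>, and these are its cycles of length at least three that are bad throughout. Such
  a cycle may be odd and then prevents a choice of the vertices to reroute.\<close>

definition core :: "('a \<Rightarrow> 'a) \<Rightarrow> ('a \<Rightarrow> 'a) \<Rightarrow> 'a set" where
  "core g g' = {s \<in> V. (\<forall>n. (nxt g ^^ n) s \<in> bad g g') \<and> nxt g (nxt g s) \<noteq> s}"

lemma cV: "v \<in> V \<Longrightarrow> c v \<in> V" and c_eq: "v \<in> V \<Longrightarrow> w \<in> V \<Longrightarrow> c v = c w \<longleftrightarrow> v = w"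
  using c by (auto simp: bij_betw_def inj_on_eq_iff)

lemma m_eq: "v \<in> V \<Longrightarrow> w \<in> V \<Longrightarrow> m v = m w \<longleftrightarrow> v = w"
  using mm by metis

context
  fixes g g' assumes pg: "perms g g'"
begin

lemma gV: "v \<in> V \<Longrightarrow> g v \<in> V" "v \<in> V \<Longrightarrow> g' v \<in> V"
  and g_eq: "v \<in> V \<Longrightarrow> w \<in> V \<Longrightarrow> g v = g w \<longleftrightarrow> v = w" "v \<in> V \<Longrightarrow> w \<in> V \<Longrightarrow> g' v = g' w \<longleftrightarrow> v = w"
  using pg unfolding perms_def by (auto simp: bij_betw_def inj_on_eq_iff)

lemma bij_h: "bij_betw (\<lambda>v. g (c v)) V V"
  using bij_betw_trans[OF c, of g V] pg unfolding perms_def comp_def by blast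

lemma nxt: "s \<in> V \<Longrightarrow> nxt g s \<in> V" "s \<in> V \<Longrightarrow> g (c (nxt g s)) = c (m s)"
proof -
  assume "s \<in> V"
  then have "c (m s) \<in> (\<lambda>v. g (c v)) ` V" using bij_h cV mV unfolding bij_betw_def by blast
  then show "nxt g s \<in> V" "g (c (nxt g s)) = c (m s)"
    unfolding nxt_def by (rule inv_into_into, rule f_inv_into_f)
qed

lemma nxt_unique: "s \<in> V \<Longrightarrow> t \<in> V \<Longrightarrow> g (c t) = c (m s) \<longleftrightarrow> t = nxt g s"
  using nxt[of s] g_eq(1) c_eq cV by metis

lemma nxt_eq: "s \<in> V \<Longrightarrow> t \<in> V \<Longrightarrow> nxt g s = nxt g t \<longleftrightarrow> s = t"
  using nxt c_eq m_eq mV by metis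

text \<open>\<open>X\<close> counts edges with multiplicity and lies below
  \<open>mset_set E\<close>, so the two permutations together use every edge at most once.\<close>

lemma edges_unique:
  assumes "v \<in> V" "w \<in> V"
  shows "{v, g v} = {w, g w} \<longleftrightarrow> v = w" "{v, g' v} = {w, g' w} \<longleftrightarrow> v = w" "{v, g v} \<noteq> {w, g' w}" "g v \<noteq> v" "g' v \<noteq> v"
proof -
  have XE: "(\<Sum>v\<in>V. {#{v, g v}#}) + (\<Sum>v\<in>V. {#{v, g' v}#}) \<subseteq># mset_set E" using pg X unfolding perms_def by simp
  have cnt: "count (\<Sum>v\<in>V. {#{v, g v}#}) e + count (\<Sum>v\<in>V. {#{v, g' v}#}) e \<le> 1" for e
    using sub_E_count[OF XE, of e] by simp
  have one: "1 \<le> count (\<Sum>v\<in>V. {#{v, f v}#}) {x, f x}" if "x \<in> V" for f x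
  proof -
    have "(\<Sum>v\<in>V. {#{v, f v}#}) = {#{x, f x}#} + (\<Sum>v\<in>V - {x}. {#{v, f v}#})" using that finV by (simp add: sum.remove)
    then show ?thesis by simp
  qed
  have two: "2 \<le> count (\<Sum>v\<in>V. {#{v, f v}#}) {x, f x}" if "x \<in> V" "y \<in> V" "x \<noteq> y" "{x, f x} = {y, f y}" for f x y
  proof -
    have "(\<Sum>v\<in>V. {#{v, f v}#}) = {#{x, f x}#} + ({#{y, f y}#} + (\<Sum>v\<in>V - {x} - {y}. {#{v, f v}#}))"
      using that finV sum.remove[of V x "\<lambda>v. {#{v, f v}#}"] sum.remove[of "V - {x}" y "\<lambda>v. {#{v, f v}#}"] by simp
    then show ?thesis using that by simp
  qed
  show "{v, g v} = {w, g w} \<longleftrightarrow> v = w" using two[OF assms, of g] cnt[of "{v, g v}"] by fastforce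
  show "{v, g' v} = {w, g' w} \<longleftrightarrow> v = w" using two[OF assms, of g'] cnt[of "{v, g' v}"] by fastforce
  show "{v, g v} \<noteq> {w, g' w}"
  proof
    assume eq: "{v, g v} = {w, g' w}"
    have "1 \<le> count (\<Sum>v\<in>V. {#{v, g' v}#}) {v, g v}" unfolding eq by (rule one[OF assms(2)])
    then show False using one[OF assms(1), of g] cnt[of "{v, g v}"] by linarith
  qed
  have "{v, g v} \<in># (\<Sum>v\<in>V. {#{v, g v}#})" "{v, g' v} \<in># (\<Sum>v\<in>V. {#{v, g' v}#})"
    using one[of v g] one[of v g'] assms by (simp_all only: count_greater_eq_one_iff)
  then have "{v, g v} \<in> E" "{v, g' v} \<in> E" using sub_E_mem[OF XE] by auto
  then show "g v \<noteq> v" "g' v \<noteq> v" using edge_neq by metis+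
qed

text \<open>Otherwise \<open>g'\<close> would interchange \<open>g (c s)\<close> and
  \<open>g (c (m s))\<close> and use their edge twice.\<close>

lemma bad_m: "s \<in> bad g g' \<Longrightarrow> m s \<notin> bad g g'"
proof
  assume "s \<in> bad g g'" "m s \<in> bad g g'"
  then have s: "s \<in> V" "g' (g (c s)) = g (c (m s))" "g' (g (c (m s))) = g (c s)" unfolding bad_def by (auto simp: mm)
  then have "{g (c s), g' (g (c s))} = {g (c (m s)), g' (g (c (m s)))}" by auto
  then have "g (c s) = g (c (m s))" using edges_unique(2) s mV cV gV by blast
  then show False using g_eq(1) c_eq cV mV m_neq s(1) by metis
qed

text \<open>Otherwise \<open>g\<close> and \<open>g'\<close> would agree at
  \<open>c (m s)\<close>.\<close>

lemma nxt_bad: "s \<in> bad g g' \<Longrightarrow> nxt g s \<noteq> s"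
proof
  assume "s \<in> bad g g'" "nxt g s = s"
  then have s: "s \<in> V" "g' (g (c s)) = g (c (m s))" "g (c s) = c (m s)" using nxt[of s] unfolding bad_def by auto
  then have "{c (m s), g (c (m s))} = {c (m s), g' (c (m s))}" by simp
  then show False using edges_unique(3) s(1) cV mV by blast
qed

lemma core_sub: "core g g' \<subseteq> bad g g'" "core g g' \<subseteq> V"
proof -
  have "s \<in> bad g g'" if "s \<in> core g g'" for s
  proof -
    have "(nxt g ^^ 0) s \<in> bad g g'" using that unfolding core_def by blast
    then show ?thesis by simp
  qed
  then show "core g g' \<subseteq> bad g g'" "core g g' \<subseteq> V" unfolding core_def by auto
qed

lemma nxt_core: "s \<in> core g g' \<Longrightarrow> nxt g s \<in> core g g'"
proof -
  assume s: "s \<in> core g g'"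
  then have sV: "s \<in> V" using core_sub by blast
  have "(nxt g ^^ n) (nxt g s) \<in> bad g g'" for n
  proof -
    have "(nxt g ^^ Suc n) s \<in> bad g g'" using s unfolding core_def by blast
    then show ?thesis by (simp only: funpow_Suc_right comp_apply)
  qed
  moreover have "nxt g (nxt g (nxt g s)) \<noteq> nxt g s" using s sV nxt_eq nxt unfolding core_def by blast
  ultimately show ?thesis using sV nxt unfolding core_def by blast
qed

lemma nxt_core_image: "nxt g ` core g g' = core g g'"
proof -
  have "inj_on (nxt g) (core g g')" using core_sub nxt_eq unfolding inj_on_def by blast
  moreover have "finite (core g g')" using core_sub finV finite_subset by blast
  moreover have "nxt g ` core g g' \<subseteq> core g g'" using nxt_core by blast
  ultimately show ?thesis by (metis endo_inj_surj)
qed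

lemma core_maximal:
  assumes "S \<subseteq> bad g g'" "nxt g ` S \<subseteq> S" "s \<in> S" "nxt g (nxt g s) \<noteq> s"
  shows "s \<in> core g g'"
proof -
  have "(nxt g ^^ n) s \<in> S" for n by (induction n) (use assms in auto)
  then show ?thesis using assms unfolding core_def bad_def by blast
qed

text \<open>Exchange the two permutations on \<open>g ` c ` core g g'\<close>: the vertices of the core become good.\<close>
lemma core_minimal:
  assumes min: "\<And>f f'. perms f f' \<Longrightarrow> card (bad g g') \<le> card (bad f f')" and s: "s \<in> core g g'"
  shows "g' (g (c (m (nxt g s)))) = g (c s)"
proof (rule ccontr)
  assume no: "g' (g (c (m (nxt g s)))) \<noteq> g (c s)"
  define C W where "C = core g g'" and "W = (\<lambda>s. g (c s)) ` C"
  have CV: "C \<subseteq> V" and Cbad: "C \<subseteq> bad g g'" using core_sub unfolding C_def by auto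
  have WV: "W \<subseteq> V" using CV gV cV unfolding W_def by blast
  have W: "W = (\<lambda>s. c (m s)) ` C"
  proof -
    have "W = (\<lambda>s. g (c (nxt g s))) ` C" unfolding W_def C_def by (subst (1) nxt_core_image[symmetric]) (simp add: image_image)
    also have "\<dots> = (\<lambda>s. c (m s)) ` C" using nxt CV by (intro image_cong) auto
    finally show ?thesis .
  qed
  \<comment> \<open>By the two descriptions of \<open>W\<close>, badness makes \<open>g\<close> and
    \<open>g'\<close> map \<open>W\<close> onto the same set, so exchanging them there yields
    bijections again.\<close>
  have gW: "g ` W = g' ` W"
  proof -
    have "g ` W = (\<lambda>s. g (c (m s))) ` C" unfolding W by (simp add: image_image)
    also have "\<dots> = (\<lambda>s. g' (g (c s))) ` C" using Cbad unfolding bad_def by (intro image_cong) auto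
    finally show ?thesis unfolding W_def by (simp add: image_image)
  qed
  have b: "bij_betw g V V" "bij_betw g' V V" using pg unfolding perms_def by auto
  define f where "f v = (if v \<in> W then g' v else g v)" for v
  define f' where "f' v = (if v \<in> W then g v else g' v)" for v
  have bW: "bij_betw g' W (g ` W)" "bij_betw g W (g ` W)" unfolding bij_betw_def using b WV gW by (auto simp: bij_betw_def intro: inj_on_subset)
  have "bij_betw f V V" unfolding f_def
    by (rule bij_betw_if[OF bW(1) bij_betw_Diff_image[OF b(1) WV] WV]) (use WV gV in blast)
  moreover have "bij_betw f' V V" unfolding f'_def
    by (rule bij_betw_if[OF bW(2) bij_betw_Diff_image[OF b(2) WV, folded gW] WV]) (use WV gV in blast)
  moreover have "(\<Sum>v\<in>V. {#{v, f v}#}) + (\<Sum>v\<in>V. {#{v, f' v}#}) = X"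
  proof -
    have "(\<Sum>v\<in>V. {#{v, f v}#}) + (\<Sum>v\<in>V. {#{v, f' v}#}) = (\<Sum>v\<in>V. {#{v, g v}#}) + (\<Sum>v\<in>V. {#{v, g' v}#})"
      unfolding sum.distrib[symmetric] f_def f'_def by (intro sum.cong) auto
    then show ?thesis using pg unfolding perms_def by simp
  qed
  ultimately have "perms f f'" unfolding perms_def by blast
  note le = min[OF this]
  have mC: "m q \<notin> C" if "q \<in> C" for q using that Cbad bad_m by blast
  have cW: "c q \<in> W \<longleftrightarrow> m q \<in> C" if "q \<in> V" for q
  proof -
    have "c q \<in> W \<longleftrightarrow> (\<exists>t\<in>C. q = m t)" using that CV c_eq mV unfolding W by blast
    then show ?thesis using that CV mm by (metis subsetD)
  qed
  have hW: "g (c q) \<in> W \<longleftrightarrow> q \<in> C" if "q \<in> V" for q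
    using that CV g_eq(1) c_eq cV unfolding W_def by blast
  have fm: "f (c (m t)) = g (c (m (nxt g t)))" if "t \<in> C" for t
  proof -
    have t: "t \<in> V" "nxt g t \<in> bad g g'" using that CV nxt_core core_sub unfolding C_def by auto
    have "f (c (m t)) = g' (g (c (nxt g t)))" using cW[OF mV[OF t(1)]] mm[OF t(1)] that nxt[OF t(1)] unfolding f_def by simp
    then show ?thesis using t(2) unfolding bad_def by simp
  qed
  have fc: "f (c q) = g (c q)" if "q \<in> V" "m q \<notin> C" for q using cW[OF that(1)] that(2) unfolding f_def by simp
  \<comment> \<open>A vertex of \<open>C\<close> becomes good, and a new bad vertex can only be
    \<open>m t\<close> for some \<open>t\<close> in \<open>C\<close> satisfying the claimed
    equation. As \<open>s\<close> violates it, the number of bad vertices drops.\<close>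
  have "bad f f' \<subseteq> (bad g g' - C) \<union> m ` (C - {s})"
  proof
    fix q assume q: "q \<in> bad f f'"
    then have qV: "q \<in> V" and e: "f' (f (c q)) = f (c (m q))" unfolding bad_def by auto
    consider "q \<in> C" | "m q \<in> C" | "q \<notin> C" "m q \<notin> C" by blast
    then show "q \<in> (bad g g' - C) \<union> m ` (C - {s})"
    proof cases
      case 1
      have "f (c q) = g (c q)" using fc[OF qV mC[OF 1]] .
      then have "g (g (c q)) = g (c (m (nxt g q)))" using e fm[OF 1] hW[OF qV] 1 unfolding f'_def by simp
      then have "g (c q) = c (m (nxt g q))" using g_eq(1) qV nxt mV cV gV by metis
      then have "q = nxt g (nxt g q)" using nxt_unique[of "nxt g q" q] nxt qV by simp
      then show ?thesis using 1 unfolding C_def core_def by auto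
    next
      case 2
      define t where "t = m q"
      have t: "t \<in> C" "q = m t" "t \<in> V" using 2 qV mm mV unfolding t_def by auto
      have nt: "nxt g t \<in> C" using nxt_core t unfolding C_def by blast
      have "f (c q) = g (c (m (nxt g t)))" using fm[OF t(1)] t(2) by simp
      moreover have "g (c (m (nxt g t))) \<notin> W" using hW[of "m (nxt g t)"] mC[OF nt] nxt[OF t(3)] mV by simp
      moreover have "f (c t) = g (c t)" using fc[OF t(3) mC[OF t(1)]] .
      ultimately have "g' (g (c (m (nxt g t)))) = g (c t)" using e t mm unfolding f'_def by simp
      then have "t \<noteq> s" using no by blast
      then show ?thesis using t by blast
    next
      case 3
      have "f (c q) = g (c q)" "f (c (m q)) = g (c (m q))" using fc[of q] fc[of "m q"] 3 qV mV mm by simp_all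
      then have "q \<in> bad g g'" using e hW[OF qV] 3 qV unfolding f'_def bad_def by simp
      then show ?thesis using 3 by blast
    qed
  qed
  moreover have fin: "finite C" "finite (bad g g')" using CV finV finite_subset unfolding bad_def by auto
  ultimately have "card (bad f f') \<le> card ((bad g g' - C) \<union> m ` (C - {s}))" by (intro card_mono) auto
  also have "\<dots> \<le> card (bad g g' - C) + card (m ` (C - {s}))" by (rule card_Un_le)
  also have "card (m ` (C - {s})) \<le> card (C - {s})" by (rule card_image_le) (use fin in auto)
  also have "card (C - {s}) < card C" using s fin(1) unfolding C_def by (intro psubset_card_mono) auto
  also have "card (bad g g' - C) + card C = card (bad g g')" using Cbad fin by (metis card_Diff_subset card_mono le_add_diff_inverse2)
  finally show False using le by simp
qed

end

text \<open>If the core is nonempty, the cycles of \<open>g'\<close> through it can be reversed; this empties the core.\<close>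
lemma core_reverse:
  assumes pg: "perms g g'" and min: "\<And>f f'. perms f f' \<Longrightarrow> card (bad g g') \<le> card (bad f f')"
  shows "\<exists>f'. perms g f' \<and> card (bad g f') = card (bad g g') \<and> core g f' = {}"
proof -
  define C where "C = core g g'"
  have CV: "C \<subseteq> V" and Cbad: "C \<subseteq> bad g g'" using core_sub[OF pg] unfolding C_def by auto
  note gV = gV[OF pg] and g_eq = g_eq[OF pg] and nxt = nxt[OF pg] and nxt_eq = nxt_eq[OF pg]
  have star: "g' (g (c (m (nxt g s)))) = g (c s)" if "s \<in> C" for s
    using core_minimal[OF pg min] that unfolding C_def by blast
  have mC: "m q \<notin> C" if "q \<in> C" for q using that Cbad bad_m[OF pg] by blast
  have nC: "nxt g ` C = C" using nxt_core_image[OF pg] unfolding C_def .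
  define x y where "x s = g (c s)" and "y s = g (c (m s))" for s
  define Z where "Z = x ` C \<union> y ` C"
  have xV: "x s \<in> V" and yV: "y s \<in> V" if "s \<in> V" for s using that gV cV mV unfolding x_def y_def by auto
  have x_eq: "x s = x t \<longleftrightarrow> s = t" if "s \<in> V" "t \<in> V" for s t using that g_eq(1) c_eq cV unfolding x_def by metis
  have y_x: "y s = x (m s)" for s unfolding x_def y_def ..
  have ZV: "Z \<subseteq> V" using CV xV yV unfolding Z_def by blast
  have gx: "g' (x s) = y s" if "s \<in> C" for s using that Cbad unfolding bad_def x_def y_def by auto
  have gy: "g' (y (nxt g s)) = x s" if "s \<in> C" for s using star[OF that] unfolding x_def y_def .
  have xZ: "x q \<in> Z \<longleftrightarrow> q \<in> C \<or> m q \<in> C" if "q \<in> V" for q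
  proof -
    have "x q \<in> Z \<longleftrightarrow> q \<in> C \<or> (\<exists>t\<in>C. q = m t)" using that CV x_eq mV unfolding Z_def y_x by blast
    then show ?thesis using that CV mm by (metis subsetD)
  qed
  have b: "bij_betw g V V" "bij_betw g' V V" using pg unfolding perms_def by auto
  \<comment> \<open>Badness sends \<open>x s\<close> to \<open>y s\<close>, and
    \<open>core_minimal\<close> sends \<open>y (nxt g s)\<close> back to \<open>x s\<close>; so
    \<open>Z\<close> is a union of cycles of \<open>g'\<close>.\<close>
  have gZ: "g' ` Z = Z"
  proof -
    have "g' ` y ` C = g' ` y ` nxt g ` C" using nC by simp
    also have "\<dots> = x ` C" using gy by (simp add: image_image)
    finally have "g' ` y ` C = x ` C" .
    moreover have "g' ` x ` C = y ` C" using gx by (simp add: image_image)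
    ultimately show ?thesis unfolding Z_def image_Un by blast
  qed
  have bZ: "bij_betw g' Z Z" using b(2) ZV gZ unfolding bij_betw_def by (auto intro: inj_on_subset)
  define f where "f v = (if v \<in> Z then inv_into Z g' v else g' v)" for v
  have fg: "f (g' z) = z" if "z \<in> Z" for z using that bZ gZ unfolding f_def bij_betw_def by auto
  have fx: "f (x s) = y (nxt g s)" if "s \<in> C" for s
  proof -
    have "nxt g s \<in> C" using nC that by blast
    then show ?thesis using fg[of "y (nxt g s)"] gy[OF that] unfolding Z_def by simp
  qed
  have fy: "f (y s) = x s" if "s \<in> C" for s using fg[of "x s"] gx[OF that] that unfolding Z_def by simp
  have "bij_betw f V V" unfolding f_def
    by (rule bij_betw_if[OF bij_betw_inv_into[OF bZ] bij_betw_Diff_image[OF b(2) ZV, unfolded gZ] ZV ZV])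
  moreover have "(\<Sum>v\<in>V. {#{v, f v}#}) = (\<Sum>v\<in>V. {#{v, g' v}#})"
  proof -
    have split: "(\<Sum>v\<in>V. h v) = (\<Sum>v\<in>Z. h v) + (\<Sum>v\<in>V - Z. h v)" for h :: "'a \<Rightarrow> 'a set multiset"
      using sum.subset_diff[OF ZV finV, of h] by (simp add: add.commute)
    have "(\<Sum>v\<in>Z. {#{v, f v}#}) = (\<Sum>v\<in>Z. {#{g' v, f (g' v)}#})"
      by (rule sum.reindex_bij_betw[OF bZ, symmetric])
    also have "\<dots> = (\<Sum>v\<in>Z. {#{v, g' v}#})" using fg by (intro sum.cong) (auto simp: insert_commute)
    finally have "(\<Sum>v\<in>Z. {#{v, f v}#}) = (\<Sum>v\<in>Z. {#{v, g' v}#})" .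
    moreover have "(\<Sum>v\<in>V - Z. {#{v, f v}#}) = (\<Sum>v\<in>V - Z. {#{v, g' v}#})" by (intro sum.cong) (auto simp: f_def)
    ultimately show ?thesis unfolding split by simp
  qed
  ultimately have pf: "perms g f" using pg unfolding perms_def by simp
  \<comment> \<open>Badness moves from each \<open>q\<close> in \<open>C\<close> to
    \<open>m q\<close>. Since the number of bad vertices is kept, the new pair is minimal too and
    \<open>core_minimal\<close> applies to it.\<close>
  have bad: "bad g f = (bad g g' - C) \<union> m ` C"
  proof (intro set_eqI)
    fix q
    show "q \<in> bad g f \<longleftrightarrow> q \<in> (bad g g' - C) \<union> m ` C"
    proof (cases "q \<in> V")
      case qV: True
      consider "q \<in> C" | "m q \<in> C" | "q \<notin> C" "m q \<notin> C" by blast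
      then show ?thesis
      proof cases
        case 1
        have "f (x q) \<noteq> y q"
        proof
          assume "f (x q) = y q"
          then have "x (m (nxt g q)) = x (m q)" using fx[OF 1] y_x by simp
          then have "nxt g q = q" using x_eq m_eq nxt mV qV by metis
          then show False using nxt_bad[OF pg] 1 Cbad by blast
        qed
        then have "q \<notin> bad g f" unfolding bad_def x_def y_def by simp
        moreover have "q \<notin> m ` C" using mC 1 mm CV by force
        ultimately show ?thesis using 1 by blast
      next
        case 2
        have "y (m q) = x q" unfolding y_x using mm qV by simp
        then have "f (x q) = x (m q)" using fy[OF 2] by simp
        then have "q \<in> bad g f" using qV unfolding bad_def x_def by simp
        moreover have "q \<in> m ` C" using 2 mm qV by force
        ultimately show ?thesis by blast
      next
        case 3
        have "x q \<notin> Z" using xZ[OF qV] 3 by simp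
        then have "q \<in> bad g f \<longleftrightarrow> q \<in> bad g g'" unfolding bad_def f_def x_def by simp
        moreover have "q \<notin> m ` C" using 3 mm CV by force
        ultimately show ?thesis using 3 by blast
      qed
    next
      case False
      then show ?thesis using CV mV unfolding bad_def by blast
    qed
  qed
  have fin: "finite C" "finite (bad g g')" using CV finV finite_subset unfolding bad_def by auto
  have "card (bad g f) = card (bad g g' - C) + card (m ` C)" unfolding bad
  proof (rule card_Un_disjoint)
    show "(bad g g' - C) \<inter> m ` C = {}" using bad_m[OF pg] Cbad by blast
  qed (use fin in auto)
  also have "card (m ` C) = card C" using CV m_eq by (intro card_image inj_onI) blast
  also have "card (bad g g' - C) + card C = card (bad g g')" using Cbad fin by (metis card_Diff_subset card_mono le_add_diff_inverse2)
  finally have card: "card (bad g f) = card (bad g g')" .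
  note f_eq = matched_graph.g_eq(2)[OF matched_graph_axioms pf]
  have "core g f = {}"
  proof (rule ccontr)
    assume "core g f \<noteq> {}"
    \<comment> \<open>A new core avoiding the partners of \<open>C\<close> would consist of vertices
      already bad for \<open>g'\<close>, hence lie in the old core \<open>C\<close>, all of whose
      vertices are now good.\<close>
    have "\<exists>s\<in>C. m s \<in> core g f"
    proof (rule ccontr)
      assume no: "\<not> ?thesis"
      have sub: "core g f \<subseteq> bad g g' - C"
        using core_sub(1)[OF pf] no unfolding bad by blast
      obtain u where u: "u \<in> core g f" using \<open>core g f \<noteq> {}\<close> by blast
      have "u \<in> core g g'"
        by (rule core_maximal[OF pg, of "core g f"]) (use sub u nxt_core_image[OF pf] in \<open>auto simp: core_def\<close>)
      then show False using sub u unfolding C_def by blast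
    qed
    then obtain s where s: "s \<in> C" "m s \<in> core g f" by blast
    have sV: "s \<in> V" using s CV by blast
    obtain r where r: "r \<in> C" "s = nxt g r" using nC s(1) by (metis imageE)
    have rV: "r \<in> V" using r CV by blast
    let ?q = "m (nxt g (m s))"
    have qV: "?q \<in> V" using sV mV nxt by blast
    have min': "card (bad g f) \<le> card (bad h h')" if "perms h h'" for h h' using min[OF that] card by simp
    \<comment> \<open>Minimality of the new pair and the reversal give two preimages of
      \<open>y s\<close> under \<open>f\<close>. Equating them makes \<open>g\<close> interchange
      \<open>x s\<close> and \<open>y r\<close>, a repeated edge.\<close>
    have "f (x ?q) = y s" using core_minimal[OF pf min' s(2)] unfolding x_def y_def .
    moreover have "f (x r) = y s" using fx[OF r(1)] r(2) by simp
    ultimately have "x ?q = x r" using f_eq xV qV rV by metis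
    then have "?q = r" using x_eq qV rV by simp
    then have "nxt g (m s) = m r" using mm nxt mV sV by metis
    then have "g (c (m r)) = c s" using nxt(2)[OF mV[OF sV]] mm[OF sV] by simp
    then have 1: "g (y r) = x s" unfolding x_def y_def by simp
    have "x s = c (m r)" using nxt(2)[OF rV] r(2) unfolding x_def by simp
    then have 2: "g (x s) = y r" unfolding y_def by simp
    have "{x s, g (x s)} = {y r, g (y r)}" unfolding 1 2 by (rule insert_commute)
    then have "x s = y r" using edges_unique(1)[OF pg] xV yV sV rV by blast
    then have "s = m r" using x_eq sV rV mV unfolding y_x by blast
    then show False using mC r s by blast
  qed
  then show ?thesis using pf card by blast
qed

text \<open>\<open>R\<close> contains the bad vertices whose path is rerouted. It must be disjoint
  from its image under \<open>nxt g\<close>, which gives up edges; a bad vertex outside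
  \<open>R\<close> is cured by the exchange of its own last edge. An empty core leaves only chains
  and cycles of length two.\<close>

lemma rotations_exist:
  assumes "perms g0 g0'"
  shows "\<exists>g g' R. perms g g' \<and> R \<subseteq> bad g g' \<and> nxt g ` R \<inter> R = {} \<and> bad g g' - R \<subseteq> nxt g ` R"
proof -
  obtain p where p: "case_prod perms p" "\<And>q. case_prod perms q \<Longrightarrow> card (case_prod bad p) \<le> card (case_prod bad q)"
    using ex_has_least_nat[of "case_prod perms" "(g0, g0')" "\<lambda>p. card (case_prod bad p)"] assms by auto
  obtain g g' where gg: "p = (g, g')" by (cases p)
  obtain f' where f: "perms g f'" "card (bad g f') = card (bad g g')" "core g f' = {}"
    using core_reverse[of g g'] p unfolding gg by fastforce
  have "\<exists>R\<subseteq>bad g f'. nxt g ` R \<inter> R = {} \<and> bad g f' - R \<subseteq> nxt g ` R"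
  proof (rule alternating_subset)
    show "finite (bad g f')" using finV unfolding bad_def by simp
    show "inj_on (nxt g) (bad g f')" using nxt_eq[OF f(1)] unfolding bad_def inj_on_def by blast
    show "nxt g (nxt g s) = s \<and> nxt g s \<noteq> s" if S: "S \<subseteq> bad g f'" "nxt g ` S = S" "s \<in> S" for S s
    proof
      show "nxt g (nxt g s) = s" using core_maximal[OF f(1) S(1) _ S(3)] S(2) f(3) by auto
      show "nxt g s \<noteq> s" using nxt_bad[OF f(1)] S by blast
    qed
  qed
  then show ?thesis using f(1) by blast
qed

end

section \<open>Assembling the paths through the first matching\<close>

lemma el_Cons_hd: "xs \<noteq> [] \<Longrightarrow> el (x # xs) = add_mset {x, hd xs} (el xs)"
  by (cases xs) simp_all

lemma el_rev_append:
  assumes "xs \<noteq> []" "ys \<noteq> []"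
  shows "el (rev xs @ ys) = el xs + el ys + {#{hd xs, hd ys}#}"
proof -
  obtain z zs where z: "ys = z # zs" using assms(2) by (cases ys) auto
  have "el (rev xs @ ys) = el (rev xs @ [z]) + el ys" unfolding z by (rule el_append)
  also have "el (rev xs @ [z]) = add_mset {hd xs, z} (el xs)"
    using assms(1) el_snoc_last[of "rev xs" z] by (simp add: last_rev el_rev)
  finally show ?thesis using z by simp
qed

text \<open>Only three pairs of positions among \<open>2 * k\<close> vertices are at least
  \<open>2 * k - 2\<close> steps apart, and the hypotheses exclude them.\<close>

lemma (in girth_graph) trail_ends_distinct:
  assumes tr: "trail (a # xs @ [b])" and len: "length xs = 2 * k - 2"
    and ne: "a \<noteq> last xs" "hd xs \<noteq> b" "a \<noteq> b"
  shows "distinct (a # xs @ [b])"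
proof (rule trail_distinctI[OF tr])
  fix i j assume ij: "i < j" "j < length (a # xs @ [b])" "2 * k - 2 \<le> j - i"
  have xs: "xs \<noteq> []" using len k3 by auto
  have l: "(a # xs @ [b]) ! (2 * k - 2) = last xs" "(a # xs @ [b]) ! (2 * k - 1) = b" "(a # xs @ [b]) ! 1 = hd xs"
    using xs len k3 by (auto simp: nth_Cons' nth_append last_conv_nth hd_conv_nth)
  have "i = 0 \<and> j = 2 * k - 2 \<or> i = 1 \<and> j = 2 * k - 1 \<or> i = 0 \<and> j = 2 * k - 1"
    using ij len k3 by auto
  then show "(a # xs @ [b]) ! i \<noteq> (a # xs @ [b]) ! j" using l ne by (elim disjE conjE) simp_all
qed

context matched_graph
begin

text \<open>One vertex of each matching edge will index its path; it is taken from \<open>R\<close>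
  where the edge meets \<open>R\<close>. The choice \<open>r\<close> depends only on the unordered
  pair.\<close>

lemma representatives:
  assumes "R \<subseteq> V" "\<And>r. r \<in> R \<Longrightarrow> m r \<notin> R"
  obtains A where "R \<subseteq> A" "A \<subseteq> V" "\<And>v. v \<in> V \<Longrightarrow> m v \<in> A \<longleftrightarrow> v \<notin> A"
proof -
  define r :: "'a set \<Rightarrow> 'a" where "r e = (SOME x. x \<in> e)" for e
  define A where "A = R \<union> {v \<in> V. v \<notin> R \<and> m v \<notin> R \<and> r {v, m v} = v}"
  have "m v \<in> A \<longleftrightarrow> v \<notin> A" if v: "v \<in> V" for v
  proof -
    have "r {m v, v} = r {v, m v}" by (simp only: insert_commute)
    moreover have "r {v, m v} \<in> {v, m v}" unfolding r_def by (rule someI[of _ v]) simp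
    ultimately show ?thesis using v mm[OF v] mV[OF v] m_neq[OF v] assms(2)[of v] assms(2)[of "m v"] unfolding A_def by auto
  qed
  then show ?thesis using that[of A] assms(1) unfolding A_def by blast
qed

lemma half_paths:
  assumes p0: "perms g0 g0'"
    and tok: "\<And>v. v \<in> V \<Longrightarrow> tok v \<noteq> [] \<and> hd (tok v) = v \<and> last (tok v) = c v \<and> length (tok v) = k - 2"
    and sub: "(\<Sum>v\<in>V. el (tok v)) + X + mset_set ((\<lambda>v. {v, m v}) ` V) \<subseteq># mset_set E"
  shows "\<exists>(A :: 'a set) P. finite A \<and> 2 * card A = card V \<and> (\<Sum>s\<in>A. el (P s)) = (\<Sum>v\<in>V. el (tok v)) + X + mset_set ((\<lambda>v. {v, m v}) ` V) \<and>
     (\<forall>s\<in>A. distinct (P s) \<and> length (P s) = 2 * k) \<and> (\<forall>v\<in>V. \<exists>s\<in>A. v \<in> {hd (P s), last (P s)})"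
proof -
  from rotations_exist[OF p0] obtain g g' R where pg: "perms g g'" and R: "R \<subseteq> bad g g'" "nxt g ` R \<inter> R = {}" "bad g g' - R \<subseteq> nxt g ` R"
    by blast
  note gV = gV[OF pg] and g_eq = g_eq[OF pg] and nxt = nxt[OF pg] and nxt_unique = nxt_unique[OF pg]
  have RV: "R \<subseteq> V" using R(1) unfolding bad_def by auto
  have mR: "m r \<notin> R" if "r \<in> R" for r using that R(1) bad_m[OF pg] by blast
  obtain A where A: "R \<subseteq> A" "A \<subseteq> V" "\<And>v. v \<in> V \<Longrightarrow> m v \<in> A \<longleftrightarrow> v \<notin> A" using representatives[OF RV mR] by metis
  have finA: "finite A" using A(2) finV finite_subset by blast
  define h where "h q = g (c q)" for q
  \<comment> \<open>\<open>nl q\<close> is the vertex after \<open>h q\<close> and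
    \<open>ot q\<close> the other end of the edge used at \<open>c q\<close>. Values of
    \<open>nxt g\<close> on \<open>R\<close> have given away their \<open>g'\<close> edge at
    \<open>h q\<close> and received the \<open>g\<close> edge there.\<close>
  define nl where "nl q = (if q \<in> nxt g ` R then g (h q) else g' (h q))" for q
  define ot where "ot q = (if m q \<in> R then g' (c q) else g (c q))" for q
  have hV: "h q \<in> V" if "q \<in> V" for q using that gV cV unfolding h_def by blast
  have h_eq: "h q = h t \<longleftrightarrow> q = t" if "q \<in> V" "t \<in> V" for q t using that g_eq(1) c_eq cV unfolding h_def by metis
  have hn: "h (nxt g q) = c (m q)" if "q \<in> V" for q using nxt(2)[OF that] unfolding h_def .
  have badR: "g' (h r) = h (m r)" if "r \<in> R" for r using that R(1) unfolding bad_def h_def by auto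
  have nR: "r \<notin> nxt g ` R" if "r \<in> R" for r using that R(2) by blast
  have bh: "bij_betw h V V" using bij_h[OF pg] unfolding h_def .

  \<comment> \<open>Rerouting exchanges \<open>g\<close> and \<open>g'\<close> exactly at the
    vertices of \<open>W\<close>, so the edges of \<open>X\<close> are still used once each.\<close>
  have sumX: "(\<Sum>q\<in>V. {#{h q, nl q}#}) + (\<Sum>q\<in>V. {#{c q, ot q}#}) = X"
  proof -
    define W where "W = (\<lambda>t. c (m t)) ` R"
    have 1: "q \<in> nxt g ` R \<longleftrightarrow> h q \<in> W" if "q \<in> V" for q
      using that RV nxt_unique[of _ q] unfolding W_def h_def by blast
    have 2: "m q \<in> R \<longleftrightarrow> c q \<in> W" if "q \<in> V" for q
    proof -
      have "c q \<in> W \<longleftrightarrow> (\<exists>t\<in>R. q = m t)" using that RV c_eq mV unfolding W_def by blast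
      then show ?thesis using that RV mm by (metis subsetD)
    qed
    have "(\<Sum>q\<in>V. {#{h q, nl q}#}) = (\<Sum>q\<in>V. {#{h q, if h q \<in> W then g (h q) else g' (h q)}#})"
      using 1 unfolding nl_def by (intro sum.cong) auto
    also have "\<dots> = (\<Sum>w\<in>V. {#{w, if w \<in> W then g w else g' w}#})"
      by (rule sum.reindex_bij_betw[OF bh])
    finally have s1: "(\<Sum>q\<in>V. {#{h q, nl q}#}) = (\<Sum>w\<in>V. {#{w, if w \<in> W then g w else g' w}#})" .
    have "(\<Sum>q\<in>V. {#{c q, ot q}#}) = (\<Sum>q\<in>V. {#{c q, if c q \<in> W then g' (c q) else g (c q)}#})"
      using 2 unfolding ot_def by (intro sum.cong) auto
    also have "\<dots> = (\<Sum>w\<in>V. {#{w, if w \<in> W then g' w else g w}#})"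
      by (rule sum.reindex_bij_betw[OF c])
    finally have s2: "(\<Sum>q\<in>V. {#{c q, ot q}#}) = (\<Sum>w\<in>V. {#{w, if w \<in> W then g' w else g w}#})" .
    have "(\<Sum>q\<in>V. {#{h q, nl q}#}) + (\<Sum>q\<in>V. {#{c q, ot q}#}) = (\<Sum>w\<in>V. {#{w, g w}#}) + (\<Sum>w\<in>V. {#{w, g' w}#})"
      unfolding s1 s2 sum.distrib[symmetric] by (intro sum.cong) auto
    then show ?thesis using pg unfolding perms_def by simp
  qed

  define B where "B s = rev (tok s) @ tok (m s)" for s
  have B: "B s \<noteq> []" "hd (B s) = c s" "last (B s) = c (m s)" "length (B s) = 2 * k - 4"
      "el (B s) = el (tok s) + el (tok (m s)) + {#{s, m s}#}" if "s \<in> V" for s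
    using tok[OF that] tok[OF mV[OF that]] el_rev_append[of "tok s" "tok (m s)"]
    unfolding B_def by (auto simp: hd_append hd_rev last_append)
  \<comment> \<open>For \<open>s\<close> in \<open>R\<close> the trail closes up at
    \<open>h (m s) = g' (h s)\<close>. Its edge from \<open>c (m s)\<close> to
    \<open>h (m s)\<close> is cut, so the path starts on the far side of \<open>h (m s)\<close>, and
    it leaves \<open>c (m s)\<close> along \<open>g'\<close>.\<close>
  define P where "P s = (if s \<in> R then nl (m s) # (h (m s) # h s # B s) @ [g' (c (m s))]
    else nl s # (h s # B s @ [h (m s)]) @ [nl (m s)])" for s
  define D where "D q = el (tok q) + {#{c q, ot q}#} + {#{h q, nl q}#}" for q
  have elP: "el (P s) = {#{s, m s}#} + D s + D (m s)" if s: "s \<in> A" for s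
  proof -
    have sV: "s \<in> V" using s A by blast
    note Bs = B[OF sV]
    have ms: "m s \<notin> R" "m (m s) = s" using s A sV mm by auto
    show ?thesis
    proof (cases "s \<in> R")
      case True
      have "nl s = h (m s)" using nR[OF True] badR[OF True] unfolding nl_def by simp
      moreover have "ot s = h s" "ot (m s) = g' (c (m s))" using ms True unfolding ot_def h_def by simp_all
      moreover have "P s = nl (m s) # h (m s) # (h s # B s) @ [g' (c (m s))]" using True unfolding P_def by simp
      moreover have "el (nl (m s) # h (m s) # (h s # B s) @ [g' (c (m s))]) =
         {#{nl (m s), h (m s)}#} + {#{h (m s), h s}#} + {#{h s, c s}#} + {#{c (m s), g' (c (m s))}#} + el (B s)"
        using Bs(1-3) el_snoc_last[of "h s # B s"] el_Cons_hd[of "B s" "h s"] by simp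
      ultimately show ?thesis unfolding D_def Bs(5) by (simp add: insert_commute)
    next
      case False
      have "ot s = h s" "ot (m s) = h (m s)" using ms False unfolding ot_def h_def by simp_all
      moreover have "P s = nl s # h s # ((B s @ [h (m s)]) @ [nl (m s)])" using False unfolding P_def by simp
      moreover have "el (nl s # h s # ((B s @ [h (m s)]) @ [nl (m s)])) =
         {#{nl s, h s}#} + {#{h s, c s}#} + {#{c (m s), h (m s)}#} + {#{h (m s), nl (m s)}#} + el (B s)"
        using Bs(1-3) el_Cons_hd[of "(B s @ [h (m s)]) @ [nl (m s)]" "h s"] el_snoc_last[of "B s @ [h (m s)]" "nl (m s)"]
          el_snoc_last[of "B s" "h (m s)"] by simp
      ultimately show ?thesis unfolding D_def Bs(5) by (simp add: insert_commute)
    qed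
  qed
  have VA: "V = A \<union> m ` A" "A \<inter> m ` A = {}"
  proof -
    have "v \<in> m ` A" if "v \<in> V" "v \<notin> A" for v using that A(3)[OF that(1)] mm[OF that(1)] by (metis imageI)
    then show "V = A \<union> m ` A" using A(2) mV by blast
    show "A \<inter> m ` A = {}" using A(2,3) by blast
  qed
  have injm: "inj_on m A" using A(2) m_eq unfolding inj_on_def by blast
  have total: "(\<Sum>s\<in>A. el (P s)) = (\<Sum>v\<in>V. el (tok v)) + X + mset_set ((\<lambda>v. {v, m v}) ` V)"
  proof -
    have "(\<Sum>s\<in>A. el (P s)) = (\<Sum>s\<in>A. {#{s, m s}#}) + (\<Sum>s\<in>A. D s) + (\<Sum>s\<in>A. D (m s))"
      unfolding sum.distrib[symmetric] by (rule sum.cong[OF refl elP])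
    also have "(\<Sum>s\<in>A. D (m s)) = (\<Sum>s\<in>m ` A. D s)" using sum.reindex[OF injm, of D] by simp
    also have "(\<Sum>s\<in>A. {#{s, m s}#}) + (\<Sum>s\<in>A. D s) + (\<Sum>s\<in>m ` A. D s) = (\<Sum>s\<in>A. {#{s, m s}#}) + (\<Sum>s\<in>V. D s)"
      unfolding VA(1) using sum.union_disjoint[OF finA finite_imageI[OF finA] VA(2), of D] by (simp add: add.assoc)
    also have "(\<Sum>s\<in>V. D s) = (\<Sum>v\<in>V. el (tok v)) + X"
      unfolding D_def sum.distrib sumX[symmetric] by (simp add: ac_simps)
    also have "(\<Sum>s\<in>A. {#{s, m s}#}) = mset_set ((\<lambda>v. {v, m v}) ` V)"
    proof -
      have inj: "inj_on (\<lambda>v. {v, m v}) A" using A(2,3) by (auto simp: inj_on_def doubleton_eq_iff)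
      have "(\<lambda>v. {v, m v}) ` V = (\<lambda>v. {v, m v}) ` A"
      proof
        show "(\<lambda>v. {v, m v}) ` V \<subseteq> (\<lambda>v. {v, m v}) ` A"
        proof
          fix e assume "e \<in> (\<lambda>v. {v, m v}) ` V"
          then obtain v where v: "v \<in> V" "e = {v, m v}" by blast
          have "e = {m v, m (m v)}" using v mm by auto
          then show "e \<in> (\<lambda>v. {v, m v}) ` A" using v A(3)[of v] by blast
        qed
      qed (use A(2) in blast)
      then have "mset_set ((\<lambda>v. {v, m v}) ` V) = image_mset (\<lambda>v. {v, m v}) (mset_set A)"
        using image_mset_mset_set[OF inj] by simp
      also have "\<dots> = (\<Sum>s\<in>A. {#{s, m s}#})" using finA by (induction A rule: finite_induct) auto
      finally show ?thesis ..
    qed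
    finally show ?thesis by (simp add: ac_simps)
  qed
  have trP: "trail (P s)" if "s \<in> A" for s
  proof -
    have "el (P s) \<subseteq># (\<Sum>s\<in>A. el (P s))" using finA that by (simp add: sum.remove)
    then show ?thesis using sub unfolding total by (rule subset_mset.order_trans)
  qed

  have eu: "v = w" if "v \<in> V" "w \<in> V" "f = g \<or> f = g'" "f' = g \<or> f' = g'" "{v, f v} = {w, f' w}" for v w f f'
    using that edges_unique[OF pg, of v w] edges_unique(3)[OF pg, of w v] by metis
  \<comment> \<open>Equality would give a trail with \<open>2 * k - 3\<close> vertices and a
    repeated vertex.\<close>
  have hc: "h s \<noteq> c (m s)" if s: "s \<in> V" for s
  proof
    assume eq: "h s = c (m s)"
    have "trail (h s # B s)"
    proof (rule subset_mset.order_trans[OF _ sub])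
      have e: "el (h s # B s) = {#{c s, h s}#} + (el (tok s) + el (tok (m s)) + {#{s, m s}#})"
        using B[OF s] el_Cons_hd[of "B s" "h s"] by (simp add: insert_commute)
      have "{#{c s, h s}#} \<subseteq># X"
      proof -
        have "{#{c s, g (c s)}#} \<subseteq># (\<Sum>v\<in>V. {#{v, g v}#})" using finV cV[OF s] by (simp add: sum.remove)
        then have "{#{c s, g (c s)}#} \<subseteq># (\<Sum>v\<in>V. {#{v, g v}#}) + (\<Sum>v\<in>V. {#{v, g' v}#})"
          by (rule subset_mset.add_increasing2[OF subset_mset.zero_le])
        then show ?thesis using pg unfolding perms_def h_def by simp
      qed
      moreover have "el (tok s) + el (tok (m s)) \<subseteq># (\<Sum>v\<in>V. el (tok v))"
      proof -
        have "(\<Sum>v\<in>V. el (tok v)) = el (tok s) + (el (tok (m s)) + (\<Sum>v\<in>V - {s} - {m s}. el (tok v)))"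
          using finV s mV[OF s] m_neq[OF s] sum.remove[of V s "\<lambda>v. el (tok v)"] sum.remove[of "V - {s}" "m s" "\<lambda>v. el (tok v)"] by simp
        then show ?thesis by (simp add: add.assoc[symmetric])
      qed
      moreover have "{#{s, m s}#} \<subseteq># mset_set ((\<lambda>v. {v, m v}) ` V)"
        using finV s by simp
      ultimately have "(el (tok s) + el (tok (m s))) + {#{c s, h s}#} + {#{s, m s}#} \<subseteq># (\<Sum>v\<in>V. el (tok v)) + X + mset_set ((\<lambda>v. {v, m v}) ` V)"
        by (intro subset_mset.add_mono)
      moreover have "(el (tok s) + el (tok (m s))) + {#{c s, h s}#} + {#{s, m s}#} = el (h s # B s)"
        unfolding e by (simp add: ac_simps)
      ultimately show "el (h s # B s) \<subseteq># (\<Sum>v\<in>V. el (tok v)) + X + mset_set ((\<lambda>v. {v, m v}) ` V)" by simp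
    qed
    then have "distinct (h s # B s)" by (rule short_trail_distinct) (use B[OF s] k3 in auto)
    moreover have "c (m s) \<in> set (B s)" using B[OF s] last_in_set[of "B s"] by simp
    ultimately show False using eq by simp
  qed
  have nl_h: "nl q \<noteq> h (m q)" if q: "q \<in> V" "q \<notin> R" for q
  proof
    assume eq: "nl q = h (m q)"
    show False
    proof (cases "q \<in> nxt g ` R")
      case True
      then have "g (h q) = g (c (m q))" using eq unfolding nl_def h_def by simp
      then have "h q = c (m q)" using g_eq(1) hV q cV mV by blast
      then show False using hc q by blast
    next
      case False
      then have "q \<in> bad g g'" using eq q unfolding nl_def bad_def h_def by simp
      then show False using R(3) q False by blast
    qed
  qed
  \<comment> \<open>For \<open>q = nxt g t\<close> the exchanged end is
    \<open>g (h q) = h (m t) = g' (h t)\<close>, so injectivity of \<open>g'\<close> separates it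
    from the end on the other side.\<close>
  have mixed: "g (h q) \<noteq> g' (h (m q))" if q: "q \<in> V" "m q \<notin> R" "q \<in> nxt g ` R" for q
  proof
    assume eq: "g (h q) = g' (h (m q))"
    obtain t where t: "t \<in> R" "q = nxt g t" using q(3) by blast
    have tV: "t \<in> V" using t RV by blast
    have "g' (h t) = g (h q)" using badR[OF t(1)] hn[OF tV] unfolding t(2) h_def by simp
    then have "h t = h (m q)" using eq g_eq(2) hV tV q(1) mV by metis
    then show False using h_eq tV mV[OF q(1)] t(1) q(2) by blast
  qed
  have distP: "distinct (P s)" if s: "s \<in> A" for s
  proof -
    have sV: "s \<in> V" "m s \<in> V" using s A mV by auto
    have ms: "m s \<notin> R" "m (m s) = s" "s \<noteq> m s" using s A sV mm m_neq[OF sV(1)] by auto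
    note Bs = B[OF sV(1)]
    show ?thesis
    proof (cases "s \<in> R")
      case False
      have P: "P s = nl s # (h s # B s @ [h (m s)]) @ [nl (m s)]" using False unfolding P_def by simp
      show ?thesis unfolding P
      proof (rule trail_ends_distinct)
        show "trail (nl s # (h s # B s @ [h (m s)]) @ [nl (m s)])" using trP[OF s] unfolding P .
        show "length (h s # B s @ [h (m s)]) = 2 * k - 2" using Bs(4) k3 by simp
        show "nl s \<noteq> last (h s # B s @ [h (m s)])" using nl_h[OF sV(1) False] by simp
        show "hd (h s # B s @ [h (m s)]) \<noteq> nl (m s)" using nl_h[OF sV(2) ms(1)] ms(2) by simp
        show "nl s \<noteq> nl (m s)"
          using mixed[of s] mixed[of "m s"] g_eq hV h_eq sV ms False unfolding nl_def by (auto split: if_splits)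
      qed
    next
      case True
      have P: "P s = nl (m s) # (h (m s) # h s # B s) @ [g' (c (m s))]" using True unfolding P_def by simp
      let ?y = "h (m s)" and ?z = "c (m s)"
      have V: "?y \<in> V" "?z \<in> V" using hV cV sV by auto
      have y: "?y = g ?z" unfolding h_def ..
      have yz: "?y \<noteq> ?z" using edges_unique(4)[OF pg V(2,2)] y by simp
      show ?thesis unfolding P
      proof (rule trail_ends_distinct)
        show "trail (nl (m s) # (h (m s) # h s # B s) @ [g' (c (m s))])" using trP[OF s] unfolding P .
        show "length (h (m s) # h s # B s) = 2 * k - 2" using Bs(4) k3 by simp
        have "nl (m s) \<noteq> ?z"
        proof
          assume eq: "nl (m s) = ?z"
          obtain f where f: "f = g \<or> f = g'" "nl (m s) = f ?y" unfolding nl_def by metis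
          have "{?y, f ?y} = {?z, g ?z}" using eq f(2) y by auto
          then show False using eu[OF V f(1), of g] yz by blast
        qed
        then show "nl (m s) \<noteq> last (h (m s) # h s # B s)" using Bs by simp
        show "hd (h (m s) # h s # B s) \<noteq> g' ?z"
          using edges_unique(3)[OF pg V(2,2)] y by auto
        show "nl (m s) \<noteq> g' ?z"
        proof
          assume eq: "nl (m s) = g' ?z"
          show False
          proof (cases "m s \<in> nxt g ` R")
            case False
            then have "g' ?y = g' ?z" using eq unfolding nl_def by simp
            then show False using g_eq(2) V yz by blast
          next
            case nxtR: True
            then obtain t where t: "t \<in> R" "m s = nxt g t" by blast
            have tV: "t \<in> V" using t RV by blast
            have "g (h (m s)) = g' ?z" using eq nxtR unfolding nl_def by simp
            moreover have "g' (h t) = g (h (m s))" using badR[OF t(1)] hn[OF tV] unfolding t(2) h_def by simp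
            ultimately have "h t = c (m s)" using g_eq(2) hV tV V by metis
            then have "t = nxt g s" using nxt_unique[OF sV(1) tV] unfolding h_def by simp
            then show False using R(2) True t(1) by blast
          qed
        qed
      qed
    qed
  qed
  have lenP: "length (P s) = 2 * k" if "s \<in> A" for s
  proof -
    have "s \<in> V" using that A by blast
    from B(4)[OF this] show ?thesis using k3 unfolding P_def by auto
  qed
  have end_nl: "\<exists>s\<in>A. nl q \<in> {hd (P s), last (P s)}" if q: "q \<in> V" "q \<notin> R" for q
  proof (cases "q \<in> A")
    case True
    then show ?thesis using q unfolding P_def by (intro bexI[of _ q]) simp_all
  next
    case False
    then have "m q \<in> A" using A(3) q by blast
    then show ?thesis using mm[OF q(1)] unfolding P_def by (intro bexI[of _ "m q"]) simp_all
  qed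
  \<comment> \<open>Each \<open>v\<close> is \<open>g' (h r)\<close> for some \<open>r\<close>, and
    rerouting only permutes ends: \<open>v\<close> is the end at \<open>nxt g r\<close> if
    \<open>r\<close> is in \<open>R\<close>, the end after \<open>c (m t)\<close> if
    \<open>r = nxt g t\<close> with \<open>t\<close> in \<open>R\<close>, and stays at
    \<open>r\<close> otherwise.\<close>
  have ends: "\<exists>s\<in>A. v \<in> {hd (P s), last (P s)}" if v: "v \<in> V" for v
  proof -
    obtain w where w: "w \<in> V" "v = g' w" using pg v unfolding perms_def bij_betw_def by blast
    obtain r where r: "r \<in> V" "w = h r" using bh w(1) unfolding bij_betw_def by blast
    consider "r \<in> R" | "r \<notin> R" "r \<notin> nxt g ` R" | "r \<in> nxt g ` R" by blast
    then show ?thesis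
    proof cases
      case 1
      have q: "nxt g r \<in> V" "nxt g r \<notin> R" using nxt(1) r(1) 1 R(2) by auto
      have "nl (nxt g r) = g (h (nxt g r))" using 1 unfolding nl_def by simp
      also have "\<dots> = v" using hn[OF r(1)] badR[OF 1] w r unfolding h_def by simp
      finally show ?thesis using end_nl[OF q] by simp
    next
      case 2
      then have "nl r = v" using w r unfolding nl_def by simp
      then show ?thesis using end_nl[OF r(1) 2(1)] by simp
    next
      case 3
      then obtain t where t: "t \<in> R" "r = nxt g t" by blast
      have "v = g' (c (m t))" using hn[of t] t RV w r by auto
      then show ?thesis using t(1) A(1) unfolding P_def by (intro bexI[of _ t]) auto
    qed
  qed
  have "2 * card A = card V"
    unfolding VA(1) using card_Un_disjoint[OF finA finite_imageI[OF finA] VA(2)] card_image[OF injm] by simp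
  then show ?thesis
    by (intro exI[of _ A] exI[of _ P] conjI ballI finA total distP lenP ends)
qed

end

section \<open>The decomposition\<close>

lemma el_map_upt: "el (map g [0..<Suc n]) = (\<Sum>j<n. {#{g j, g (Suc j)}#})"
proof (induction n)
  case (Suc n)
  have "el (map g [0..<Suc (Suc n)]) = el (map g [0..<Suc n] @ [g (Suc n)])" by simp
  also have "\<dots> = add_mset {g n, g (Suc n)} (el (map g [0..<Suc n]))"
    by (subst el_snoc_last) simp_all
  finally show ?case using Suc by simp
qed simp

lemma matching_partner:
  assumes M: "perfect_matching V E M" and E: "\<And>e. e \<in> E \<Longrightarrow> \<exists>u v. e = {u, v} \<and> u \<noteq> v \<and> u \<in> V \<and> v \<in> V"
  obtains m where "\<And>v. v \<in> V \<Longrightarrow> m v \<in> V" "\<And>v. v \<in> V \<Longrightarrow> m (m v) = v" "\<And>v. v \<in> V \<Longrightarrow> m v \<noteq> v" "M = (\<lambda>v. {v, m v}) ` V"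
proof -
  have ME: "M \<subseteq> E" and uniq: "\<And>v. v \<in> V \<Longrightarrow> \<exists>!e. e \<in> M \<and> v \<in> e" using M unfolding perfect_matching_def by auto
  have "\<exists>w. w \<in> V \<and> w \<noteq> v \<and> {v, w} \<in> M" if v: "v \<in> V" for v
  proof -
    obtain e where e: "e \<in> M" "v \<in> e" using uniq[OF v] by blast
    then have "e \<in> E" using ME by blast
    then obtain a b where "e = {a, b}" "a \<noteq> b" "a \<in> V" "b \<in> V" using E by metis
    then show ?thesis using e by (auto simp: insert_commute)
  qed
  then obtain m where m: "\<And>v. v \<in> V \<Longrightarrow> m v \<in> V \<and> m v \<noteq> v \<and> {v, m v} \<in> M" by metis
  have eq: "e = e'" if "e \<in> M" "e' \<in> M" "v \<in> e" "v \<in> e'" "v \<in> V" for e e' v using uniq[OF that(5)] that by blast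
  have mm: "m (m v) = v" if v: "v \<in> V" for v
  proof -
    have "{v, m v} = {m v, m (m v)}" using eq[of "{v, m v}" "{m v, m (m v)}" "m v"] m[OF v] m[of "m v"] by blast
    then show ?thesis using m[OF v] by (auto simp: doubleton_eq_iff)
  qed
  have "M = (\<lambda>v. {v, m v}) ` V"
  proof
    show "(\<lambda>v. {v, m v}) ` V \<subseteq> M" using m by blast
    show "M \<subseteq> (\<lambda>v. {v, m v}) ` V"
    proof
      fix e assume e: "e \<in> M"
      then have "e \<in> E" using ME by blast
      then obtain a b where ab: "e = {a, b}" "a \<in> V" using E by metis
      then have "e = {a, m a}" using eq[OF e, of "{a, m a}" a] m[OF ab(2)] by blast
      then show "e \<in> (\<lambda>v. {v, m v}) ` V" using ab by blast
    qed
  qed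
  then show ?thesis using that[of m] m mm by blast
qed

context girth_graph
begin

lemma initial_paths:
  assumes simple: "simple_graph V E" and reg: "regular V E (2 * k)" and M1: "perfect_matching V E M1" and M2: "perfect_matching V E M2" and disj: "M1 \<inter> M2 = {}"
  shows "\<exists>(A :: 'a set) P. finite A \<and> 2 * card A = card V \<and> (\<Sum>s\<in>A. el (P s)) = mset_set (E - M2) \<and>
     (\<forall>s\<in>A. distinct (P s) \<and> length (P s) = 2 * k) \<and> (\<forall>v\<in>V. \<exists>s\<in>A. v \<in> {hd (P s), last (P s)})"
proof -
  have V: "finite V" and E: "\<And>e. e \<in> E \<Longrightarrow> \<exists>u v. e = {u, v} \<and> u \<noteq> v \<and> u \<in> V \<and> v \<in> V"
    using simple unfolding simple_graph_def by auto
  obtain n where n: "k = n + 3" using k3 by (metis add.commute le_Suc_ex)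
  obtain m where m: "\<And>v. v \<in> V \<Longrightarrow> m v \<in> V" "\<And>v. v \<in> V \<Longrightarrow> m (m v) = v" "\<And>v. v \<in> V \<Longrightarrow> m v \<noteq> v"
    "M1 = (\<lambda>v. {v, m v}) ` V" using matching_partner[OF M1 E] by blast
  have ME: "M1 \<subseteq> E" "M2 \<subseteq> E" using M1 M2 unfolding perfect_matching_def by auto
  define F where "F = E - M1 - M2"
  have "card {e \<in> F. v \<in> e} = 2 * (k - 1)" if v: "v \<in> V" for v
  proof -
    obtain e1 where e1: "e1 \<in> M1" "v \<in> e1" "\<And>e. e \<in> M1 \<Longrightarrow> v \<in> e \<Longrightarrow> e = e1" using M1 v unfolding perfect_matching_def by metis
    obtain e2 where e2: "e2 \<in> M2" "v \<in> e2" "\<And>e. e \<in> M2 \<Longrightarrow> v \<in> e \<Longrightarrow> e = e2" using M2 v unfolding perfect_matching_def by metis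
    have ne: "e1 \<noteq> e2" using e1(1) e2(1) disj by blast
    have "{e \<in> E. v \<in> e} = insert e1 (insert e2 {e \<in> F. v \<in> e})"
    proof
      show "{e \<in> E. v \<in> e} \<subseteq> insert e1 (insert e2 {e \<in> F. v \<in> e})" using e1(3) e2(3) unfolding F_def by blast
      show "insert e1 (insert e2 {e \<in> F. v \<in> e}) \<subseteq> {e \<in> E. v \<in> e}" using e1(1,2) e2(1,2) ME unfolding F_def by blast
    qed
    moreover have "finite {e \<in> F. v \<in> e}" using finE unfolding F_def by simp
    moreover have "e1 \<notin> F" "e2 \<notin> F" using e1(1) e2(1) unfolding F_def by blast+
    ultimately have "card {e \<in> E. v \<in> e} = Suc (Suc (card {e \<in> F. v \<in> e}))" using ne by simp
    then show ?thesis using reg v unfolding regular_def degree_def by simp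
  qed
  from two_factorisation[OF V _ this] obtain f where f: "\<And>i. i < k - 1 \<Longrightarrow> bij_betw (f i) V V"
    and fF: "(\<Sum>i<k - 1. \<Sum>v\<in>V. {#{v, f i v}#}) = mset_set F" using E unfolding F_def by blast
  \<comment> \<open>Each \<open>T j\<close> used here is a bijection, so the trails from all
    vertices together use every edge of the first \<open>n\<close> permutations once.\<close>
  define T where "T j v = fold f [0..<j] v" for j v
  have T0: "T 0 v = v" and TS: "T (Suc j) v = f j (T j v)" for j v unfolding T_def by simp_all
  have Tb: "bij_betw (T j) V V" if "j \<le> k - 1" for j using that
  proof (induction j)
    case 0
    have "T 0 = id" using T0 by (auto simp: fun_eq_iff)
    then show ?case by (simp only: bij_betw_id)
  next
    case (Suc j)
    have "bij_betw (f j \<circ> T j) V V" by (rule bij_betw_trans[of _ _ V]) (use Suc f in auto)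
    moreover have "T (Suc j) = f j \<circ> T j" using TS by (auto simp: fun_eq_iff)
    ultimately show ?case by (simp only:)
  qed
  define tok where "tok v = map (\<lambda>j. T j v) [0..<Suc n]" for v
  define X where "X = (\<Sum>v\<in>V. {#{v, f n v}#}) + (\<Sum>v\<in>V. {#{v, f (Suc n) v}#})"
  have "(\<Sum>v\<in>V. el (tok v)) = (\<Sum>j<n. \<Sum>v\<in>V. {#{T j v, f j (T j v)}#})"
    unfolding tok_def el_map_upt TS by (rule sum.swap)
  also have "\<dots> = (\<Sum>j<n. \<Sum>v\<in>V. {#{v, f j v}#})"
  proof (rule sum.cong[OF refl])
    fix j assume "j \<in> {..<n}"
    then have "bij_betw (T j) V V" using Tb n by simp
    then show "(\<Sum>v\<in>V. {#{T j v, f j (T j v)}#}) = (\<Sum>v\<in>V. {#{v, f j v}#})" by (rule sum.reindex_bij_betw)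
  qed
  finally have tX: "(\<Sum>v\<in>V. el (tok v)) + X = mset_set F"
    unfolding fF[symmetric] X_def n by (simp add: add.assoc)
  have tot: "(\<Sum>v\<in>V. el (tok v)) + X + mset_set ((\<lambda>v. {v, m v}) ` V) = mset_set (E - M2)"
  proof -
    have "mset_set (F \<union> M1) = mset_set F + mset_set M1"
      by (rule mset_set_Union) (use finE ME in \<open>auto simp: F_def intro: finite_subset\<close>)
    moreover have "F \<union> M1 = E - M2" using ME disj unfolding F_def by blast
    ultimately show ?thesis unfolding tX m(4) by simp
  qed
  have subE: "mset_set (E - M2) \<subseteq># mset_set E" using finE by (intro subset_imp_msubset_mset_set) auto
  have XF: "X \<subseteq># mset_set (E - M2)"
    unfolding tot[symmetric] by (simp add: subset_mset.add_increasing2 subset_mset.add_increasing)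
  interpret matched_graph E k V m "T n" X
    by unfold_locales (use V m Tb[of n] n subset_mset.order_trans[OF XF subE] in auto)
  have p: "perms (f n) (f (Suc n))" unfolding perms_def using f n X_def by simp
  have "tok v \<noteq> [] \<and> hd (tok v) = v \<and> last (tok v) = T n v \<and> length (tok v) = k - 2" for v
    unfolding tok_def n by (auto simp: hd_map last_map T0 simp del: upt_Suc)
  from half_paths[OF p this] show ?thesis unfolding tot using subE by blast
qed

text \<open>Initially every path has \<open>2 * k\<close> vertices and at most two slots, which fits
  the bound of \<open>state\<close>. Since \<open>card V\<close> is twice \<open>card A\<close> and
  twice \<open>card M2\<close>, the paths and the second matching give
  \<open>(2 * k - 1) * card A + card A\<close> edges.\<close>

lemma path_decomposition:
  assumes simple: "simple_graph V E" and reg: "regular V E (2 * k)" and M1: "perfect_matching V E M1" and M2: "perfect_matching V E M2" and disj: "M1 \<inter> M2 = {}"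
  obtains A :: "'a set" and P where "finite A" "card E = 2 * k * card A" "(\<Sum>s\<in>A. el (P s)) = mset_set E"
    "\<forall>s\<in>A. distinct (P s) \<and> 2 * k \<le> length (P s) \<and> length (P s) \<le> 2 * k + 2"
proof -
  have V: "finite V" and E: "\<And>e. e \<in> E \<Longrightarrow> \<exists>u v. e = {u, v} \<and> u \<noteq> v \<and> u \<in> V \<and> v \<in> V"
    using simple unfolding simple_graph_def by auto
  obtain A :: "'a set" and P where A: "finite A" "2 * card A = card V" "(\<Sum>s\<in>A. el (P s)) = mset_set (E - M2)"
    and P0: "\<forall>s\<in>A. distinct (P s) \<and> length (P s) = 2 * k"
    and ends: "\<forall>v\<in>V. \<exists>s\<in>A. v \<in> {hd (P s), last (P s)}"
    using initial_paths[OF simple reg M1 M2 disj] by (elim exE conjE) (rule that; assumption)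
  have P: "distinct (P s)" "length (P s) = 2 * k" if "s \<in> A" for s using P0 that by auto
  have ME: "M2 \<subseteq> E" and uniq: "\<And>v. v \<in> V \<Longrightarrow> \<exists>!e. e \<in> M2 \<and> v \<in> e" using M2 unfolding perfect_matching_def by auto
  have EV: "e \<subseteq> V" if "e \<in> E" for e using E[OF that] by auto
  have UV: "\<Union>M2 = V" using uniq ME EV by blast
  have finM: "finite M2" using ME finE finite_subset by blast
  have dM: "e \<inter> e' = {}" if "e \<in> M2" "e' \<in> M2" "e \<noteq> e'" for e e'
  proof -
    have "e \<subseteq> V" using that ME EV by blast
    then show ?thesis using uniq that by blast
  qed
  obtain sl where sl: "\<And>v. v \<in> V \<Longrightarrow> sl v \<in> A \<and> v \<in> {hd (P (sl v)), last (P (sl v))}" using ends by metis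
  have splitE: "mset_set E = mset_set (E - M2) + mset_set M2"
  proof -
    have "mset_set ((E - M2) \<union> M2) = mset_set (E - M2) + mset_set M2" by (rule mset_set_Union) (use finE finM in auto)
    moreover have "(E - M2) \<union> M2 = E" using ME by blast
    ultimately show ?thesis by simp
  qed
  have slots: "card {v \<in> \<Union>M2. sl v = i} \<le> 2" for i
  proof -
    have "{v \<in> \<Union>M2. sl v = i} \<subseteq> {hd (P i), last (P i)}" using sl unfolding UV by auto
    then have "card {v \<in> \<Union>M2. sl v = i} \<le> card {hd (P i), last (P i)}" by (intro card_mono) auto
    also have "\<dots> \<le> 2" by (simp add: card_insert_if)
    finally show ?thesis .
  qed
  have st: "state A M2 P sl" unfolding state_def
  proof (intro conjI ballI impI)
    show "(\<Sum>i\<in>A. el (P i)) + mset_set M2 = mset_set E" using A(3) splitE by simp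
    show "length (P i) + card {v \<in> \<Union>M2. sl v = i} \<le> 2 * k + 2" if "i \<in> A" for i using slots[of i] P(2)[OF that] by simp
  qed (use A ME dM P sl UV in auto)
  have "\<forall>l\<in>loops A M2 sl. P l ! 1 \<in> \<Union>M2"
  proof
    fix l assume "l \<in> loops A M2 sl"
    then have l: "l \<in> A" unfolding loops_def by blast
    have "el (P l) \<subseteq># (\<Sum>s\<in>A. el (P s))" using A(1) l by (simp add: sum.remove)
    then have "trail (P l)" unfolding splitE A(3) by (rule subset_mset.order_trans) simp
    from trail_walk[OF this, of 0] have "{P l ! 0, P l ! Suc 0} \<in> E" using P(2)[OF l] k3 by simp
    then show "P l ! 1 \<in> \<Union>M2" using EV unfolding UV by auto
  qed
  from open_all_loops[OF st this] obtain U P1 sl1 where "state A U P1 sl1" "loops A U sl1 = {}" by blast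
  from add_all_edges[OF this] obtain P2 where st2: "state A {} P2 sl1" by blast
  show ?thesis
  proof (rule that)
    have "card (\<Union>M2) = (\<Sum>e\<in>M2. card e)"
    proof (rule card_Union_disjoint)
      show "finite e" if "e \<in> M2" for e using that ME EV finite_subset[OF _ V] by blast
    qed (use dM in \<open>auto simp: pairwise_def disjnt_def\<close>)
    also have "\<dots> = (\<Sum>e\<in>M2. 2)"
    proof (rule sum.cong[OF refl])
      fix e assume "e \<in> M2"
      then obtain u v where "e = {u, v}" "u \<noteq> v" using E ME by blast
      then show "card e = 2" by simp
    qed
    finally have cM: "card M2 = card A" using A(2) unfolding UV by simp
    have "card (E - M2) = size (\<Sum>s\<in>A. el (P s))" unfolding A(3) by simp
    also have "\<dots> = (\<Sum>s\<in>A. size (el (P s)))" by (rule size_multiset_sum)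
    also have "\<dots> = (\<Sum>s\<in>A. 2 * k - 1)" using P(2) by (intro sum.cong) (auto simp: size_el)
    finally have "card (E - M2) = card A * (2 * k - 1)" by simp
    then have "card E = card A * (2 * k - 1) + card A"
      using cM card_Diff_subset[OF finM ME] card_mono[OF finE ME] by simp
    also have "\<dots> = 2 * k * card A" using k3 by (cases k) (simp_all add: algebra_simps)
    finally show "card E = 2 * k * card A" .
    show "finite A" by (rule A(1))
    show "(\<Sum>s\<in>A. el (P2 s)) = mset_set E" using st2 unfolding state_def by simp
    show "\<forall>s\<in>A. distinct (P2 s) \<and> 2 * k \<le> length (P2 s) \<and> length (P2 s) \<le> 2 * k + 2"
      using st2 unfolding state_def by simp
  qed
qed

end

theorem theorem2:
  fixes k :: nat and V :: "'a set" and E :: "'a set set"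
  assumes "k \<ge> 3" and "class_G k V E"
  shows "\<exists>D. decomposition E D \<and>
           (\<forall>P\<in>D. is_path_in E P \<and> card P \<in> {2*k - 1, 2*k, 2*k + 1}) \<and>
           card {P\<in>D. card P = 2*k - 1} = card {P\<in>D. card P = 2*k + 1}"
proof -
  have simple: "simple_graph V E" using assms(2) unfolding class_G_def by blast
  then have fV: "finite V" and E: "\<And>e. e \<in> E \<Longrightarrow> \<exists>u v. e = {u, v} \<and> u \<noteq> v \<and> u \<in> V \<and> v \<in> V"
    unfolding simple_graph_def by auto
  have reg: "regular V E (2 * k)" and girth: "girth_at_least E (2 * k - 2)" using assms(2) unfolding class_G_def by auto
  obtain M1 M2 where M: "perfect_matching V E M1" "perfect_matching V E M2" "M1 \<inter> M2 = {}"
    using assms(2) unfolding class_G_def by blast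
  have "E \<subseteq> Pow V" using E by auto
  then have finE: "finite E" using fV finite_subset by blast
  interpret girth_graph E k by unfold_locales (use finE E girth assms(1) in \<open>blast+\<close>)
  obtain A :: "'a set" and P where A: "finite A" "card E = 2 * k * card A" "(\<Sum>s\<in>A. el (P s)) = mset_set E"
    and P0: "\<forall>s\<in>A. distinct (P s) \<and> 2 * k \<le> length (P s) \<and> length (P s) \<le> 2 * k + 2"
    by (rule path_decomposition[OF simple reg M]) (rule that; assumption)
  have P: "distinct (P s) \<and> 2 * k \<le> length (P s) \<and> length (P s) \<le> 2 * k + 2" if "s \<in> A" for s using P0 that by blast
  define Q where "Q s = path_edges (P s)" for s
  have Q: "Q s = set_mset (el (P s))" for s unfolding Q_def set_el ..
  have tr: "trail (P s)" if "s \<in> A" for s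
    unfolding A(3)[symmetric] using A(1) that by (simp add: sum.remove)
  have cQ: "card (Q s) = length (P s) - 1" if "s \<in> A" for s
  proof -
    have "count (el (P s)) e = count (mset_set (Q s)) e" for e
    proof (cases "e \<in># el (P s)")
      case True
      then have "1 \<le> count (el (P s)) e" by (simp only: count_greater_eq_one_iff)
      then have "count (el (P s)) e = 1" using sub_E_count[OF tr[OF that], of e] by linarith
      then show ?thesis using True unfolding Q by simp
    next
      case False
      then show ?thesis unfolding Q by (simp add: not_in_iff)
    qed
    then have "el (P s) = mset_set (Q s)" by (rule multiset_eqI)
    then show ?thesis using size_el[of "P s"] by simp
  qed
  have disj: "Q s \<inter> Q t = {}" if st: "s \<in> A" "t \<in> A" "s \<noteq> t" for s t
  proof (rule ccontr)
    assume "Q s \<inter> Q t \<noteq> {}"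
    then obtain e where e: "e \<in># el (P s)" "e \<in># el (P t)" unfolding Q by blast
    have "(\<Sum>s\<in>A. el (P s)) = el (P s) + (el (P t) + (\<Sum>s\<in>A - {s} - {t}. el (P s)))"
      using A(1) st sum.remove[of A s "\<lambda>s. el (P s)"] sum.remove[of "A - {s}" t "\<lambda>s. el (P s)"] by simp
    then have "count (mset_set E) e = count (el (P s)) e + (count (el (P t)) e + count (\<Sum>s\<in>A - {s} - {t}. el (P s)) e)"
      unfolding A(3) by simp
    moreover have "1 \<le> count (el (P s)) e" "1 \<le> count (el (P t)) e" using e by simp_all
    moreover have "count (mset_set E) e \<le> 1" by (rule sub_E_count) simp
    ultimately show False by linarith
  qed
  have ne: "Q s \<noteq> {}" if "s \<in> A" for s
  proof -
    have "0 < card (Q s)" using cQ[OF that] P[OF that] assms(1) by linarith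
    then show ?thesis by auto
  qed
  \<comment> \<open>The edge sets are disjoint and nonempty, so paths can be counted by their
    indices.\<close>
  have inj: "inj_on Q A" using disj ne unfolding inj_on_def by (metis Int_absorb)
  have union: "\<Union>(Q ` A) = E"
  proof -
    have "set_mset (\<Sum>s\<in>A. el (P s)) = \<Union>(Q ` A)" unfolding Q using A(1) by (induction A rule: finite_induct) auto
    then show ?thesis unfolding A(3) using finE by simp
  qed
  have count_card: "card {R \<in> Q ` A. card R = n} = card {s \<in> A. card (Q s) = n}" for n
  proof -
    have "{R \<in> Q ` A. card R = n} = Q ` {s \<in> A. card (Q s) = n}" by auto
    then show ?thesis using inj by (simp add: card_image inj_on_subset)
  qed
  have len: "card (Q s) = 2 * k - 1 \<or> card (Q s) = 2 * k \<or> card (Q s) = 2 * k + 1" if "s \<in> A" for s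
    using cQ[OF that] P[OF that] assms(1) by linarith
  have "card E = (\<Sum>s\<in>A. card (Q s))"
  proof -
    have "card E = size (\<Sum>s\<in>A. el (P s))" unfolding A(3) by simp
    also have "\<dots> = (\<Sum>s\<in>A. size (el (P s)))" by (rule size_multiset_sum)
    finally show ?thesis using cQ by (simp add: size_el)
  qed
  then have "(\<Sum>s\<in>A. card (Q s)) = (\<Sum>s\<in>A. 2 * k)" using A(2) by (simp add: mult.commute)
  \<comment> \<open>Each length plus the indicator of being short equals \<open>2 * k\<close> plus
    the indicator of being long; as the lengths average \<open>2 * k\<close>, the indicators have
    equal sums.\<close>
  moreover have "(\<Sum>s\<in>A. card (Q s) + of_bool (card (Q s) = 2 * k - 1)) = (\<Sum>s\<in>A. 2 * k + of_bool (card (Q s) = 2 * k + 1))"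
    using len assms(1) by (intro sum.cong) auto
  ultimately have "(\<Sum>s\<in>A. of_bool (card (Q s) = 2 * k - 1)) = (\<Sum>s\<in>A. of_bool (card (Q s) = 2 * k + 1) :: nat)"
    by (simp add: sum.distrib)
  then have "card {s \<in> A. card (Q s) = 2 * k - 1} = card {s \<in> A. card (Q s) = 2 * k + 1}"
    using A(1) by (simp add: of_bool_def sum.If_cases Int_def)
  moreover have "is_path_in E (Q s)" if "s \<in> A" for s
    unfolding is_path_in_def is_walk_def Q_def
    using P[OF that] assms(1) trail_walk[OF tr[OF that]] by (intro exI[of _ "P s"]) auto
  moreover have "decomposition E (Q ` A)" unfolding decomposition_def using union disj by blast
  ultimately show ?thesis using len unfolding count_card[symmetric] by (intro exI[of _ "Q ` A"]) auto
qed

end
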